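(* Let $m,n\ge2$ be integers with $mn\ge 6$. Let $w$ be a non-periodic cutting sequence of a bi-infinite linear trajectory on $S_{m,n}$ in a direction $\theta\in\Sigma_0^{m,n}$. Let $(a_k)_{k\ge1}\in\{1,\dots,m-1\}^{\mathbb N}$ and $(b_k)_{k\ge1}\in\{1,\dots,n-1\}^{\mathbb N}$ be the pair of sequences of admissible sectors associated to $w$. Then the sequence $((a_k,b_k))_{k\ge1}$ is the itinerary of $\theta$ under the Bouw–Möller Farey map $\mathcal F_{m,n}$.
   Context: **Surface.** For $a,b\ge 0$ let $P_n(a,b)$ be the equiangular polygon whose edges, indexed by $i\in\mathbb Z/2n$ and traversed counterclockwise, have edge vectors $a(\cos\frac{i\pi}{n},\sin\frac{i\pi}{n})$ for $i$ even and $b(\cos\frac{i\pi}{n},\sin\frac{i\pi}{n})$ for $i$ odd (edges of length $0$ are omitted; for $n=2$ this may degenerate to a two-sided segment). For $0\le k\le m-1$ put $P(k)=P_n(\sin\frac{k\pi}{m},\sin\frac{(k+1)\pi}{m})$ if $n$ is odd or $k$ is even, and $P(k)=P_n(\sin\frac{(k+1)\pi}{m},\sin\frac{k\pi}{m})$ if $n$ is even and $k$ is odd. The right edges of $P(k)$ are those of odd index in the first case and those of even index in the second case. The Bouw–Möller surface $S_{m,n}$ is obtained from $P(0),\dots,P(m-1)$ by gluing, for $0\le k\le m-2$, each right edge of $P(k)$, of index $e$, by translation to the edge of $P(k+1)$ of index $e+n$ mod $2n$. The glued edges are labeled by $L_{m,n}=\{1,\dots,n(m-1)\}$: for $1\le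 r\le m-1$, $1\le s\le n$, the label $(r-1)n+s$ is given to the right edge of $P(r-1)$ of index $e(s)$ mod $2n$, where, if right edges of $P(r-1)$ have odd index, $e(s)=s$ for $s$ odd and $e(s)=1-s$ for $s$ even; if they have even index, $e(s)=s$ for $s$ even and $e(s)=1-s$ for $s$ odd. A bi-infinite linear trajectory is a straight line with constant direction on the surface, defined for all times and never hitting a vertex; its cutting sequence is the bi-infinite sequence of labels of edges crossed (origin arbitrary). $S_{n,m}$, $L_{n,m}$, and all objects below with indices $n,m$, are defined by exchanging $m$ and $n$. **Transition diagrams.** $\Sigma_i^{m,n}=[i\pi/n,(i+1)\pi/n]$. $T_i^{m,n}$ is the directed graph on $L_{m,n}$ with an arrow $p\to q$ iff some trajectory on $S_{m,n}$ with direction in $\Sigma_i^{m,n}$ crosses edge $p$ and then, next, edge $q$. A word is admissible in $T_i^{m,n}$ (or in sector $i$) if it is a path in it. **Derivation.** Explicitly, $T_0^{m,n}$ has vertices at positions $(r,c)$, $1\le r\le m-1$, $1\le c\le n$, the vertex at $(r,c)$ being the label $(r-1)n+c$ if $r$ is odd and $rn+1-c$ if $r$ is even; it has arrows in both directions between $(r,c)$ and $(r,c+1)$, and vertical arrows $(r,c)\to(r+1,c)$ for $c$ odd, $(r+1,c)\to(r,c)$ for $c$ even. The derivation diagram $D_0^{m,n}$ is $T_0^{m,n}$ with horizontal arrows labeled by $L_{n,m}$ (vertical arrows unlabeled): for $c$ odd, $(r,c+1)\to(r,c)$ has label $(c-1)m+r$ and $(r,c)\to(r,c+1)$ has label $(c-1)m+r+1$;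 for $c$ even, $(r,c)\to(r,c+1)$ has label $cm-r+1$ and $(r,c+1)\to(r,c)$ has label $cm-r$. For $w$ admissible in $T_0^{m,n}$, $\mathbf D_{m,n}w\in L_{n,m}^{\mathbb Z}$ is the sequence of arrow labels read along the path $w$ in $D_0^{m,n}$. **Normalization.** For $0\le i\le 2n-1$, $\phi_i^{m,n}$ is the reflection of the plane across the line of angle $(i+1)\pi/(2n)$; it maps $\Sigma_i^{m,n}$ onto $\Sigma_0^{m,n}$. It is taken as a fact, for every $(m,n)$, that $\phi_i^{m,n}$ also gives an affine diffeomorphism of $S_{m,n}$ to itself, obtained by reflecting each polygon of $S_{m,n}$; $\pi_i^{m,n}$ denotes the permutation of the edge labels $L_{m,n}$ that it induces. If $w$ is admissible in $T_i^{m,n}$, $0\le i\le n-1$, then $\mathbf N_{m,n}w=\pi_i^{m,n}w$ (letter by letter), which is admissible in $T_0^{m,n}$ (for non-periodic cutting sequences $i$ is unique). **Sequences of admissible sectors.** Given $w$ as in the claim, put $w^0=w$, $w^1=\mathbf D_{m,n}w^0$ (as $w^0$ is already in the standard sector), $w^{k+1}=\mathbf D_{n,m}(\mathbf N_{n,m}w^k)$ for $k$ odd, and $w^{k+1}=\mathbf D_{m,n}(\mathbf N_{m,n}w^k)$ for even $k\ge2$. The pair of sequences of admissible sectors associated to $w$ is $(a_k),(b_k)$ with $a_k\in\{1,\dots,m-1\}$, $b_k\in\{1,\dots,n-1\}$ such that $w^{2k-1}$ is admissible in $T_{a_k}^{n,m}$ and $w^{2k}$ is admissible in $T_{b_k}^{m,n}$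 for all $k\ge1$ (it exists, and is unique for non-periodic $w$). **Farey map.** Let $\gamma_{m,n}=\begin{pmatrix}-\sqrt{\sin\frac{\pi}{n}/\sin\frac{\pi}{m}} & \dfrac{\cos\frac{\pi}{m}+\cos\frac{\pi}{n}}{\sqrt{\sin\frac{\pi}{m}\sin\frac{\pi}{n}}}\\ 0&\sqrt{\sin\frac{\pi}{m}/\sin\frac{\pi}{n}}\end{pmatrix}$, acting on directions (angles in $[0,\pi]$, the direction of $(\cos\theta,\sin\theta)$ being $\theta$); it maps $\Sigma_0^{m,n}$ onto $[\pi/m,\pi]=\bigcup_{j=1}^{m-1}\Sigma_j^{n,m}$. Define $F_{m,n}:\Sigma_0^{m,n}\to\Sigma_0^{n,m}$ by $F_{m,n}(\theta)=\phi_j^{n,m}\gamma_{m,n}[\theta]$ if $\gamma_{m,n}[\theta]\in\Sigma_j^{n,m}$, $1\le j\le m-1$. The Bouw–Möller Farey map is $\mathcal F_{m,n}=F_{n,m}\circ F_{m,n}:\Sigma_0^{m,n}\to\Sigma_0^{m,n}$. For $1\le i\le m-1$, $1\le j\le n-1$ let $\Sigma(i,j)=\{\theta\in\Sigma_0^{m,n}:\gamma_{m,n}[\theta]\in\Sigma_i^{n,m},\ \gamma_{n,m}[F_{m,n}(\theta)]\in\Sigma_j^{m,n}\}$. The itinerary of $\theta$ is the sequence $((a_k,b_k))_{k\ge1}$ with $\mathcal F_{m,n}^{\,k-1}(\theta)\in\Sigma(a_k,b_k)$ for all $k\ge1$. *)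

theory Defs
  imports "HOL-Analysis.Analysis" "HOL-Combinatorics.Permutations"
begin

text \<open>
  The plane is \<^typ>\<open>complex\<close>. A direction is the angle \<open>\<theta>\<close> of the vector \<^term>\<open>cis \<theta>\<close>.
  Edge indices, which live in \<open>\<int>/2n\<close>, are represented by the naturals below \<open>2 * n\<close>.
\<close>

definition poly_edge :: "nat \<Rightarrow> real \<Rightarrow> real \<Rightarrow> nat \<Rightarrow> complex" where
  "poly_edge n a b i = of_real (if even i then a else b) * cis (real i * pi / real n)"

text \<open>
  The polygon is placed with the initial point of edge 0 at the origin; edge \<open>i\<close> runs from vertex
  \<open>i\<close> to vertex \<open>i + 1\<close>, and vertex \<open>2 * n\<close> is vertex 0 again.
\<close>

definition poly_vertex :: "nat \<Rightarrow> real \<Rightarrow> real \<Rightarrow> nat \<Rightarrow> complex" where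
  "poly_vertex n a b i = (\<Sum>j<i. poly_edge n a b j)"

definition right_odd :: "nat \<Rightarrow> nat \<Rightarrow> bool" where
  "right_odd n k \<longleftrightarrow> odd n \<or> even k"

definition even_len :: "nat \<Rightarrow> nat \<Rightarrow> nat \<Rightarrow> real" where
  "even_len m n k = (if right_odd n k then sin (real k * pi / real m)
                     else sin (real (k + 1) * pi / real m))"

definition odd_len :: "nat \<Rightarrow> nat \<Rightarrow> nat \<Rightarrow> real" where
  "odd_len m n k = (if right_odd n k then sin (real (k + 1) * pi / real m)
                    else sin (real k * pi / real m))"

definition BM_edge :: "nat \<Rightarrow> nat \<Rightarrow> nat \<Rightarrow> nat \<Rightarrow> complex" where
  "BM_edge m n k = poly_edge n (even_len m n k) (odd_len m n k)"

definition BM_vertex :: "nat \<Rightarrow> nat \<Rightarrow> nat \<Rightarrow> nat \<Rightarrow> complex" where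
  "BM_vertex m n k = poly_vertex n (even_len m n k) (odd_len m n k)"

definition right_edge :: "nat \<Rightarrow> nat \<Rightarrow> nat \<Rightarrow> bool" where
  "right_edge n k e \<longleftrightarrow> e < 2 * n \<and> (if right_odd n k then odd e else even e)"

definition glued :: "nat \<Rightarrow> nat \<Rightarrow> nat \<Rightarrow> nat \<Rightarrow> nat \<Rightarrow> nat \<Rightarrow> bool" where
  "glued m n k e k' e' \<longleftrightarrow>
     k + 1 < m \<and> right_edge n k e \<and> k' = k + 1 \<and> e' = (e + n) mod (2 * n)"

text \<open>The index \<open>1 - s\<close> modulo \<open>2 * n\<close> is written \<open>2 * n + 1 - s\<close> to avoid truncated subtraction.\<close>

definition label_index :: "nat \<Rightarrow> nat \<Rightarrow> nat \<Rightarrow> nat" where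
  "label_index n k s =
     (if right_odd n k \<longleftrightarrow> odd s then s else 2 * n + 1 - s) mod (2 * n)"

definition labels :: "nat \<Rightarrow> nat \<Rightarrow> nat set" where
  "labels m n = {1..n * (m - 1)}"

definition right_label :: "nat \<Rightarrow> nat \<Rightarrow> nat \<Rightarrow> nat \<Rightarrow> nat \<Rightarrow> bool" where
  "right_label m n k e l \<longleftrightarrow>
     (\<exists>r s. 1 \<le> r \<and> r \<le> m - 1 \<and> 1 \<le> s \<and> s \<le> n \<and>
        k = r - 1 \<and> e = label_index n k s \<and> l = (r - 1) * n + s)"

text \<open>The label of side \<open>e\<close> of polygon \<open>k\<close>; the two sides of a glued edge carry the same label.\<close>

definition side_label :: "nat \<Rightarrow> nat \<Rightarrow> nat \<Rightarrow> nat \<Rightarrow> nat \<Rightarrow> bool" where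
  "side_label m n k e l \<longleftrightarrow>
     right_label m n k e l \<or> (\<exists>k0 e0. glued m n k0 e0 k e \<and> right_label m n k0 e0 l)"

text \<open>
  A trajectory without vertices never runs along an edge, so it is a chain of chords: its
  \<open>j\<close>-th crossing of an edge takes place at time \<open>time T j\<close>, after which it lies in polygon
  \<open>polyg T j\<close> until its next crossing. It enters that polygon through the edge \<open>in_edge T j\<close>, at the
  proportion \<open>in_pos T j\<close> of its length, and leaves it through \<open>out_edge T j\<close>, at \<open>out_pos T j\<close>.
  Chords have positive length except in the two-sided segments that occur for \<open>n = 2\<close>, which are
  entered and left at the same point, through opposite sides.
\<close>

record traj =
  polyg :: "int \<Rightarrow> nat"
  in_edge :: "int \<Rightarrow> nat"
  in_pos :: "int \<Rightarrow> real"
  out_edge :: "int \<Rightarrow> nat"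
  out_pos :: "int \<Rightarrow> real"
  time :: "int \<Rightarrow> real"

definition side_point :: "nat \<Rightarrow> nat \<Rightarrow> nat \<Rightarrow> nat \<Rightarrow> real \<Rightarrow> complex" where
  "side_point m n k e s = BM_vertex m n k e + of_real s * BM_edge m n k e"

definition cross :: "complex \<Rightarrow> complex \<Rightarrow> real" where
  "cross u v = Re u * Im v - Im u * Re v"

text \<open>
  Polygons are traversed counterclockwise, so the outward normal of an edge \<open>v\<close> is \<open>-\<i> * v\<close>, and
  a unit speed motion in direction \<open>d\<close> leaves through \<open>v\<close> iff \<^term>\<open>cross d v > 0\<close>. This also
  excludes the omitted edges \<open>v = 0\<close>. Glued edges are traversed in opposite senses by the two
  polygons, whence the position \<open>1 - s\<close>.
\<close>

definition trajectory :: "nat \<Rightarrow> nat \<Rightarrow> real \<Rightarrow> traj \<Rightarrow> bool" where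
  "trajectory m n \<theta> T \<longleftrightarrow>
     (\<forall>j. polyg T j < m \<and> in_edge T j < 2 * n \<and> out_edge T j < 2 * n \<and>
        0 < in_pos T j \<and> in_pos T j < 1 \<and> 0 < out_pos T j \<and> out_pos T j < 1 \<and>
        cross (cis \<theta>) (BM_edge m n (polyg T j) (in_edge T j)) < 0 \<and>
        cross (cis \<theta>) (BM_edge m n (polyg T j) (out_edge T j)) > 0 \<and>
        time T j \<le> time T (j + 1) \<and>
        side_point m n (polyg T j) (out_edge T j) (out_pos T j) =
          side_point m n (polyg T j) (in_edge T j) (in_pos T j)
            + of_real (time T (j + 1) - time T j) * cis \<theta> \<and>
        (glued m n (polyg T j) (out_edge T j) (polyg T (j + 1)) (in_edge T (j + 1)) \<or>
         glued m n (polyg T (j + 1)) (in_edge T (j + 1)) (polyg T j) (out_edge T j)) \<and>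
        in_pos T (j + 1) = 1 - out_pos T j) \<and>
     (\<forall>B. (\<exists>j. time T j > B) \<and> (\<exists>j. time T j < B))"

type_synonym biword = "int \<Rightarrow> nat"

definition cutting_sequence :: "nat \<Rightarrow> nat \<Rightarrow> real \<Rightarrow> biword \<Rightarrow> bool" where
  "cutting_sequence m n \<theta> w \<longleftrightarrow>
     (\<exists>T. trajectory m n \<theta> T \<and> (\<forall>j. side_label m n (polyg T j) (in_edge T j) (w j)))"

definition periodic :: "biword \<Rightarrow> bool" where
  "periodic w \<longleftrightarrow> (\<exists>p>0. \<forall>j. w (j + p) = w j)"

definition sector :: "nat \<Rightarrow> nat \<Rightarrow> nat \<Rightarrow> real set" where
  "sector m n i = {real i * pi / real n .. real (i + 1) * pi / real n}"

definition arrow :: "nat \<Rightarrow> nat \<Rightarrow> nat \<Rightarrow> nat \<Rightarrow> nat \<Rightarrow> bool" where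
  "arrow m n i p q \<longleftrightarrow>
     (\<exists>\<theta>\<in>sector m n i. \<exists>w j. cutting_sequence m n \<theta> w \<and> w j = p \<and> w (j + 1) = q)"

definition admissible :: "nat \<Rightarrow> nat \<Rightarrow> nat \<Rightarrow> biword \<Rightarrow> bool" where
  "admissible m n i w \<longleftrightarrow> (\<forall>j. arrow m n i (w j) (w (j + 1)))"

definition pos_label :: "nat \<Rightarrow> nat \<Rightarrow> nat \<Rightarrow> nat" where
  "pos_label n r c = (if odd r then (r - 1) * n + c else r * n + 1 - c)"

text \<open>
  Vertices are denoted by their labels, arrows by the labels of their end points: \<open>h_arrow m n p q l\<close>
  is a horizontal arrow from \<open>p\<close> to \<open>q\<close> labeled \<open>l\<close>, and \<open>v_arrow m n p q\<close> a vertical, unlabeled one.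
\<close>

inductive h_arrow :: "nat \<Rightarrow> nat \<Rightarrow> nat \<Rightarrow> nat \<Rightarrow> nat \<Rightarrow> bool" for m n where
  odd_left: "\<lbrakk>1 \<le> r; r \<le> m - 1; 1 \<le> c; c < n; odd c\<rbrakk> \<Longrightarrow>
    h_arrow m n (pos_label n r (c + 1)) (pos_label n r c) ((c - 1) * m + r)"
| odd_right: "\<lbrakk>1 \<le> r; r \<le> m - 1; 1 \<le> c; c < n; odd c\<rbrakk> \<Longrightarrow>
    h_arrow m n (pos_label n r c) (pos_label n r (c + 1)) ((c - 1) * m + r + 1)"
| even_right: "\<lbrakk>1 \<le> r; r \<le> m - 1; 1 \<le> c; c < n; even c\<rbrakk> \<Longrightarrow>
    h_arrow m n (pos_label n r c) (pos_label n r (c + 1)) (c * m - r + 1)"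
| even_left: "\<lbrakk>1 \<le> r; r \<le> m - 1; 1 \<le> c; c < n; even c\<rbrakk> \<Longrightarrow>
    h_arrow m n (pos_label n r (c + 1)) (pos_label n r c) (c * m - r)"

inductive v_arrow :: "nat \<Rightarrow> nat \<Rightarrow> nat \<Rightarrow> nat \<Rightarrow> bool" for m n where
  down: "\<lbrakk>1 \<le> r; r < m - 1; 1 \<le> c; c \<le> n; odd c\<rbrakk> \<Longrightarrow>
    v_arrow m n (pos_label n r c) (pos_label n (r + 1) c)"
| up: "\<lbrakk>1 \<le> r; r < m - 1; 1 \<le> c; c \<le> n; even c\<rbrakk> \<Longrightarrow>
    v_arrow m n (pos_label n (r + 1) c) (pos_label n r c)"

text \<open>
  \<open>derived m n w u\<close>: \<open>w\<close> is a path in the derivation diagram and \<open>u\<close> is the sequence of arrow labels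
  read along it. The function \<open>f\<close> enumerates the steps of \<open>w\<close> along labeled arrows in order; as the
  origin of a bi-infinite sequence is arbitrary, it is only determined up to a shift.
\<close>

definition derived :: "nat \<Rightarrow> nat \<Rightarrow> biword \<Rightarrow> biword \<Rightarrow> bool" where
  "derived m n w u \<longleftrightarrow>
     (\<forall>j. (\<exists>l. h_arrow m n (w j) (w (j + 1)) l) \<or> v_arrow m n (w j) (w (j + 1))) \<and>
     (\<exists>f :: int \<Rightarrow> int. strict_mono f \<and>
        range f = {j. \<exists>l. h_arrow m n (w j) (w (j + 1)) l} \<and>
        (\<forall>j. h_arrow m n (w (f j)) (w (f j + 1)) (u j)))"

definition phi :: "nat \<Rightarrow> nat \<Rightarrow> nat \<Rightarrow> complex \<Rightarrow> complex" where
  "phi m n i z = cis (real (i + 1) * pi / real n) * cnj z"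

text \<open>
  \<open>induced_perm m n i \<pi>\<close>: reflecting every polygon \<open>k\<close> of the surface by \<^term>\<open>phi m n i\<close>, followed by
  a translation by \<open>t k\<close>, gives a well-defined map of the surface to itself, which takes polygon
  \<open>k\<close> to polygon \<open>\<rho> k\<close>, the edge \<open>e\<close> of polygon \<open>k\<close> to the edge \<open>\<eta> k e\<close> of polygon \<open>\<rho> k\<close>, and the
  edge labeled \<open>l\<close> to the edge labeled \<open>\<pi> l\<close>. Initial and final points of edges are exchanged because
  reflections reverse orientation. Since the clause on labels applies to both sides of each edge, it
  expresses compatibility with the gluings. The permutation is unique unless \<open>m\<close> and \<open>n\<close> are both
  even; in that case there are two, differing by a translation automorphism of the surface, if \<open>i\<close>
  is odd, and none if \<open>i\<close> is even. Hence a relation, whose existence is asked for only where used.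
\<close>

definition induced_perm :: "nat \<Rightarrow> nat \<Rightarrow> nat \<Rightarrow> (nat \<Rightarrow> nat) \<Rightarrow> bool" where
  "induced_perm m n i \<pi> \<longleftrightarrow> \<pi> permutes labels m n \<and>
     (\<exists>\<rho> \<eta> t. \<rho> permutes {..<m} \<and>
        (\<forall>k<m. \<forall>e<2 * n. BM_edge m n k e \<noteq> 0 \<longrightarrow>
           \<eta> k e < 2 * n \<and>
           phi m n i (BM_vertex m n k e) + t k = BM_vertex m n (\<rho> k) (\<eta> k e + 1) \<and>
           phi m n i (BM_vertex m n k (e + 1)) + t k = BM_vertex m n (\<rho> k) (\<eta> k e) \<and>
           (\<forall>l. side_label m n k e l \<longrightarrow> side_label m n (\<rho> k) (\<eta> k e) (\<pi> l))))"

definition normalized :: "nat \<Rightarrow> nat \<Rightarrow> biword \<Rightarrow> biword \<Rightarrow> bool" where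
  "normalized m n w u \<longleftrightarrow>
     (\<exists>i<n. admissible m n i w \<and> (\<exists>\<pi>. induced_perm m n i \<pi> \<and> (\<forall>j. u j = \<pi> (w j))))"

text \<open>The values of \<open>a\<close> and \<open>b\<close> at 0 are irrelevant.\<close>

definition sector_sequences ::
    "nat \<Rightarrow> nat \<Rightarrow> biword \<Rightarrow> (nat \<Rightarrow> nat) \<Rightarrow> (nat \<Rightarrow> nat) \<Rightarrow> bool" where
  "sector_sequences m n w a b \<longleftrightarrow>
     (\<exists>W :: nat \<Rightarrow> biword. W 0 = w \<and> derived m n (W 0) (W 1) \<and>
        (\<forall>k\<ge>1. if odd k then \<exists>u. normalized n m (W k) u \<and> derived n m u (W (k + 1))
                else \<exists>u. normalized m n (W k) u \<and> derived m n u (W (k + 1))) \<and>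
        (\<forall>k\<ge>1. a k \<in> {1..m - 1} \<and> b k \<in> {1..n - 1} \<and>
           admissible n m (a k) (W (2 * k - 1)) \<and> admissible m n (b k) (W (2 * k))))"

definition gamma :: "nat \<Rightarrow> nat \<Rightarrow> complex \<Rightarrow> complex" where
  "gamma m n z = (let sm = sin (pi / real m); sn = sin (pi / real n);
                      cm = cos (pi / real m); cn = cos (pi / real n) in
     Complex (- sqrt (sn / sm) * Re z + (cm + cn) / sqrt (sm * sn) * Im z)
             (sqrt (sm / sn) * Im z))"

text \<open>
  The action of a linear map on directions. For the directions concerned, the image lies in the
  closed upper half plane, so that its \<^const>\<open>Arg\<close> is the angle in \<open>[0, \<pi>]\<close>.
\<close>

definition act :: "(complex \<Rightarrow> complex) \<Rightarrow> real \<Rightarrow> real" where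
  "act g \<theta> = Arg (g (cis \<theta>))"

text \<open>
  Two adjacent sectors share an endpoint, where the two branches differ; we let the smaller index
  win there.
\<close>

definition farey_half :: "nat \<Rightarrow> nat \<Rightarrow> real \<Rightarrow> real" where
  "farey_half m n \<theta> =
     (let j = (LEAST j. 1 \<le> j \<and> j \<le> m - 1 \<and> act (gamma m n) \<theta> \<in> sector n m j)
      in act (phi n m j) (act (gamma m n) \<theta>))"

definition farey :: "nat \<Rightarrow> nat \<Rightarrow> real \<Rightarrow> real" where
  "farey m n = farey_half n m \<circ> farey_half m n"

definition farey_sector :: "nat \<Rightarrow> nat \<Rightarrow> nat \<Rightarrow> nat \<Rightarrow> real set" where
  "farey_sector m n i j =
     {\<theta> \<in> sector m n 0. act (gamma m n) \<theta> \<in> sector n m i \<and>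
                       act (gamma n m) (farey_half m n \<theta>) \<in> sector m n j}"

text \<open>As for sector sequences, the value of the sequence at 0 is irrelevant.\<close>

definition is_itinerary :: "nat \<Rightarrow> nat \<Rightarrow> real \<Rightarrow> (nat \<Rightarrow> nat \<times> nat) \<Rightarrow> bool" where
  "is_itinerary m n \<theta> s \<longleftrightarrow>
     (\<forall>k\<ge>1. (farey m n ^^ (k - 1)) \<theta> \<in> farey_sector m n (fst (s k)) (snd (s k)))"

end

theory Submission
  imports Defs
begin

text \<open>
  Only the asymptotic direction of the words is followed, so no trajectory has to be constructed on
  the derived surfaces. Unfolding the polygons met by a word \<open>w\<close> gives a path \<open>Z\<close> in the plane whose
  steps depend only on the letters crossed; if \<open>w\<close> is the cutting sequence of a trajectory in
  direction \<open>\<theta>\<close>, then \<open>Z\<close> stays at bounded distance from a line of direction \<open>\<theta>\<close>, and non-periodicity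
  makes the distances of \<open>Z\<close> from that line take infinitely many values. Both properties survive
  derivation and normalization: a potential on the vertices of the diagram shows that the path of the
  derived word is the image under \<open>\<gamma>\<close> of the path of the word, up to a correction with finitely many
  values, and a reflection acts on paths in the obvious way.

  If \<open>w\<close> is admissible in sector \<open>i\<close>, then the midpoints of the edges crossed move within the cone
  spanned by the sector, so \<open>\<theta>\<close> lies in the sector. It does not lie on the boundary, because then the
  distance from the line would be monotone up to finitely many values, hence take only finitely many.
  So every direction that occurs lies in the interior of the sector in which the word is admissible,
  which determines the branches of the Farey map.
\<close>

section \<open>Polygons, side labels and crossing vectors\<close>

text \<open>A word does not tell in which sense its edges are crossed. Two consistent readings are
  either equal or opposite at every letter, so a development is determined up to translation and
  sign, and each use of a path has to settle that sign: in the standard sector all letters move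
  weakly to the right, and in a general sector \<theta> is confined to [0,\<pi>]. The path of
  centres may leave the cone of the sector, since a step between centres is orthogonal to the edge
  crossed; hence midpoints of edges are compared instead, at the price of a correction that depends
  on the letter only. Such corrections take finitely many values, which is harmless both for bounded
  distances and for infinite sets of distances. The arrows of a diagram come from trajectories with
  varying directions in a sector, so the cone condition is proved for each arrow separately, without
  reference to the trajectory that realizes it.\<close>

definition label_row :: "nat \<Rightarrow> nat \<Rightarrow> nat" where
  "label_row n l = (l - 1) div n + 1"

definition right_index :: "nat \<Rightarrow> nat \<Rightarrow> nat" where
  "right_index n l = label_index n (label_row n l - 1) ((l - 1) mod n + 1)"

definition outward_normal :: "nat \<Rightarrow> nat \<Rightarrow> complex" where
  "outward_normal n e = - \<i> * cis (real e * pi / real n)"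

definition len :: "nat \<Rightarrow> nat \<Rightarrow> nat \<Rightarrow> nat \<Rightarrow> real" where
  "len m n k e = (if even e then even_len m n k else odd_len m n k)"

text \<open>Distance from the centre to edge \<open>e\<close> in an equiangular polygon with 2n
  sides of alternating lengths, solved from the condition that consecutive edges meet in a vertex.
  For equal lengths it is the apothem of the regular polygon; edges of length 0 are covered
  too.\<close>

definition apothem :: "nat \<Rightarrow> nat \<Rightarrow> nat \<Rightarrow> nat \<Rightarrow> real" where
  "apothem m n k e =
     (len m n k (Suc e) + len m n k e * cos (pi / real n)) / (2 * sin (pi / real n))"

definition centre :: "nat \<Rightarrow> nat \<Rightarrow> nat \<Rightarrow> complex" where
  "centre m n k = of_real (len m n k 0 / 2) - of_real (apothem m n k 0) * outward_normal n 0"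

definition midpoint_offset :: "nat \<Rightarrow> nat \<Rightarrow> nat \<Rightarrow> nat \<Rightarrow> complex" where
  "midpoint_offset m n k e = of_real (apothem m n k e) * outward_normal n e"

lemma sin_pi_div_pos: "n \<ge> 2 \<Longrightarrow> sin (pi / real n) > 0"
proof -
  assume "n \<ge> 2"
  then have "pi / real n < pi" by (simp add: divide_less_eq)
  then show ?thesis using \<open>n \<ge> 2\<close> by (intro sin_gt_zero) auto
qed

lemma BM_edge_len: "BM_edge m n k e = of_real (len m n k e) * cis (real e * pi / real n)"
  by (simp add: BM_edge_def poly_edge_def len_def)

lemma len_add_even: "even d \<Longrightarrow> len m n k (e + d) = len m n k e"
  by (simp add: len_def)

lemma len_cong: "even e = even e' \<Longrightarrow> len m n k e = len m n k e'"
  by (simp add: len_def)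

lemma apothem_cong: "even e = even e' \<Longrightarrow> apothem m n k e = apothem m n k e'"
  by (auto simp add: apothem_def len_def)

lemma len_nonneg:
  assumes "m \<ge> 2" "k < m"
  shows "len m n k e \<ge> 0"
proof -
  have "sin (real j * pi / real m) \<ge> 0" if "j \<le> m" for j
  proof (rule sin_ge_zero)
    show "0 \<le> real j * pi / real m" by simp
    have "real j * pi / real m \<le> real m * pi / real m"
      using that assms by (intro divide_right_mono mult_right_mono) auto
    then show "real j * pi / real m \<le> pi" using assms by simp
  qed
  from this[of k] this[of "k+1"] show ?thesis using assms
    by (auto simp: len_def even_len_def odd_len_def simp del: of_nat_add)
qed

lemma BM_edge_eq_vertex_diff: "BM_edge m n k e = BM_vertex m n k (Suc e) - BM_vertex m n k e"
  by (simp add: BM_edge_def BM_vertex_def poly_vertex_def)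

text \<open>Both sides are the vertex between edges \<open>e\<close> and \<open>e + 1\<close>, seen
  from the centre. Divided by the direction of edge \<open>e\<close>, the real and imaginary parts
  are the two conditions that fix the values of \<open>apothem\<close>.\<close>

lemma midpoint_offset_step:
  assumes "sin (pi / real n) \<noteq> 0"
  shows "midpoint_offset m n k (Suc e) - BM_edge m n k (Suc e) / 2 =
         midpoint_offset m n k e + BM_edge m n k e / 2"
proof -
  define b where "b = pi / real n"
  define L L' where "L = len m n k e" and "L' = len m n k (Suc e)"
  have L2: "len m n k (Suc (Suc e)) = L" by (simp add: L_def len_def)
  have ang: "cis (real (Suc e) * pi / real n) = cis b * cis (real e * pi / real n)"
    by (simp add: cis_mult b_def add_divide_distrib distrib_right)
  have s: "sin b \<noteq> 0" using assms by (simp add: b_def)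
  have sc: "sin b * sin b = 1 - cos b * cos b"
    using sin_cos_squared_add3[of b] by (simp add: algebra_simps)
  have key: "- \<i> * of_real ((L + L' * cos b) / (2 * sin b)) * cis b - of_real L' * cis b / 2
     = - \<i> * of_real ((L' + L * cos b) / (2 * sin b)) + of_real L / 2"
  proof -
    have "(L + L' * cos b) / (2 * sin b) * sin b - L' * cos b / 2 = L / 2"
      using s by (simp add: field_simps)
    moreover have "- ((L + L' * cos b) / (2 * sin b)) * cos b - L' * sin b / 2
        = - ((L' + L * cos b) / (2 * sin b))"
    proof -
      have "- ((L + L' * cos b) / (2 * sin b)) * cos b - L' * sin b / 2
        = - ((L + L' * cos b) * cos b + L' * (sin b * sin b)) / (2 * sin b)"
        using s by (simp add: divide_simps)
      also have "(L + L' * cos b) * cos b + L' * (sin b * sin b) = L' + L * cos b"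
        unfolding sc by (simp add: algebra_simps)
      finally show ?thesis by (simp only: minus_divide_left)
    qed
    ultimately show ?thesis by (auto simp: complex_eq_iff)
  qed
  have "midpoint_offset m n k (Suc e) - BM_edge m n k (Suc e) / 2 =
     (- \<i> * of_real ((L + L' * cos b) / (2 * sin b)) * cis b - of_real L' * cis b / 2)
        * cis (real e * pi / real n)"
    unfolding midpoint_offset_def BM_edge_len outward_normal_def apothem_def L2 ang
      L'_def[symmetric] b_def[symmetric] by (simp add: algebra_simps)
  also have "\<dots> = (- \<i> * of_real ((L' + L * cos b) / (2 * sin b)) + of_real L / 2)
        * cis (real e * pi / real n)"
    unfolding key ..
  also have "\<dots> = midpoint_offset m n k e + BM_edge m n k e / 2"
    unfolding midpoint_offset_def BM_edge_len outward_normal_def apothem_def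
      L'_def[symmetric] L_def[symmetric] b_def[symmetric] by (simp add: algebra_simps)
  finally show ?thesis .
qed

text \<open>Valid for every index, not only below 2n, so that the closing of the polygon and the
  periodicity in the index can be read off from the right-hand side.\<close>

lemma BM_vertex_eq:
  assumes "n \<ge> 2"
  shows "BM_vertex m n k e = centre m n k + midpoint_offset m n k e - BM_edge m n k e / 2"
proof (induction e)
  case 0
  show ?case
    by (simp add: BM_vertex_def poly_vertex_def centre_def midpoint_offset_def BM_edge_len)
next
  case (Suc e)
  have "BM_vertex m n k (Suc e) = BM_vertex m n k e + BM_edge m n k e"
    by (simp add: BM_edge_eq_vertex_diff)
  also have "\<dots> = centre m n k + (midpoint_offset m n k e + BM_edge m n k e / 2)"
    by (simp add: Suc.IH)
  also have "\<dots> = centre m n k + (midpoint_offset m n k (Suc e) - BM_edge m n k (Suc e) / 2)"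
    using sin_pi_div_pos[OF assms] by (subst midpoint_offset_step) auto
  finally show ?case by simp
qed

lemma side_point_eq:
  assumes "n \<ge> 2"
  shows "side_point m n k e s =
    centre m n k + midpoint_offset m n k e + of_real (s - 1/2) * BM_edge m n k e"
  by (simp add: side_point_def BM_vertex_eq[OF assms] algebra_simps)

section \<open>Labels, their rows and the two sides of a glued edge\<close>

lemma label_index_less: "n \<ge> 1 \<Longrightarrow> label_index n k s < 2 * n"
  by (simp add: label_index_def)

lemma even_mod_double: "even ((x::nat) mod (2 * n)) = even x"
  by (metis dvd_mod_iff dvd_triv_left)

lemma even_label_index:
  assumes "1 \<le> s" "s \<le> n"
  shows "even (label_index n k s) = (\<not> right_odd n k)"
proof -
  have "even (2 * n + 1 - s) = odd s" using assms by (simp add: even_diff_nat)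
  then show ?thesis by (auto simp: label_index_def even_mod_double)
qed

lemma label_bounds:
  assumes "l \<in> labels m n" "n \<ge> 1"
  shows "1 \<le> label_row n l" "label_row n l \<le> m - 1" "label_row n l < m"
    "1 \<le> (l - 1) mod n + 1" "(l - 1) mod n + 1 \<le> n"
    "l = (label_row n l - 1) * n + ((l - 1) mod n + 1)"
proof -
  have l: "1 \<le> l" "l \<le> n * (m - 1)" using assms by (auto simp: labels_def)
  then have "l - 1 < (m - 1) * n" by (simp add: mult.commute)
  then have "(l - 1) div n < m - 1" by (simp add: less_mult_imp_div_less)
  then show "label_row n l \<le> m - 1" "label_row n l < m" by (auto simp: label_row_def)
  show "1 \<le> label_row n l" "1 \<le> (l - 1) mod n + 1" by (auto simp: label_row_def)
  show "(l - 1) mod n + 1 \<le> n" using assms by (simp add: Suc_leI)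
  show "l = (label_row n l - 1) * n + ((l - 1) mod n + 1)" using l by (simp add: label_row_def)
qed

lemma label_row_eq:
  assumes "1 \<le> r" "1 \<le> s" "s \<le> n"
  shows "label_row n ((r - 1) * n + s) = r" "((r - 1) * n + s - 1) mod n + 1 = s"
proof -
  obtain r' s' where "r = Suc r'" "s = Suc s'" using assms by (cases r; cases s) auto
  moreover have "(r' * n + s') div n = r'" "(r' * n + s') mod n = s'"
    using assms(3) \<open>s = Suc s'\<close> by simp_all
  ultimately show "label_row n ((r - 1) * n + s) = r" "((r - 1) * n + s - 1) mod n + 1 = s"
    by (simp_all add: label_row_def)
qed

lemma label_in_labels:
  assumes "1 \<le> r" "r \<le> m - 1" "1 \<le> s" "s \<le> n"
  shows "(r - 1) * n + s \<in> labels m n"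
proof -
  have "(r - 1) * n + s \<le> (r - 1) * n + n" using assms by simp
  also have "\<dots> = r * n" using assms by (cases r) auto
  also have "\<dots> \<le> n * (m - 1)" using assms by (simp add: mult.commute)
  finally show ?thesis using assms by (simp add: labels_def)
qed

lemma right_label_iff:
  assumes "n \<ge> 1"
  shows "right_label m n k e l \<longleftrightarrow>
    l \<in> labels m n \<and> k = label_row n l - 1 \<and> e = right_index n l"
proof
  assume "right_label m n k e l"
  then obtain r s where rs: "1 \<le> r" "r \<le> m - 1" "1 \<le> s" "s \<le> n"
    and k: "k = r - 1" "e = label_index n k s" and l: "l = (r - 1) * n + s"
    unfolding right_label_def by blast
  have "label_row n l = r" "(l - 1) mod n + 1 = s" using label_row_eq rs unfolding l by auto
  then show "l \<in> labels m n \<and> k = label_row n l - 1 \<and> e = right_index n l"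
    using label_in_labels[OF rs] k l unfolding right_index_def by simp
next
  assume a: "l \<in> labels m n \<and> k = label_row n l - 1 \<and> e = right_index n l"
  note b = label_bounds[of l m n, OF _ assms]
  show "right_label m n k e l" unfolding right_label_def
    by (rule exI[of _ "label_row n l"], rule exI[of _ "(l - 1) mod n + 1"])
      (use a b in \<open>auto simp: right_index_def\<close>)
qed

lemma right_edge_right_index:
  assumes "l \<in> labels m n" "n \<ge> 1"
  shows "right_edge n (label_row n l - 1) (right_index n l)"
  using even_label_index[OF label_bounds(4,5)[OF assms]] label_index_less[OF assms(2)]
  by (simp add: right_edge_def right_index_def)

lemma right_index_less: "n \<ge> 1 \<Longrightarrow> right_index n l < 2 * n"
  by (simp add: right_index_def label_index_less)

lemma shift_twice:
  fixes e n :: nat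
  assumes "e < 2 * n"
  shows "((e + n) mod (2 * n) + n) mod (2 * n) = e"
proof -
  have "((e + n) mod (2 * n) + n) mod (2 * n) = (e + 2 * n) mod (2 * n)"
    by (metis ab_semigroup_add_class.add_ac(1) mod_add_left_eq mult_2)
  then show ?thesis using assms by simp
qed

lemma side_label_iff:
  assumes "n \<ge> 1"
  shows "side_label m n k e l \<longleftrightarrow> l \<in> labels m n \<and>
    (k = label_row n l - 1 \<and> e = right_index n l \<or>
     k = label_row n l \<and> e = (right_index n l + n) mod (2 * n))" (is "?L = ?R")
proof
  assume ?L
  then show ?R unfolding side_label_def right_label_iff[OF assms] glued_def
    by (auto simp: label_row_def)
next
  assume R: ?R
  then have l: "l \<in> labels m n" by simp
  have "label_row n l - 1 + 1 < m" "label_row n l - 1 + 1 = label_row n l" using label_bounds[OF l assms] by auto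
  then show ?L using R right_edge_right_index[OF l assms]
    unfolding side_label_def right_label_iff[OF assms] glued_def by auto
qed

text \<open>For odd \<open>n\<close> the shift by \<open>n\<close> flips the parity of the index
  while right edges have the same parity in all polygons; for even \<open>n\<close> it keeps the
  parity while right edges alternate. So the partner of a right edge is never a right edge.\<close>

lemma right_edge_shift:
  assumes "right_edge n k e" "n \<ge> 1"
  shows "\<not> right_edge n (Suc k) ((e + n) mod (2 * n))"
  using assms by (auto simp: right_edge_def right_odd_def even_mod_double split: if_splits)

text \<open>A cutting sequence names the edge of entry into each polygon; this recovers the edge of
  exit from the polygon before. No side is both a right edge and the partner of one, which leaves
  the two stated cases.\<close>

lemma glued_side_label:
  assumes "n \<ge> 1" "side_label m n k e l" "e' < 2 * n"
    and "glued m n k' e' k e \<or> glued m n k e k' e'"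
  shows "l \<in> labels m n" 
    "k' = label_row n l - 1 \<and> e' = right_index n l \<and> k = label_row n l \<and> e = (right_index n l + n) mod (2 * n)
     \<or> k' = label_row n l \<and> e' = (right_index n l + n) mod (2 * n) \<and> k = label_row n l - 1 \<and> e = right_index n l"
proof -
  show l: "l \<in> labels m n" using assms(1,2) by (simp add: side_label_iff)
  define r i where "r = label_row n l" and "i = right_index n l"
  note re = right_edge_right_index[OF l assms(1), folded r_def i_def]
  have r: "r \<ge> 1" by (simp add: r_def label_row_def)
  have i: "i < 2 * n" using assms(1) by (simp add: i_def right_index_less)
  consider (R) "k = r - 1" "e = i" | (L) "k = r" "e = (i + n) mod (2 * n)"
    using assms(1,2) by (auto simp: side_label_iff r_def i_def)
  then show "k' = label_row n l - 1 \<and> e' = right_index n l \<and> k = label_row n l \<and> e = (right_index n l + n) mod (2 * n)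
     \<or> k' = label_row n l \<and> e' = (right_index n l + n) mod (2 * n) \<and> k = label_row n l - 1 \<and> e = right_index n l"
    unfolding r_def[symmetric] i_def[symmetric]
  proof cases
    case R
    have "\<not> glued m n k' e' k e"
    proof
      assume g: "glued m n k' e' k e"
      then have "right_edge n k' e'" "Suc k' = r - 1" "i = (e' + n) mod (2 * n)"
        using R by (simp_all add: glued_def)
      then show False using re right_edge_shift[OF _ assms(1)] by metis
    qed
    then have "glued m n k e k' e'" using assms(4) by simp
    then have "k' = r" "e' = (i + n) mod (2 * n)" using R r by (simp_all add: glued_def)
    then show "k' = r - 1 \<and> e' = i \<and> k = r \<and> e = (i + n) mod (2 * n)
     \<or> k' = r \<and> e' = (i + n) mod (2 * n) \<and> k = r - 1 \<and> e = i"
      using R by blast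
  next
    case L
    have "\<not> glued m n k e k' e'"
    proof
      assume "glued m n k e k' e'"
      then have "right_edge n r ((i + n) mod (2 * n))" using L by (simp add: glued_def)
      moreover have "Suc (r - 1) = r" using r by simp
      ultimately show False using re right_edge_shift[OF _ assms(1)] by metis
    qed
    then have g: "glued m n k' e' k e" using assms(4) by simp
    then have k': "k' = r - 1" using L by (simp add: glued_def)
    have "(e' + n) mod (2 * n) = (i + n) mod (2 * n)" using g L by (simp add: glued_def)
    then have "((e' + n) mod (2 * n) + n) mod (2 * n) = ((i + n) mod (2 * n) + n) mod (2 * n)"
      by (simp only:)
    then have "e' = i" unfolding shift_twice[OF assms(3)] shift_twice[OF i] .
    then show "k' = r - 1 \<and> e' = i \<and> k = r \<and> e = (i + n) mod (2 * n)
     \<or> k' = r \<and> e' = (i + n) mod (2 * n) \<and> k = r - 1 \<and> e = i" using L k' by blast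
  qed
qed

lemma cis_shift_index:
  assumes "n \<ge> 1"
  shows "cis (real ((e + n) mod (2 * n)) * pi / real n) = - cis (real e * pi / real n)"
proof -
  define q x where "q = (e + n) div (2 * n)" and "x = (e + n) mod (2 * n)"
  have "2 * n * q + x = e + n" unfolding q_def x_def by (rule mult_div_mod_eq)
  from arg_cong[OF this, of real] have x: "real x = real e + real n - 2 * real n * real q" by simp
  have "real x * pi / real n = real e * pi / real n + pi + - (2 * pi * real q)"
    unfolding x using assms by (simp add: field_simps)
  then have "cis (real x * pi / real n)
    = cis (real e * pi / real n) * cis pi * cis (- (2 * pi * real q))"
    by (simp only: cis_mult)
  moreover have "cis (- (2 * pi * real q)) = 1"
    using cis_multiple_2pi[of "- real q"] by simp
  ultimately show ?thesis unfolding x_def[symmetric] by simp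
qed

text \<open>Step from the centre of polygon r - 1 to that of polygon r when they are unfolded across
  the edge \<open>l\<close> of row r. It is orthogonal to the edge because glued edges share their
  midpoint.\<close>

definition crossing_vector :: "nat \<Rightarrow> nat \<Rightarrow> nat \<Rightarrow> complex" where
  "crossing_vector m n l =
     of_real (sin (real (label_row n l) * pi / real m) * (cos (pi / real m) + cos (pi / real n)) /
       sin (pi / real n)) * outward_normal n (right_index n l)"

lemma len_right_edge:
  assumes "right_edge n k e"
  shows "len m n k e = sin (real (k + 1) * pi / real m)"
    and "len m n k (Suc e) = sin (real k * pi / real m)"
  using assms by (auto simp: right_edge_def len_def even_len_def odd_len_def split: if_splits)

lemma len_left_edge:
  assumes "right_edge n k e" "n \<ge> 1"
  shows "len m n (Suc k) ((e + n) mod (2 * n)) = sin (real (k + 1) * pi / real m)"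
    and "len m n (Suc k) (Suc ((e + n) mod (2 * n))) = sin (real (k + 2) * pi / real m)"
  using right_edge_shift[OF assms] assms
  by (auto simp: right_edge_def len_def even_len_def odd_len_def right_odd_def even_mod_double
      split: if_splits)

lemma sin_three_term: "sin ((x::real) + a) + sin (x - a) = 2 * sin x * cos a"
  by (simp add: sin_add sin_diff)

text \<open>The length of the step is the sum of two apothems. The neighbours of the glued sides
  have lengths sin((r-1)\<pi>/m) and sin((r+1)\<pi>/m), and the three-term relation of sines makes
  their sum a multiple of the common length sin(r\<pi>/m).\<close>

lemma crossing_apothems:
  assumes "l \<in> labels m n" "n \<ge> 2"
  shows "crossing_vector m n l = midpoint_offset m n (label_row n l - 1) (right_index n l)
     - midpoint_offset m n (label_row n l) ((right_index n l + n) mod (2 * n))"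
proof -
  define r e where "r = label_row n l" and "e = right_index n l"
  have n1: "n \<ge> 1" using assms by simp
  have r1: "r \<ge> 1" by (simp add: r_def label_row_def)
  then have r: "Suc (r - 1) = r" "real (r - 1) = real r - 1" "r - 1 + 1 = r" "r - 1 + 2 = r + 1" by auto
  note re = right_edge_right_index[OF assms(1) n1, folded r_def e_def]
  note L1 = len_right_edge[OF re, of m, unfolded r]
  note L2 = len_left_edge[OF re n1, of m, unfolded r]
  have nrm: "outward_normal n ((e + n) mod (2 * n)) = - outward_normal n e"
    by (simp add: outward_normal_def cis_shift_index[OF n1])
  have tri: "sin (real (r + 1) * pi / real m) + sin ((real r - 1) * pi / real m)
     = 2 * sin (real r * pi / real m) * cos (pi / real m)"
    using sin_three_term[of "real r * pi / real m" "pi / real m"]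
    by (simp add: algebra_simps add_divide_distrib diff_divide_distrib)
  have "midpoint_offset m n (r - 1) e - midpoint_offset m n r ((e + n) mod (2 * n))
     = of_real (apothem m n (r - 1) e + apothem m n r ((e + n) mod (2 * n))) * outward_normal n e"
    unfolding midpoint_offset_def nrm by (simp add: algebra_simps)
  also have "apothem m n (r - 1) e + apothem m n r ((e + n) mod (2 * n)) =
     (sin (real (r + 1) * pi / real m) + sin ((real r - 1) * pi / real m)
      + 2 * sin (real r * pi / real m) * cos (pi / real n)) / (2 * sin (pi / real n))"
    unfolding apothem_def L1 L2 by (simp add: add_divide_distrib[symmetric] algebra_simps)
  also have "\<dots> = sin (real r * pi / real m) * (cos (pi / real m) + cos (pi / real n)) / sin (pi / real n)"
    unfolding tri using sin_pi_div_pos[OF assms(2)] by (simp add: field_simps)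
  finally show ?thesis unfolding crossing_vector_def r_def[symmetric] e_def[symmetric] by simp
qed

text \<open>The displacement between the centres does not depend on where the edge is crossed, which is
  why words determine paths in the plane.\<close>

lemma side_point_crossing:
  assumes "l \<in> labels m n" "n \<ge> 2"
  shows "side_point m n (label_row n l - 1) (right_index n l) s - centre m n (label_row n l - 1)
     = side_point m n (label_row n l) ((right_index n l + n) mod (2 * n)) (1 - s) - centre m n (label_row n l)
       + crossing_vector m n l"
proof -
  have n1: "n \<ge> 1" using assms by simp
  have r: "Suc (label_row n l - 1) = label_row n l" "label_row n l - 1 + 1 = label_row n l" by (simp_all add: label_row_def)
  note re = right_edge_right_index[OF assms(1) n1]
  have "BM_edge m n (label_row n l) ((right_index n l + n) mod (2 * n))
     = - BM_edge m n (label_row n l - 1) (right_index n l)"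
    unfolding BM_edge_len cis_shift_index[OF n1]
    using len_right_edge(1)[OF re, of m] len_left_edge(1)[OF re n1, of m] r by simp
  then show ?thesis
    by (simp add: side_point_eq[OF assms(2)] crossing_apothems[OF assms] algebra_simps)
qed

section \<open>Developing a word into the plane\<close>

definition crosses :: "nat \<Rightarrow> nat \<Rightarrow> nat \<Rightarrow> bool" where
  "crosses r k k' \<longleftrightarrow> k = r - 1 \<and> k' = r \<or> k = r \<and> k' = r - 1"

text \<open>Letter \<open>w j\<close> is crossed from polygon \<open>K j\<close> to polygon \<open>K (j + 1)\<close>, and \<open>Z j\<close> is the centre of
  \<open>K j\<close> once the polygons met are unfolded in the plane.\<close>

definition develops ::
    "nat \<Rightarrow> nat \<Rightarrow> biword \<Rightarrow> (int \<Rightarrow> nat) \<Rightarrow> (int \<Rightarrow> complex) \<Rightarrow> bool" where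
  "develops m n w K Z \<longleftrightarrow> (\<forall>j. w j \<in> labels m n \<and> crosses (label_row n (w j)) (K j) (K (j + 1)) \<and>
     Z (j + 1) = Z j + of_real (real (K (j + 1)) - real (K j)) * crossing_vector m n (w j))"

text \<open>The parameters \<open>t j\<close> need not be monotone and are controlled towards the
  future only, which suffices to recover the direction and survives passage to a subsequence. The
  distance bound is for all \<open>j\<close>.\<close>

definition directed :: "(int \<Rightarrow> complex) \<Rightarrow> real \<Rightarrow> bool" where
  "directed Z \<theta> \<longleftrightarrow>
     (\<exists>t C. filterlim t at_top at_top \<and> (\<forall>j. norm (Z j - of_real (t j) * cis \<theta>) \<le> C))"

text \<open>Stands in for non-periodicity, because it is easily transported through derivation.\<close>

definition spread :: "(int \<Rightarrow> complex) \<Rightarrow> real \<Rightarrow> bool" where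
  "spread Z \<theta> \<longleftrightarrow> infinite (range (\<lambda>j. cross (cis \<theta>) (Z j)))"

lemma cross_simps:
  "cross u (v + w) = cross u v + cross u w"
  "cross u (v - w) = cross u v - cross u w"
  "cross u (- v) = - cross u v"
  "cross (- u) v = - cross u v"
  "cross u (of_real c * v) = c * cross u v"
  "cross (of_real c * u) v = c * cross u v"
  by (simp_all add: cross_def algebra_simps)

lemma cross_self [simp]: "cross u u = 0"
  by (simp add: cross_def)

lemma cross_cis: "cross (cis a) (cis b) = sin (b - a)"
  by (simp add: cross_def sin_diff)

lemma abs_cross_le: "\<bar>cross u v\<bar> \<le> 2 * norm u * norm v"
proof -
  have "\<bar>cross u v\<bar> \<le> \<bar>Re u\<bar> * \<bar>Im v\<bar> + \<bar>Im u\<bar> * \<bar>Re v\<bar>"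
    unfolding cross_def by (metis abs_mult abs_triangle_ineq4)
  also have "\<dots> \<le> norm u * norm v + norm u * norm v"
    by (intro add_mono mult_mono abs_Re_le_cmod abs_Im_le_cmod) auto
  finally show ?thesis by simp
qed

lemma cross_parallel:
  assumes "cross v w = 0" "v \<noteq> 0"
  obtains c where "w = of_real c * v"
proof -
  have "Im (cnj v * w) = 0" using assms(1) by (simp add: cross_def)
  then have c: "cnj v * w = of_real (Re (cnj v * w))" by (simp add: complex_eq_iff)
  have "of_real ((norm v)\<^sup>2) * w = v * (cnj v * w)"
    using complex_norm_square[of v] by (simp add: algebra_simps)
  also have "\<dots> = of_real (Re (cnj v * w)) * v" using c by (metis mult.commute)
  finally have "w = of_real (Re (cnj v * w) / (norm v)\<^sup>2) * v"
    using assms(2) by (simp add: field_simps)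
  then show ?thesis using that by blast
qed

text \<open>Each letter joins two fixed polygons, so two chains that agree before it agree after it,
  and conversely. Otherwise they differ everywhere and cross every edge in opposite senses.\<close>

lemma same_or_opposite_crossings:
  fixes K K' :: "int \<Rightarrow> nat"
  assumes "\<And>j. r j \<ge> 1" "\<And>j. crosses (r j) (K j) (K (j + 1))" "\<And>j. crosses (r j) (K' j) (K' (j + 1))"
  shows "K = K' \<or> (\<forall>j. real (K' (j + 1)) - real (K' j) = - (real (K (j + 1)) - real (K j)))"
proof -
  have step: "K (j + 1) = K' (j + 1) \<longleftrightarrow> K j = K' j" for j :: int
    using assms(1)[of j] assms(2)[of j] assms(3)[of j] unfolding crosses_def by auto
  have all: "K j = K' j \<longleftrightarrow> K 0 = K' 0" for j
  proof (induction j rule: int_induct[where k = 0])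
    case (step2 i)
    then show ?case using step[of "i - 1"] by simp
  qed (auto simp: step)
  show ?thesis
  proof (cases "K 0 = K' 0")
    case False
    then have ne: "K j \<noteq> K' j" for j using all by simp
    have "real (K' (j + 1)) - real (K' j) = - (real (K (j + 1)) - real (K j))" for j
      using assms(1)[of j] assms(2)[of j] assms(3)[of j] ne[of j] unfolding crosses_def by auto
    then show ?thesis by simp
  qed (use all in auto)
qed

lemma label_row_ge_1 [simp]: "label_row n l \<ge> 1" "Suc 0 \<le> label_row n l" "0 < label_row n l"
  by (simp_all add: label_row_def)

lemma develops_other_crossings:
  assumes "develops m n w K Z" "\<And>j. crosses (label_row n (w j)) (K' j) (K' (j + 1))"
  shows "develops m n w K' Z \<or> develops m n w K' (\<lambda>j. - Z j)"
proof -
  have "K = K' \<or> (\<forall>j. real (K' (j + 1)) - real (K' j) = - (real (K (j + 1)) - real (K j)))"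
    by (rule same_or_opposite_crossings[of "\<lambda>j. label_row n (w j)"])
      (use assms in \<open>auto simp: develops_def\<close>)
  then show ?thesis
  proof
    assume "K = K'"
    then show ?thesis using assms(1) by simp
  next
    assume "\<forall>j. real (K' (j + 1)) - real (K' j) = - (real (K (j + 1)) - real (K j))"
    then have eq: "of_real (real (K' (j + 1)) - real (K' j)) * c =
        - (of_real (real (K (j + 1)) - real (K j)) * c)" for j and c :: complex
      by (metis mult_minus_left of_real_minus)
    have "develops m n w K' (\<lambda>j. - Z j)"
      using assms unfolding develops_def eq by (simp del: of_real_diff)
    then show ?thesis by simp
  qed
qed

text \<open>Otherwise the height of the corrected path over \<open>v\<close> would tend to minus
  infinity along \<theta>, although its increments are nonnegative.\<close>

lemma directed_cone:
  assumes "directed Z \<theta>" "finite (range \<mu>)"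
    and "\<And>j. 0 \<le> cross v ((Z (j + 1) + \<mu> (j + 1)) - (Z j + \<mu> j))"
  shows "0 \<le> cross v (cis \<theta>)"
proof (rule ccontr)
  assume neg: "\<not> 0 \<le> cross v (cis \<theta>)"
  obtain t C where t: "filterlim t at_top at_top"
    and C: "\<And>j. norm (Z j - of_real (t j) * cis \<theta>) \<le> C"
    using assms(1) unfolding directed_def by blast
  have "bounded (range \<mu>)" using assms(2) by (rule finite_imp_bounded)
  then obtain B where B: "\<And>j. norm (\<mu> j) \<le> B" unfolding bounded_iff by auto
  define h where "h j = cross v (Z j + \<mu> j)" for j
  have mono: "h 0 \<le> h j" if "j \<ge> 0" for j
    using that
  proof (induction j rule: int_ge_induct)
    case (step i)
    then show ?case using assms(3)[of i] by (simp add: h_def cross_simps)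
  qed simp
  define D where "D = 2 * norm v * (C + B)"
  have up: "h j \<le> t j * cross v (cis \<theta>) + D" for j
  proof -
    have "h j = t j * cross v (cis \<theta>) + cross v ((Z j - of_real (t j) * cis \<theta>) + \<mu> j)"
      by (simp add: h_def cross_simps)
    moreover have "cross v ((Z j - of_real (t j) * cis \<theta>) + \<mu> j)
        \<le> 2 * norm v * norm ((Z j - of_real (t j) * cis \<theta>) + \<mu> j)"
      using abs_cross_le[of v "(Z j - of_real (t j) * cis \<theta>) + \<mu> j"] by linarith
    moreover have "\<dots> \<le> D" unfolding D_def
      by (intro mult_left_mono order_trans[OF norm_triangle_ineq] add_mono C B) simp
    ultimately show ?thesis by linarith
  qed
  \<comment> \<open>At parameter \<open>T\<close> the upper bound for the height equals
    \<open>h 0 - 1\<close>.\<close>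
  define T where "T = (h 0 - D - 1) / cross v (cis \<theta>)"
  have "eventually (\<lambda>j. t j \<ge> T \<and> j \<ge> 0) at_top"
    using t by (intro eventually_conj eventually_ge_at_top) (simp add: filterlim_at_top)
  then obtain j where j: "t j \<ge> T" "j \<ge> 0"
    using eventually_happens'[OF trivial_limit_at_top_linorder] by blast
  have "t j * cross v (cis \<theta>) \<le> T * cross v (cis \<theta>)"
    using j neg by (intro mult_right_mono_neg) auto
  also have "\<dots> = h 0 - D - 1" using neg by (simp add: T_def)
  finally show False using up[of j] mono[OF j(2)] by linarith
qed

text \<open>The least positive increment \<epsilon> separates the values of \<open>h\<close>, and a
  bounded interval contains finitely many \<epsilon>-separated points.\<close>

lemma finite_range_monotone_steps:
  fixes h :: "int \<Rightarrow> real"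
  assumes "finite (range (\<lambda>j. h (j + 1) - h j))" "\<And>j. h j \<le> h (j + 1)" "\<And>j. \<bar>h j\<bar> \<le> C"
  shows "finite (range h)"
proof -
  \<comment> \<open>The inserted 1 keeps the set nonempty, so that \<open>Min\<close> is meaningful
    even if all increments vanish.\<close>
  define F where "F = insert 1 (range (\<lambda>j. h (j + 1) - h j) \<inter> {0<..})"
  define \<epsilon> where "\<epsilon> = Min F"
  have F: "finite F" "F \<noteq> {}" "\<forall>x\<in>F. x > 0" using assms(1) by (auto simp: F_def)
  then have eps: "\<epsilon> > 0" by (simp add: \<epsilon>_def)
  have stp: "h (j + 1) = h j \<or> h (j + 1) - h j \<ge> \<epsilon>" for j
  proof (cases "h (j + 1) = h j")
    case False
    then have "h (j + 1) - h j \<in> F" using assms(2)[of j] by (auto simp: F_def)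
    then show ?thesis using F by (simp add: \<epsilon>_def)
  qed simp
  have sep: "h j = h i \<or> h j - h i \<ge> \<epsilon>" if "i \<le> j" for i j
    using that
  proof (induction j rule: int_ge_induct)
    case (step k)
    then show ?case using stp[of k] assms(2)[of k] by linarith
  qed simp
  have inj: "inj_on (\<lambda>x. \<lfloor>x / \<epsilon>\<rfloor>) (range h)"
  proof (rule inj_onI)
    fix x y assume "x \<in> range h" "y \<in> range h" and fl: "\<lfloor>x / \<epsilon>\<rfloor> = \<lfloor>y / \<epsilon>\<rfloor>"
    then obtain i j where ij: "x = h i" "y = h j" by auto
    then have d: "x = y \<or> \<bar>x - y\<bar> \<ge> \<epsilon>" using sep[of i j] sep[of j i] by linarith
    have "\<bar>x / \<epsilon> - y / \<epsilon>\<bar> < 1" using fl by linarith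
    then have "\<bar>x - y\<bar> < \<epsilon>" using eps by (simp add: diff_divide_distrib[symmetric] divide_less_eq)
    then show "x = y" using d by linarith
  qed
  have "(\<lambda>x. \<lfloor>x / \<epsilon>\<rfloor>) ` range h \<subseteq> {\<lfloor>- C / \<epsilon>\<rfloor>..\<lfloor>C / \<epsilon>\<rfloor>}"
  proof clarify
    fix j
    have "- C \<le> h j" "h j \<le> C" using assms(3)[of j] by linarith+
    then have "- C / \<epsilon> \<le> h j / \<epsilon>" "h j / \<epsilon> \<le> C / \<epsilon>"
      using eps divide_right_mono[of "- C" "h j" \<epsilon>] divide_right_mono[of "h j" C \<epsilon>] by auto
    then show "\<lfloor>h j / \<epsilon>\<rfloor> \<in> {\<lfloor>- C / \<epsilon>\<rfloor>..\<lfloor>C / \<epsilon>\<rfloor>}" by (simp add: floor_mono)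
  qed
  then show ?thesis using inj by (meson finite_imageD finite_subset finite_atLeastAtMost_int)
qed

text \<open>Transversally to its direction \<open>Z\<close> is bounded; if it is also monotone with finitely
  many possible increments, then it takes finitely many values.\<close>

lemma not_spread_boundary:
  assumes "directed Z \<theta>" "finite (range \<mu>)" "v \<noteq> 0" "cross v (cis \<theta>) = 0"
    and fin: "finite (range (\<lambda>j. (Z (j + 1) + \<mu> (j + 1)) - (Z j + \<mu> j)))"
    and pos: "\<And>j. 0 \<le> cross v ((Z (j + 1) + \<mu> (j + 1)) - (Z j + \<mu> j))"
  shows "\<not> spread Z \<theta>"
proof -
  obtain c where c: "cis \<theta> = of_real c * v" using cross_parallel assms(3,4) by metis
  obtain t C where C: "\<And>j. norm (Z j - of_real (t j) * cis \<theta>) \<le> C"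
    using assms(1) unfolding directed_def by blast
  have "bounded (range \<mu>)" using assms(2) by (rule finite_imp_bounded)
  then obtain B where B: "\<And>j. norm (\<mu> j) \<le> B" unfolding bounded_iff by auto
  define h where "h j = cross v (Z j + \<mu> j)" for j
  have "finite (range h)"
  proof (rule finite_range_monotone_steps)
    have "range (\<lambda>j. h (j + 1) - h j) = cross v ` range (\<lambda>j. (Z (j + 1) + \<mu> (j + 1)) - (Z j + \<mu> j))"
      by (auto simp: h_def cross_simps image_image)
    then show "finite (range (\<lambda>j. h (j + 1) - h j))" using fin by simp
    show "h j \<le> h (j + 1)" for j using pos[of j] by (simp add: h_def cross_simps)
    show "\<bar>h j\<bar> \<le> 2 * norm v * (C + B)" for j
    proof -
      have "h j = cross v ((Z j - of_real (t j) * cis \<theta>) + \<mu> j)"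
        using assms(4) by (simp add: h_def cross_simps)
      moreover have "2 * norm v * norm ((Z j - of_real (t j) * cis \<theta>) + \<mu> j) \<le> 2 * norm v * (C + B)"
        by (intro mult_left_mono order_trans[OF norm_triangle_ineq] add_mono C B) simp
      ultimately show ?thesis using abs_cross_le order_trans by metis
    qed
  qed
  \<comment> \<open>The transversal coordinate of \<open>Z\<close> is recovered from the height of
    the corrected path and from the correction, both with finite range.\<close>
  have "range (\<lambda>j. cross (cis \<theta>) (Z j)) \<subseteq> (\<lambda>(x, y). c * (x - cross v y)) ` (range h \<times> range \<mu>)"
  proof (clarify)
    fix j
    have "cross (cis \<theta>) (Z j) = c * (h j - cross v (\<mu> j))" by (simp add: c h_def cross_simps)
    then show "cross (cis \<theta>) (Z j) \<in> (\<lambda>(x, y). c * (x - cross v y)) ` (range h \<times> range \<mu>)"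
      by (intro image_eqI[of _ _ "(h j, \<mu> j)"]) auto
  qed
  then show ?thesis unfolding spread_def using \<open>finite (range h)\<close> assms(2)
    by (meson finite_SigmaI finite_imageI finite_subset)
qed

text \<open>A linear map enlarges bounded distances by a bounded factor. Sampling along
  \<open>f\<close> serves derivation, where only some letters are labeled arrows; for reflections
  \<open>f\<close> is the identity.\<close>

lemma directed_transfer:
  assumes "directed Z \<theta>" "linear g" "g (cis \<theta>) = of_real c * cis \<theta>'" "c > 0"
    and "strict_mono f" "finite (range \<mu>)" "\<And>i. Z' i = g (Z (f i)) + \<mu> i"
  shows "directed Z' \<theta>'"
proof -
  obtain t C where t: "filterlim t at_top at_top"
    and C: "\<And>j. norm (Z j - of_real (t j) * cis \<theta>) \<le> C"
    using assms(1) unfolding directed_def by blast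
  obtain B where B: "B > 0" "\<And>z. norm (g z) \<le> B * norm z"
    using linear_bounded_pos[OF assms(2)] by blast
  have "bounded (range \<mu>)" using assms(6) by (rule finite_imp_bounded)
  then obtain D where D: "\<And>j. norm (\<mu> j) \<le> D" unfolding bounded_iff by auto
  have ff: "filterlim f at_top (at_top :: int filter)"
  proof -
    have "f j \<ge> f 0 + j" if "j \<ge> 0" for j
      using that
    proof (induction j rule: int_ge_induct)
      case (step i)
      have "f i < f (i + 1)" using assms(5) by (simp add: strict_mono_def)
      then show ?case using step by simp
    qed simp
    then have ge: "B \<le> f j" if "j \<ge> max 0 (B - f 0)" for B j using that by force
    show ?thesis unfolding filterlim_at_top eventually_at_top_linorder
      using ge by blast
  qed
  have "filterlim (\<lambda>i. c * t (f i)) at_top at_top"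
    by (intro filterlim_tendsto_pos_mult_at_top[OF tendsto_const assms(4)] filterlim_compose[OF t ff])
  moreover have "norm (Z' i - of_real (c * t (f i)) * cis \<theta>') \<le> B * C + D" for i
  proof -
    have "g (of_real (t (f i)) * cis \<theta>) = of_real (t (f i)) * (of_real c * cis \<theta>')"
      using linear_cmul[OF assms(2), of "t (f i)" "cis \<theta>"] assms(3) by (simp add: scaleR_conv_of_real)
    then have "Z' i - of_real (c * t (f i)) * cis \<theta>' = g (Z (f i) - of_real (t (f i)) * cis \<theta>) + \<mu> i"
      by (simp add: assms(7) linear_diff[OF assms(2)])
    moreover have "norm (g (Z (f i) - of_real (t (f i)) * cis \<theta>)) \<le> B * C"
      using B C by (meson less_imp_le mult_left_mono order_trans)
    ultimately show ?thesis using D norm_triangle_mono by metis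
  qed
  ultimately show ?thesis unfolding directed_def by blast
qed

text \<open>Sampling could lose transversal values, so here every \<open>Z j\<close>, not only a
  subsequence, has to reappear in the new path. The factor \<open>d\<close> is the determinant of
  \<open>g\<close> and may be negative.\<close>

lemma spread_transfer:
  assumes "spread Z \<theta>" "g (cis \<theta>) = of_real c * cis \<theta>'"
    and "\<And>z w. cross (g z) (g w) = d * cross z w" "d \<noteq> 0"
    and "finite (range \<mu>)" "\<And>j. \<exists>i. Z' i = g (Z j) + \<mu> j"
  shows "spread Z' \<theta>'"
proof (rule ccontr)
  assume "\<not> spread Z' \<theta>'"
  then have fin: "finite (range (\<lambda>j. cross (cis \<theta>') (Z' j)))" by (simp add: spread_def)
  have "range (\<lambda>j. cross (cis \<theta>) (Z j)) \<subseteq>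
     (\<lambda>(x, y). c * (x - cross (cis \<theta>') y) / d) ` (range (\<lambda>j. cross (cis \<theta>') (Z' j)) \<times> range \<mu>)"
  proof clarify
    fix j
    obtain i where i: "Z' i = g (Z j) + \<mu> j" using assms(6) by blast
    have "d * cross (cis \<theta>) (Z j) = c * cross (cis \<theta>') (g (Z j))"
      using assms(3)[of "cis \<theta>" "Z j"] by (simp add: assms(2) cross_simps)
    also have "\<dots> = c * (cross (cis \<theta>') (Z' i) - cross (cis \<theta>') (\<mu> j))"
      by (simp add: i cross_simps)
    finally have "cross (cis \<theta>) (Z j) = c * (cross (cis \<theta>') (Z' i) - cross (cis \<theta>') (\<mu> j)) / d"
      using assms(4) by (simp add: field_simps)
    then show "cross (cis \<theta>) (Z j) \<in> (\<lambda>(x, y). c * (x - cross (cis \<theta>') y) / d) `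
        (range (\<lambda>j. cross (cis \<theta>') (Z' j)) \<times> range \<mu>)"
      by (intro image_eqI[of _ _ "(cross (cis \<theta>') (Z' i), \<mu> j)"]) auto
  qed
  then have "finite (range (\<lambda>j. cross (cis \<theta>) (Z j)))"
    using fin assms(5) by (meson finite_SigmaI finite_imageI finite_subset)
  then show False using assms(1) by (simp add: spread_def)
qed

section \<open>Cutting sequences\<close>

text \<open>Numbers \<open>s\<close> of matching parity keep their place in 1..n, the others go to 0
  or into n+1..2n-1, so the two kinds never collide.\<close>

lemma label_index_inj:
  assumes "1 \<le> s" "s \<le> n" "1 \<le> s'" "s' \<le> n" "label_index n k s = label_index n k s'" "n \<ge> 2"
  shows "s = s'"
proof -
  define g where "g s = (if right_odd n k \<longleftrightarrow> odd s then s else if s = 1 then 0 else 2 * n + 1 - s)" for s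
  have v: "label_index n k s = g s" if s: "1 \<le> s" "s \<le> n" for s
  proof -
    have lt: "s < 2 * n" using s assms(6) by linarith
    have lt': "2 * n + 1 - s < 2 * n" if "s \<noteq> 1" using that s assms(6) by linarith
    show ?thesis
    proof (cases "right_odd n k \<longleftrightarrow> odd s")
      case True
      then show ?thesis unfolding label_index_def g_def if_P[OF True] by (intro mod_less lt)
    next
      case False
      show ?thesis
      proof (cases "s = 1")
        case True
        then show ?thesis unfolding label_index_def g_def if_not_P[OF False] by simp
      next
        case ne: False
        show ?thesis unfolding label_index_def g_def if_not_P[OF False] if_not_P[OF ne]
          by (intro mod_less lt' ne)
      qed
    qed
  qed
  have c: "g s = s \<or> g s = 0 \<and> s = 1 \<or> g s = 2 * n + 1 - s" for s
    by (simp add: g_def)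
  have "g s = g s'" using assms(5) v[OF assms(1,2)] v[OF assms(3,4)] by metis
  then show ?thesis using c[of s] c[of s'] assms(1-4) by linarith
qed

lemma side_label_unique:
  assumes "side_label m n k e l" "side_label m n k e l'" "n \<ge> 2"
  shows "l = l'"
proof -
  have n1: "n \<ge> 1" using assms(3) by simp
  have l: "l \<in> labels m n" "l' \<in> labels m n" using assms n1 by (auto simp: side_label_iff)
  define i i' where "i = right_index n l" and "i' = right_index n l'"
  have lt: "i < 2 * n" "i' < 2 * n" using right_index_less[OF n1] by (auto simp: i_def i'_def)
  note re = right_edge_right_index[OF l(1) n1, folded i_def]
    right_edge_right_index[OF l(2) n1, folded i'_def]
  have suc: "Suc (label_row n l - 1) = label_row n l" "Suc (label_row n l' - 1) = label_row n l'" by simp_all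
  note sh = right_edge_shift[OF re(1) n1, unfolded suc] right_edge_shift[OF re(2) n1, unfolded suc]
  have eq: "label_row n l - 1 = label_row n l' - 1 \<longleftrightarrow> label_row n l = label_row n l'"
    using label_row_ge_1[of n l] label_row_ge_1[of n l'] by linarith
  consider "label_row n l = label_row n l'" "i = i'"
    | "label_row n l = label_row n l'" "(i + n) mod (2 * n) = (i' + n) mod (2 * n)"
    | "label_row n l' = label_row n l - 1" "i = (i' + n) mod (2 * n)"
    | "label_row n l = label_row n l' - 1" "i' = (i + n) mod (2 * n)"
    using assms(1,2) eq unfolding side_label_iff[OF n1] i_def i'_def by metis
  then have "label_row n l = label_row n l' \<and> i = i'"
  proof cases
    case 2
    then have "((i + n) mod (2 * n) + n) mod (2 * n) = ((i' + n) mod (2 * n) + n) mod (2 * n)"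
      by (simp only:)
    then show ?thesis using 2 unfolding shift_twice[OF lt(1)] shift_twice[OF lt(2)] by blast
  next
    case 3
    then show ?thesis using re(1) sh(2) by metis
  next
    case 4
    then show ?thesis using re(2) sh(1) by metis
  qed simp
  moreover have "(l - 1) mod n + 1 = (l' - 1) mod n + 1"
    by (rule label_index_inj[where k = "label_row n l - 1" and n = n])
      (use calculation label_bounds[OF l(1) n1] label_bounds[OF l(2) n1] assms(3)
       in \<open>auto simp: right_index_def i_def i'_def\<close>)
  ultimately show ?thesis
    using label_bounds(6)[OF l(1) n1] label_bounds(6)[OF l(2) n1] by metis
qed

lemma glued_unique:
  assumes "glued m n k e k1 e1 \<or> glued m n k1 e1 k e" "glued m n k e k2 e2 \<or> glued m n k2 e2 k e"
    and "e1 < 2 * n" "e2 < 2 * n" "n \<ge> 1"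
  shows "k1 = k2 \<and> e1 = e2"
proof -
  have no: "\<not> right_edge n k e" if g: "glued m n k' e' k e" for k' e'
  proof -
    have "right_edge n k' e'" "k = Suc k'" "e = (e' + n) mod (2 * n)"
      using g by (auto simp: glued_def)
    then show ?thesis using right_edge_shift[OF _ assms(5)] by metis
  qed
  have yes: "right_edge n k e" if "glued m n k e k' e'" for k' e'
    using that by (simp add: glued_def)
  show ?thesis
  proof (cases "right_edge n k e")
    case True
    then have "glued m n k e k1 e1" "glued m n k e k2 e2" using no assms(1,2) by blast+
    then show ?thesis by (simp add: glued_def)
  next
    case False
    then have g: "glued m n k1 e1 k e" "glued m n k2 e2 k e" using yes assms(1,2) by blast+
    then have "(e1 + n) mod (2 * n) = (e2 + n) mod (2 * n)" by (simp add: glued_def)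
    then have "((e1 + n) mod (2 * n) + n) mod (2 * n) = ((e2 + n) mod (2 * n) + n) mod (2 * n)"
      by (simp only:)
    then have "e1 = e2" unfolding shift_twice[OF assms(3)] shift_twice[OF assms(4)] .
    then show ?thesis using g by (auto simp: glued_def)
  qed
qed

text \<open>\<open>cross v\<close> is weakly increasing along the vertices of the chain and strictly
  increasing inside the two edges, so equal values allow neither different edges nor different
  positions.\<close>

lemma monotone_chain_unique:
  assumes mono: "\<And>d. lo \<le> d \<Longrightarrow> d \<le> hi \<Longrightarrow> 0 \<le> cross v (BM_edge m n k d)"
    and "lo \<le> e" "e \<le> hi" "lo \<le> f" "f \<le> hi"
    and "0 < cross v (BM_edge m n k e)" "0 < cross v (BM_edge m n k f)"
    and "0 < s" "s < 1" "0 < t" "t < 1"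
    and "cross v (side_point m n k e s) = cross v (side_point m n k f t)"
  shows "e = f \<and> s = t"
proof -
  have step: "cross v (BM_vertex m n k a) \<le> cross v (BM_vertex m n k b)"
    if "lo \<le> a" "a \<le> b" "b \<le> Suc hi" for a b
    using that(2,3)
  proof (induction b rule: dec_induct)
    case (step b)
    then show ?case using mono[of b] that(1)
      by (simp add: BM_edge_eq_vertex_diff cross_simps)
  qed simp
  have less: False if "e < f" "lo \<le> e" "f \<le> hi" "0 < cross v (BM_edge m n k e)"
      "0 < cross v (BM_edge m n k f)" "s < 1" "0 < t"
      "cross v (side_point m n k e s) = cross v (side_point m n k f t)" for e f s t
  proof -
    have "cross v (side_point m n k e s) < cross v (BM_vertex m n k e) + cross v (BM_edge m n k e)"
      using mult_strict_right_mono[OF that(6) that(4)] by (simp add: side_point_def cross_simps)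
    also have "\<dots> = cross v (BM_vertex m n k (Suc e))"
      by (simp add: BM_edge_eq_vertex_diff cross_simps)
    also have "\<dots> \<le> cross v (BM_vertex m n k f)" using that by (intro step) auto
    also have "\<dots> < cross v (side_point m n k f t)"
      using that by (simp add: side_point_def cross_simps)
    finally show False using that by simp
  qed
  have "e = f" using less[of e f s t] less[of f e t s] assms by (metis linorder_neqE_nat)
  moreover have "s = t" using assms \<open>e = f\<close> by (simp add: side_point_def cross_simps)
  ultimately show ?thesis by simp
qed

section \<open>Exit and entry edges of chords in the standard sector\<close>

lemma cross_BM_edge:
  "cross (cis \<theta>) (BM_edge m n k e) = len m n k e * sin (real e * pi / real n - \<theta>)"
  by (simp add: BM_edge_len cross_simps cross_cis)

lemma side_point_add_period:
  assumes "n \<ge> 2"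
  shows "side_point m n k (e + 2 * n) s = side_point m n k e s"
    and "BM_edge m n k (e + 2 * n) = BM_edge m n k e"
proof -
  have c: "cis (real (e + 2 * n) * pi / real n) = cis (real e * pi / real n)"
  proof -
    have "real (e + 2 * n) * pi / real n = real e * pi / real n + 2 * pi"
      using assms by (simp add: field_simps)
    then show ?thesis by (simp add: cis_mult[symmetric])
  qed
  show E: "BM_edge m n k (e + 2 * n) = BM_edge m n k e"
    unfolding BM_edge_len c by (simp add: len_add_even)
  have "apothem m n k (e + 2 * n) = apothem m n k e" by (rule apothem_cong) simp
  then show "side_point m n k (e + 2 * n) s = side_point m n k e s"
    unfolding side_point_eq[OF assms] E midpoint_offset_def outward_normal_def c by simp
qed

text \<open>Edges 1..n can only be left and edges n+1..2n only be entered in a direction of the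
  standard sector. Edge 0 is counted as 2n, which makes both ranges intervals.\<close>

lemma sin_index_sign:
  assumes "n \<ge> 2" "0 \<le> \<theta>" "\<theta> \<le> pi / real n"
  shows "1 \<le> e \<Longrightarrow> e \<le> n \<Longrightarrow> 0 \<le> sin (real e * pi / real n - \<theta>)"
    and "n + 1 \<le> e \<Longrightarrow> e \<le> 2 * n \<Longrightarrow> sin (real e * pi / real n - \<theta>) \<le> 0"
proof -
  have n0: "real n > 0" using assms by simp
  have mul: "x * pi / real n \<le> y * pi / real n" if "x \<le> y" for x y :: real
    using that n0 by (intro divide_right_mono mult_right_mono) auto
  { assume "1 \<le> e" "e \<le> n"
    then have "1 * pi / real n \<le> real e * pi / real n" "real e * pi / real n \<le> real n * pi / real n"
      by (intro mul; simp)+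
    then show "0 \<le> sin (real e * pi / real n - \<theta>)"
      using assms n0 by (intro sin_ge_zero) auto }
  { assume e: "n + 1 \<le> e" "e \<le> 2 * n"
    have "(real n + 1) * pi / real n \<le> real e * pi / real n"
      "real e * pi / real n \<le> (2 * real n) * pi / real n"
      using e by (intro mul; linarith)+
    then have "pi + pi / real n \<le> real e * pi / real n" "real e * pi / real n \<le> 2 * pi"
      using n0 by (simp_all add: distrib_right add_divide_distrib)
    then have "0 \<le> sin (real e * pi / real n - \<theta> - pi)"
      using assms by (intro sin_ge_zero) auto
    then show "sin (real e * pi / real n - \<theta>) \<le> 0" by (simp add: sin_diff) }
qed

text \<open>Edges in an open half turn of directions form a chain that is monotone transversally to
  the trajectory; hence a chord is determined by either of its end points.\<close>

lemma exit_unique: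
  assumes "m \<ge> 2" "n \<ge> 2" "\<theta> \<in> sector m n 0" "k < m" "e < 2 * n" "f < 2 * n"
    and "0 < cross (cis \<theta>) (BM_edge m n k e)" "0 < cross (cis \<theta>) (BM_edge m n k f)"
    and "0 < s" "s < 1" "0 < t" "t < 1"
    and "cross (cis \<theta>) (side_point m n k e s) = cross (cis \<theta>) (side_point m n k f t)"
  shows "e = f \<and> s = t"
proof -
  have th: "0 \<le> \<theta>" "\<theta> \<le> pi / real n" using assms(3) by (auto simp: sector_def)
  note sgn = sin_index_sign[OF assms(2) th]
  have range: "1 \<le> e \<and> e \<le> n" if "0 < cross (cis \<theta>) (BM_edge m n k e)" "e < 2 * n" for e
  proof (rule ccontr)
    assume no: "\<not> ?thesis"
    have "sin (real e * pi / real n - \<theta>) \<le> 0"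
    proof (cases "e = 0")
      case True
      have "pi / real n \<le> pi" using assms(2) by (simp add: divide_le_eq)
      then show ?thesis using True th by (simp add: sin_ge_zero)
    next
      case False
      then show ?thesis using no that(2) by (intro sgn(2)) auto
    qed
    then have "len m n k e * sin (real e * pi / real n - \<theta>) \<le> 0"
      using len_nonneg[OF assms(1,4), of n e] by (rule mult_nonneg_nonpos[rotated])
    then show False using that(1) by (simp add: cross_BM_edge)
  qed
  show ?thesis
  proof (rule monotone_chain_unique[of 1 n])
    fix d assume "1 \<le> d" "d \<le> n"
    then show "0 \<le> cross (cis \<theta>) (BM_edge m n k d)"
      unfolding cross_BM_edge using len_nonneg[OF assms(1,4)] by (intro mult_nonneg_nonneg sgn) auto
  qed (use assms range in auto)
qed

lemma entry_unique:
  assumes "m \<ge> 2" "n \<ge> 2" "\<theta> \<in> sector m n 0" "k < m" "e < 2 * n" "f < 2 * n"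
    and "cross (cis \<theta>) (BM_edge m n k e) < 0" "cross (cis \<theta>) (BM_edge m n k f) < 0"
    and "0 < s" "s < 1" "0 < t" "t < 1"
    and "cross (cis \<theta>) (side_point m n k e s) = cross (cis \<theta>) (side_point m n k f t)"
  shows "e = f \<and> s = t"
proof -
  have th: "0 \<le> \<theta>" "\<theta> \<le> pi / real n" using assms(3) by (auto simp: sector_def)
  note sgn = sin_index_sign[OF assms(2) th]
  \<comment> \<open>Entry edges form a contiguous chain once index 0 is moved to 2n.\<close>
  define up where "up e = (if e = 0 then 2 * n else e)" for e :: nat
  have up: "side_point m n k (up e) s = side_point m n k e s" "BM_edge m n k (up e) = BM_edge m n k e"
    for e s
    using side_point_add_period[OF assms(2), of m k 0] by (auto simp: up_def)
  have range: "n + 1 \<le> up e \<and> up e \<le> 2 * n"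
    if "cross (cis \<theta>) (BM_edge m n k e) < 0" "e < 2 * n" for e
  proof (rule ccontr)
    assume no: "\<not> ?thesis"
    have "0 \<le> sin (real e * pi / real n - \<theta>)"
      using no that(2) by (intro sgn(1)) (auto simp: up_def split: if_splits)
    then have "0 \<le> len m n k e * sin (real e * pi / real n - \<theta>)"
      using len_nonneg[OF assms(1,4), of n e] by (rule mult_nonneg_nonneg[rotated])
    then show False using that(1) by (simp add: cross_BM_edge)
  qed
  have "up e = up f \<and> s = t"
  proof (rule monotone_chain_unique[of "n + 1" "2 * n" "- cis \<theta>"])
    fix d assume "n + 1 \<le> d" "d \<le> 2 * n"
    then have "len m n k d * sin (real d * pi / real n - \<theta>) \<le> 0"
      using len_nonneg[OF assms(1,4)] by (intro mult_nonneg_nonpos sgn) auto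
    then show "0 \<le> cross (- cis \<theta>) (BM_edge m n k d)" by (simp add: cross_BM_edge cross_simps)
  qed (use assms range in \<open>auto simp: up cross_simps\<close>)
  then show ?thesis using assms(5,6) by (auto simp: up_def split: if_splits)
qed

text \<open>The trajectory is laid on the line through the origin, with crossing \<open>j\<close> at
  distance \<open>time T j\<close>; subtracting the exit point relative to the centre of its polygon
  gives the unfolded centre. Letter \<open>j\<close> labels the edge of entry into
  \<open>polyg T j\<close>, so it is crossed from \<open>polyg T (j - 1)\<close>: hence the
  shift.\<close>

lemma trajectory_develops:
  assumes "m \<ge> 2" "n \<ge> 2" "trajectory m n \<theta> T"
    and "\<And>j. side_label m n (polyg T j) (in_edge T j) (w j)"
  defines "p \<equiv> \<lambda>j. side_point m n (polyg T j) (out_edge T j) (out_pos T j) - centre m n (polyg T j)"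
  shows "develops m n w (\<lambda>j. polyg T (j - 1)) (\<lambda>j. of_real (time T j) * cis \<theta> - p (j - 1))"
  unfolding develops_def
proof (intro allI)
  fix j
  have n1: "n \<ge> 1" using assms(2) by simp
  have T: "out_edge T (j - 1) < 2 * n" "in_pos T j = 1 - out_pos T (j - 1)"
    "glued m n (polyg T (j - 1)) (out_edge T (j - 1)) (polyg T j) (in_edge T j) \<or>
     glued m n (polyg T j) (in_edge T j) (polyg T (j - 1)) (out_edge T (j - 1))"
    using assms(3)[unfolded trajectory_def, THEN conjunct1, rule_format, of "j - 1"] by auto
  have T': "side_point m n (polyg T j) (out_edge T j) (out_pos T j) =
      side_point m n (polyg T j) (in_edge T j) (in_pos T j) + of_real (time T (j + 1) - time T j) * cis \<theta>"
    using assms(3) unfolding trajectory_def by blast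
  define q where "q = side_point m n (polyg T j) (in_edge T j) (in_pos T j) - centre m n (polyg T j)"
  have pj: "p j = q + of_real (time T (j + 1) - time T j) * cis \<theta>"
    unfolding p_def q_def T' by simp
  note g = glued_side_label[OF n1 assms(4)[of j] T(1) T(3)]
  define r i where "r = label_row n (w j)" and "i = right_index n (w j)"
  note sp = side_point_crossing[OF g(1) assms(2), folded r_def i_def]
  have r: "r \<ge> 1" by (simp add: r_def)
  have *: "crosses r (polyg T (j - 1)) (polyg T j) \<and>
      p (j - 1) - q = of_real (real (polyg T j) - real (polyg T (j - 1))) * crossing_vector m n (w j)"
    using g(2)[folded r_def i_def]
  proof (elim disjE conjE)
    assume a: "polyg T (j - 1) = r - 1" "out_edge T (j - 1) = i" "polyg T j = r"
      "in_edge T j = (i + n) mod (2 * n)"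
    have "p (j - 1) - q = crossing_vector m n (w j)"
      unfolding p_def q_def a T(2) using sp[of "out_pos T (j - 1)"] by simp
    moreover have "real r - real (r - 1) = 1" using r by simp
    ultimately show ?thesis unfolding a by (simp add: crosses_def del: of_real_diff)
  next
    assume a: "polyg T (j - 1) = r" "out_edge T (j - 1) = (i + n) mod (2 * n)" "polyg T j = r - 1"
      "in_edge T j = i"
    have "p (j - 1) - q = - crossing_vector m n (w j)"
      unfolding p_def q_def a T(2) using sp[of "1 - out_pos T (j - 1)"] by simp
    moreover have "real (r - 1) - real r = - 1" using r by simp
    ultimately show ?thesis unfolding a by (simp add: crosses_def del: of_real_diff)
  qed
  have "of_real (time T (j + 1)) * cis \<theta> - p j = of_real (time T j) * cis \<theta> - p (j - 1) + (p (j - 1) - q)"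
    unfolding pj by (simp add: algebra_simps)
  then show "w j \<in> labels m n \<and> crosses (label_row n (w j)) (polyg T (j - 1)) (polyg T (j + 1 - 1)) \<and>
      of_real (time T (j + 1)) * cis \<theta> - p (j + 1 - 1) = of_real (time T j) * cis \<theta> - p (j - 1) +
       of_real (real (polyg T (j + 1 - 1)) - real (polyg T (j - 1))) * crossing_vector m n (w j)"
    using g(1) * unfolding r_def by simp
qed

lemma trajectory_positions_bounded:
  assumes "n \<ge> 2" "trajectory m n \<theta> T"
  shows "\<exists>C. \<forall>j. norm (side_point m n (polyg T j) (out_edge T j) (out_pos T j) - centre m n (polyg T j)) \<le> C"
proof -
  define S where "S = (\<lambda>(k, e). norm (midpoint_offset m n k e) + norm (BM_edge m n k e)) ` ({..<m} \<times> {..<2 * n})"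
  have fin: "finite S" by (simp add: S_def)
  have "norm (side_point m n (polyg T j) (out_edge T j) (out_pos T j) - centre m n (polyg T j)) \<le> Max S" for j
  proof -
    define k e s where "k = polyg T j" and "e = out_edge T j" and "s = out_pos T j"
    have "k < m" "e < 2 * n" "0 < s" "s < 1"
      using assms(2) unfolding trajectory_def k_def e_def s_def by blast+
    then have "norm (of_real (s - 1/2) * BM_edge m n k e) \<le> 1 * norm (BM_edge m n k e)"
      unfolding norm_mult by (intro mult_right_mono) (auto simp: norm_of_real simp del: of_real_diff)
    then have "norm (midpoint_offset m n k e + of_real (s - 1/2) * BM_edge m n k e)
        \<le> norm (midpoint_offset m n k e) + norm (BM_edge m n k e)"
      by (intro order_trans[OF norm_triangle_ineq]) simp
    also have "\<dots> \<le> Max S" using \<open>k < m\<close> \<open>e < 2 * n\<close> fin by (intro Max_ge) (auto simp: S_def)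
    finally show ?thesis unfolding k_def[symmetric] e_def[symmetric] s_def[symmetric]
      by (simp add: side_point_eq[OF assms(1)])
  qed
  then show ?thesis by blast
qed

lemma trajectory_directed:
  assumes "n \<ge> 2" "trajectory m n \<theta> T"
  shows "directed (\<lambda>j. of_real (time T j) * cis \<theta> -
    (side_point m n (polyg T (j - 1)) (out_edge T (j - 1)) (out_pos T (j - 1)) - centre m n (polyg T (j - 1)))) \<theta>"
proof -
  have step: "time T j \<le> time T (j + 1)" for j using assms(2) unfolding trajectory_def by blast
  have mono: "time T i \<le> time T j" if "i \<le> j" for i j
    using that
  proof (induction j rule: int_ge_induct)
    case (step k)
    then show ?case using \<open>time T k \<le> time T (k + 1)\<close> by linarith
  qed simp
  have "filterlim (time T) at_top at_top"
    unfolding filterlim_at_top eventually_at_top_linorder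
  proof
    fix B
    obtain i where "time T i > B" using assms(2) unfolding trajectory_def by blast
    then show "\<exists>N. \<forall>j\<ge>N. B \<le> time T j" using mono by (meson less_imp_le order_trans)
  qed
  moreover obtain C where "\<forall>j. norm (side_point m n (polyg T j) (out_edge T j) (out_pos T j) - centre m n (polyg T j)) \<le> C"
    using trajectory_positions_bounded[OF assms] by blast
  ultimately show ?thesis unfolding directed_def
    by (intro exI[of _ "time T"] exI[of _ C]) (auto simp: norm_minus_commute)
qed

text \<open>With finitely many transversal values there are finitely many exit states, so one of
  them recurs. Entry and exit states determine each other, as do an exit and the next entry, so the
  recurrence propagates in both time directions and the word is periodic.\<close>

lemma trajectory_spread:
  assumes "m \<ge> 2" "n \<ge> 2" "trajectory m n \<theta> T" "\<theta> \<in> sector m n 0"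
    and lab: "\<And>j. side_label m n (polyg T j) (in_edge T j) (w j)"
    and "\<not> periodic w"
  shows "spread (\<lambda>j. of_real (time T j) * cis \<theta> -
    (side_point m n (polyg T (j - 1)) (out_edge T (j - 1)) (out_pos T (j - 1)) - centre m n (polyg T (j - 1)))) \<theta>"
proof (rule ccontr)
  assume "\<not> ?thesis"
  then have fin: "finite (range (\<lambda>j. cross (cis \<theta>) (of_real (time T j) * cis \<theta> -
    (side_point m n (polyg T (j - 1)) (out_edge T (j - 1)) (out_pos T (j - 1)) - centre m n (polyg T (j - 1))))))"
    (is "finite (range ?c)") by (simp add: spread_def)
  have n1: "n \<ge> 1" using assms(2) by simp
  define X where "X j = (polyg T j, in_edge T j, in_pos T j)" for j
  define Y where "Y j = (polyg T j, out_edge T j, out_pos T j)" for j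
  have T: "polyg T j < m" "in_edge T j < 2 * n" "out_edge T j < 2 * n"
      "0 < in_pos T j" "in_pos T j < 1" "0 < out_pos T j" "out_pos T j < 1"
      "cross (cis \<theta>) (BM_edge m n (polyg T j) (in_edge T j)) < 0"
      "0 < cross (cis \<theta>) (BM_edge m n (polyg T j) (out_edge T j))"
      "glued m n (polyg T j) (out_edge T j) (polyg T (j + 1)) (in_edge T (j + 1)) \<or>
       glued m n (polyg T (j + 1)) (in_edge T (j + 1)) (polyg T j) (out_edge T j)"
      "in_pos T (j + 1) = 1 - out_pos T j" for j
    using assms(3)[unfolded trajectory_def, THEN conjunct1, rule_format, of j] by auto
  have chord: "cross (cis \<theta>) (side_point m n (polyg T j) (out_edge T j) (out_pos T j)) =
      cross (cis \<theta>) (side_point m n (polyg T j) (in_edge T j) (in_pos T j))" for j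
  proof -
    have "side_point m n (polyg T j) (out_edge T j) (out_pos T j) =
      side_point m n (polyg T j) (in_edge T j) (in_pos T j) + of_real (time T (j + 1) - time T j) * cis \<theta>"
      using assms(3) unfolding trajectory_def by blast
    then show ?thesis by (simp only: cross_simps cross_self mult_zero_right add_0_right)
  qed
  have XY: "X i = X j \<longleftrightarrow> Y i = Y j" for i j
  proof
    assume "X i = X j"
    then have e: "polyg T i = polyg T j" "in_edge T i = in_edge T j" "in_pos T i = in_pos T j"
      by (simp_all add: X_def)
    have "out_edge T i = out_edge T j \<and> out_pos T i = out_pos T j"
    proof (rule exit_unique[OF assms(1,2,4) T(1)[of j] T(3) T(3) T(9)[of i, unfolded e(1)] T(9) T(6,7) T(6,7)])
      show "cross (cis \<theta>) (side_point m n (polyg T j) (out_edge T i) (out_pos T i)) =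
        cross (cis \<theta>) (side_point m n (polyg T j) (out_edge T j) (out_pos T j))"
        using chord[of i, unfolded e] chord[of j] by simp
    qed
    then show "Y i = Y j" using e by (simp add: Y_def)
  next
    assume "Y i = Y j"
    then have e: "polyg T i = polyg T j" "out_edge T i = out_edge T j" "out_pos T i = out_pos T j"
      by (simp_all add: Y_def)
    have "in_edge T i = in_edge T j \<and> in_pos T i = in_pos T j"
    proof (rule entry_unique[OF assms(1,2,4) T(1)[of j] T(2) T(2) T(8)[of i, unfolded e(1)] T(8) T(4,5) T(4,5)])
      show "cross (cis \<theta>) (side_point m n (polyg T j) (in_edge T i) (in_pos T i)) =
        cross (cis \<theta>) (side_point m n (polyg T j) (in_edge T j) (in_pos T j))"
        using chord[of i, unfolded e] chord[of j] by simp
    qed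
    then show "X i = X j" using e by (simp add: X_def)
  qed
  have YX: "Y i = Y j \<longleftrightarrow> X (i + 1) = X (j + 1)" for i j
  proof
    assume "Y i = Y j"
    then have e: "polyg T i = polyg T j" "out_edge T i = out_edge T j" "out_pos T i = out_pos T j"
      by (simp_all add: Y_def)
    have "polyg T (i + 1) = polyg T (j + 1) \<and> in_edge T (i + 1) = in_edge T (j + 1)"
      using glued_unique[OF T(10)[of i, unfolded e] T(10)[of j] T(2) T(2) n1] .
    then show "X (i + 1) = X (j + 1)" using e T(11) by (simp add: X_def)
  next
    assume "X (i + 1) = X (j + 1)"
    then have e: "polyg T (i + 1) = polyg T (j + 1)" "in_edge T (i + 1) = in_edge T (j + 1)"
      "in_pos T (i + 1) = in_pos T (j + 1)" by (simp_all add: X_def)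
    have "polyg T i = polyg T j \<and> out_edge T i = out_edge T j"
      using glued_unique[OF T(10)[of i, unfolded e, THEN disj_commute[THEN iffD1]]
          T(10)[of j, THEN disj_commute[THEN iffD1]] T(3) T(3) n1] .
    then show "Y i = Y j" using e T(11)[of i] T(11)[of j] by (simp add: Y_def)
  qed
  \<comment> \<open>On a given exit edge the transversal coordinate determines the position, because
    the edge is not parallel to the trajectory.\<close>
  define G where "G = (\<lambda>(k, e, s). (k, e, cross (cis \<theta>) (side_point m n k e s - centre m n k)))"
  have inj: "inj_on G (range Y)"
  proof (rule inj_onI)
    fix x y assume "x \<in> range Y" "y \<in> range Y" and G: "G x = G y"
    then obtain i j where ij: "x = Y i" "y = Y j" by blast
    have e: "polyg T i = polyg T j" "out_edge T i = out_edge T j"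
      and "cross (cis \<theta>) (side_point m n (polyg T i) (out_edge T i) (out_pos T i) - centre m n (polyg T i))
       = cross (cis \<theta>) (side_point m n (polyg T j) (out_edge T j) (out_pos T j) - centre m n (polyg T j))"
      using G unfolding ij Y_def G_def prod.case prod.inject by blast+
    then have "(out_pos T i - out_pos T j) * cross (cis \<theta>) (BM_edge m n (polyg T j) (out_edge T j)) = 0"
      unfolding e side_point_def cross_simps by (simp add: left_diff_distrib)
    then have "out_pos T i = out_pos T j" using T(9)[of j] by simp
    with e show "x = y" by (simp add: ij Y_def)
  qed
  have "G ` range Y \<subseteq> {..<m} \<times> {..<2 * n} \<times> uminus ` range ?c"
  proof (rule image_subsetI, erule rangeE, hypsubst)
    fix j
    have "cross (cis \<theta>) (side_point m n (polyg T j) (out_edge T j) (out_pos T j) - centre m n (polyg T j))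
       = - ?c (j + 1)" by (simp add: cross_simps)
    then have "G (Y j) = (polyg T j, out_edge T j, - ?c (j + 1))"
      by (simp only: G_def Y_def prod.case)
    moreover have "- ?c (j + 1) \<in> uminus ` range ?c" by (intro imageI rangeI)
    ultimately show "G (Y j) \<in> {..<m} \<times> {..<2 * n} \<times> uminus ` range ?c"
      using T(1,3)[of j] by (simp only: mem_Times_iff fst_conv snd_conv lessThan_iff)
  qed
  then have "finite (G ` range Y)" by (rule finite_subset) (use fin in auto)
  then have "finite (range Y)" using inj by (rule finite_imageD)
  then have "\<not> inj Y" using finite_imageD infinite_UNIV_int by blast
  then obtain i j where ij: "Y i = Y j" "i < j" unfolding inj_on_def by (metis linorder_neqE)
  define p where "p = j - i"
  have "p > 0" using ij by (simp add: p_def)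
  have step: "X (a + p + 1) = X (a + 1) \<longleftrightarrow> X (a + p) = X a" for a
    using XY[of "a + p" a] YX[of "a + p" a] by simp
  have "X (a + p) = X a" for a
  proof (induction a rule: int_induct[where k = i])
    case base
    then show ?case using ij XY by (simp add: p_def)
  next
    case (step1 a)
    then show ?case using step[of a] by (simp add: algebra_simps)
  next
    case (step2 a)
    then show ?case using step[of "a - 1"] by (simp add: algebra_simps)
  qed
  then have "w (a + p) = w a" for a
    using lab[of "a + p"] lab[of a] side_label_unique[OF _ _ assms(2)] by (auto simp: X_def)
  then show False using \<open>p > 0\<close> assms(6) unfolding periodic_def by blast
qed

section \<open>Sectors and directions\<close>

text \<open>The edges of index \<open>e\<close> through which trajectories with direction in sector \<open>i\<close> leave a polygon
  are those with \<open>e \<in> {i + 1..i + n}\<close> modulo \<open>2 * n\<close>.\<close>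

definition exit_index :: "nat \<Rightarrow> nat \<Rightarrow> nat \<Rightarrow> bool" where
  "exit_index n i e \<longleftrightarrow> (int e - int i - 1) mod (2 * int n) < int n"

lemma exit_indexE:
  assumes "exit_index n i e" "n \<ge> 1"
  obtains y q where "1 \<le> y" "y \<le> n" "int e = int i + int y + 2 * int n * q"
proof -
  define b where "b = (int e - int i - 1) mod (2 * int n)"
  have b: "0 \<le> b" "b < int n" using assms by (auto simp: b_def exit_index_def)
  have "2 * int n * ((int e - int i - 1) div (2 * int n)) + b = int e - int i - 1"
    unfolding b_def by (rule mult_div_mod_eq)
  then show ?thesis
    by (intro that[of "nat (b + 1)" "(int e - int i - 1) div (2 * int n)"]) (use b in auto)
qed

text \<open>Entry edges are counted downwards from \<open>i\<close> in view of
  \<open>height_in\<close>, whose reflection turns the offset -x into +x.\<close>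

lemma not_exit_indexE:
  assumes "\<not> exit_index n i e" "n \<ge> 1"
  obtains x q where "x < n" "int e = int i - int x + 2 * int n * q"
proof -
  define b where "b = (int e - int i - 1) mod (2 * int n)"
  have b: "int n \<le> b" "b < 2 * int n" using assms by (auto simp: b_def exit_index_def)
  define d where "d = (int e - int i - 1) div (2 * int n)"
  have "2 * int n * d + b = int e - int i - 1"
    unfolding b_def d_def by (rule mult_div_mod_eq)
  moreover have "2 * int n * (d + 1) = 2 * int n * d + 2 * int n" by (simp add: algebra_simps)
  ultimately show ?thesis
    by (intro that[of "nat (2 * int n - 1 - b)" "d + 1"]) (use b in auto)
qed

lemma exit_index_shift:
  assumes "n \<ge> 1"
  shows "exit_index n i ((e + n) mod (2 * n)) \<longleftrightarrow> \<not> exit_index n i e"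
proof -
  define a where "a = int e - int i - 1"
  define b where "b = a mod (2 * int n)"
  have b: "0 \<le> b" "b < 2 * int n" using assms by (auto simp: b_def)
  have "(int ((e + n) mod (2 * n)) - int i - 1) mod (2 * int n) = (a + int n) mod (2 * int n)"
  proof -
    have "(int ((e + n) mod (2 * n)) - (int i + 1)) mod (2 * int n)
      = ((int e + int n) - (int i + 1)) mod (2 * int n)"
      by (simp add: zmod_int mod_diff_left_eq)
    then show ?thesis by (simp add: a_def algebra_simps)
  qed
  also have "\<dots> = (b + int n) mod (2 * int n)" by (simp add: b_def mod_add_left_eq)
  also have "\<dots> = (if b < int n then b + int n else b - int n)"
  proof (cases "b < int n")
    case False
    have "(b + int n) mod (2 * int n) = ((b - int n) + 2 * int n) mod (2 * int n)"
      by (simp add: algebra_simps)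
    also have "\<dots> = b - int n" unfolding mod_add_self2 using b False by (intro mod_pos_pos_trivial) auto
    finally show ?thesis using False by simp
  qed (use b in \<open>auto intro: mod_pos_pos_trivial\<close>)
  finally show ?thesis unfolding exit_index_def a_def[symmetric] b_def[symmetric] using b by auto
qed

lemma trig_add_period:
  "sin (x + 2 * pi * of_int q) = sin x" "cos (x + 2 * pi * of_int q) = cos x"
  using sin_int_2pin[of q] cos_int_2pin[of q] by (simp_all add: sin_add cos_add mult.commute)

lemma index_angle:
  assumes "int e = int g + z + 2 * int n * q" "n \<ge> 1"
  shows "real e * pi / real n = real g * pi / real n + of_int z * pi / real n + 2 * pi * of_int q"
proof -
  have "real_of_int (int e) = real_of_int (int g + z + 2 * int n * q)" using assms(1) by simp
  then have "real e = real g + of_int z + 2 * real n * of_int q" by simp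
  then show ?thesis using assms(2) by (simp add: field_simps)
qed

lemma exit_index_sin:
  assumes "n \<ge> 2" "\<theta> \<in> sector m n i"
  shows "exit_index n i e \<Longrightarrow> 0 \<le> sin (real e * pi / real n - \<theta>)"
    and "\<not> exit_index n i e \<Longrightarrow> sin (real e * pi / real n - \<theta>) \<le> 0"
proof -
  have n1: "n \<ge> 1" using assms(1) by simp
  define \<tau> where "\<tau> = \<theta> - real i * pi / real n"
  have t: "0 \<le> \<tau>" "\<tau> \<le> pi / real n"
    using assms(2) by (auto simp: sector_def \<tau>_def algebra_simps add_divide_distrib)
  note sgn = sin_index_sign[OF assms(1) t]
  { assume "exit_index n i e"
    then obtain y q where y: "1 \<le> y" "y \<le> n" "int e = int i + int y + 2 * int n * q"
      using exit_indexE n1 by metis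
    have "real e * pi / real n - \<theta> = (real y * pi / real n - \<tau>) + 2 * pi * of_int q"
      unfolding index_angle[OF y(3) n1] \<tau>_def by simp
    then show "0 \<le> sin (real e * pi / real n - \<theta>)" using sgn(1)[OF y(1,2)] by (simp only: trig_add_period) }
  { assume "\<not> exit_index n i e"
    then obtain x q where x: "x < n" "int e = int i - int x + 2 * int n * q"
      using not_exit_indexE n1 by metis
    have e: "int e = int i + int (2 * n - x) + 2 * int n * (q - 1)"
      using x by (simp add: algebra_simps of_nat_diff)
    have "real e * pi / real n - \<theta> = (real (2 * n - x) * pi / real n - \<tau>) + 2 * pi * of_int (q - 1)"
      unfolding index_angle[OF e n1] \<tau>_def by simp
    moreover have "n + 1 \<le> 2 * n - x" "2 * n - x \<le> 2 * n" using x(1) by linarith+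
    ultimately show "sin (real e * pi / real n - \<theta>) \<le> 0" using sgn(2) by (simp only: trig_add_period) }
qed

text \<open>Within a fixed sector the letter alone decides the sense of crossing: by
  \<open>exit_index_shift\<close> exactly one of its two sides is an exit. So polygons and sides
  before and after the crossing are functions of the letter.\<close>

definition out_poly :: "nat \<Rightarrow> nat \<Rightarrow> nat \<Rightarrow> nat" where
  "out_poly n i l = (if exit_index n i (right_index n l) then label_row n l - 1 else label_row n l)"

definition in_poly :: "nat \<Rightarrow> nat \<Rightarrow> nat \<Rightarrow> nat" where
  "in_poly n i l = (if exit_index n i (right_index n l) then label_row n l else label_row n l - 1)"

definition out_side :: "nat \<Rightarrow> nat \<Rightarrow> nat \<Rightarrow> nat" where
  "out_side n i l = (if exit_index n i (right_index n l) then right_index n l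
     else (right_index n l + n) mod (2 * n))"

definition in_side :: "nat \<Rightarrow> nat \<Rightarrow> nat \<Rightarrow> nat" where
  "in_side n i l = (if exit_index n i (right_index n l) then (right_index n l + n) mod (2 * n)
     else right_index n l)"

lemma side_label_exit:
  assumes "side_label m n k e l" "n \<ge> 1"
  shows "exit_index n i e \<Longrightarrow> k = out_poly n i l \<and> e = out_side n i l"
    and "\<not> exit_index n i e \<Longrightarrow> k = in_poly n i l \<and> e = in_side n i l"
proof -
  note sh = exit_index_shift[OF assms(2), of i "right_index n l"]
  consider (R) "k = label_row n l - 1" "e = right_index n l"
    | (L) "k = label_row n l" "e = (right_index n l + n) mod (2 * n)"
    using assms(1) unfolding side_label_iff[OF assms(2)] by blast
  note cs = this
  show "exit_index n i e \<Longrightarrow> k = out_poly n i l \<and> e = out_side n i l"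
    using cs by cases (simp_all only: out_poly_def out_side_def sh if_True if_False simp_thms)
  show "\<not> exit_index n i e \<Longrightarrow> k = in_poly n i l \<and> e = in_side n i l"
    using cs by cases (simp_all only: in_poly_def in_side_def sh if_True if_False simp_thms)
qed

lemma crosses_out_in: "crosses (label_row n l) (out_poly n i l) (in_poly n i l)"
  by (simp add: crosses_def out_poly_def in_poly_def)

lemma crossing_vector_out_in:
  assumes "l \<in> labels m n" "n \<ge> 2"
  shows "of_real (real (in_poly n i l) - real (out_poly n i l)) * crossing_vector m n l =
    midpoint_offset m n (out_poly n i l) (out_side n i l) - midpoint_offset m n (in_poly n i l) (in_side n i l)"
proof -
  have "real (label_row n l - 1) = real (label_row n l) - 1" using label_row_ge_1[of n l] by simp
  then show ?thesis unfolding crossing_apothems[OF assms] out_poly_def in_poly_def out_side_def in_side_def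
    by simp
qed

section \<open>Heights over a boundary direction of the sector\<close>

lemma height_out:
  assumes "n \<ge> 2" "int e = int g + int y + 2 * int n * q"
  shows "cross (cis (real g * pi / real n)) (side_point m n k e s) =
         cross (cis (real g * pi / real n)) (side_point m n k (y + g) s)"
proof -
  have n1: "n \<ge> 1" using assms(1) by simp
  have "real e * pi / real n = real (y + g) * pi / real n + 2 * pi * of_int q"
    unfolding index_angle[OF assms(2) n1] by (simp add: algebra_simps add_divide_distrib)
  then have c: "cis (real e * pi / real n) = cis (real (y + g) * pi / real n)"
    by (simp only: complex_eq_iff cis.sel trig_add_period simp_thms)
  have "even (int e) = even (int g + int y)" unfolding assms(2) by simp
  then have "even e = even (y + g)" by (simp add: add.commute)
  then have A: "apothem m n k e = apothem m n k (y + g)" "len m n k e = len m n k (y + g)"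
    by (auto intro: apothem_cong len_cong)
  have "side_point m n k e s = side_point m n k (y + g) s"
    unfolding side_point_eq[OF assms(1)] midpoint_offset_def BM_edge_len outward_normal_def c A ..
  then show ?thesis by simp
qed

text \<open>The polygons are symmetric about the axis orthogonal to any of their edge directions.\<close>

lemma height_in:
  assumes "n \<ge> 2" "int e = int g - int x + 2 * int n * q"
  shows "cross (cis (real g * pi / real n)) (side_point m n k e s) =
         cross (cis (real g * pi / real n)) (side_point m n k (x + g) (1 - s))"
proof -
  have n1: "n \<ge> 1" using assms(1) by simp
  define G X where "G = real g * pi / real n" and "X = real x * pi / real n"
  have e: "int e = int g + (- int x) + 2 * int n * q" using assms(2) by simp
  have "real e * pi / real n = (G - X) + 2 * pi * of_int q"
    unfolding index_angle[OF e n1] G_def X_def by simp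
  then have c: "cis (real e * pi / real n) = cis (G - X)"
    by (simp only: complex_eq_iff cis.sel trig_add_period simp_thms)
  have c': "cis (real (x + g) * pi / real n) = cis (G + X)"
    by (simp add: G_def X_def algebra_simps add_divide_distrib)
  have "even (int e) = even (int g - int x)" unfolding assms(2) by simp
  then have "even e = even (x + g)" by auto
  then have A: "apothem m n k e = apothem m n k (x + g)" "len m n k e = len m n k (x + g)"
    by (auto intro: apothem_cong len_cong)
  have h: "cross (cis G) (- \<i> * cis a) = - cos (a - G)" for a
    by (simp add: cross_def cos_diff algebra_simps)
  have "cross (cis G) (side_point m n k e s) - cross (cis G) (centre m n k)
      = apothem m n k (x + g) * (- cos X) - (s - 1/2) * (len m n k (x + g) * sin X)"
    unfolding side_point_eq[OF assms(1)] midpoint_offset_def BM_edge_len outward_normal_def c A cross_simps h cross_cis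
    by simp
  also have "\<dots> = cross (cis G) (side_point m n k (x + g) (1 - s)) - cross (cis G) (centre m n k)"
    unfolding side_point_eq[OF assms(1)] midpoint_offset_def BM_edge_len outward_normal_def c' cross_simps h cross_cis
    by (simp add: algebra_simps)
  finally show ?thesis by (simp add: G_def)
qed

text \<open>Heights increase weakly along the chain, so an interior point of edge \<open>y\<close>
  can be at least as high as one of edge \<open>x\<close> with \<open>y < x\<close> only if both
  edges have zero rise and lie at one level. This frees the cone condition from the actual crossing
  positions.\<close>

lemma midpoint_heights:
  fixes g :: nat
  assumes "m \<ge> 2" "n \<ge> 2" "k < m" "x \<le> n" "y \<le> n" "0 < s" "s < 1" "0 < t" "t < 1"
  defines "v \<equiv> cis (real g * pi / real n)"
  assumes less: "cross v (side_point m n k (x + g) s) \<le> cross v (side_point m n k (y + g) t)"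
  shows "cross v (side_point m n k (x + g) (1/2)) \<le> cross v (side_point m n k (y + g) (1/2))"
proof -
  define V where "V a = cross v (BM_vertex m n k (a + g))" for a
  define E where "E a = cross v (BM_edge m n k (a + g))" for a
  have VE: "V (Suc a) = V a + E a" for a
    by (simp add: V_def E_def BM_edge_eq_vertex_diff cross_simps)
  have E: "0 \<le> E a" if "a \<le> n" for a
  proof -
    have "real a * pi / real n \<le> real n * pi / real n"
      using that assms(2) by (intro divide_right_mono mult_right_mono) auto
    then have "0 \<le> sin (real a * pi / real n)" using assms(2) by (intro sin_ge_zero) auto
    moreover have "E a = len m n k (a + g) * sin (real a * pi / real n)"
      unfolding E_def v_def cross_BM_edge by (simp add: algebra_simps add_divide_distrib)
    ultimately show ?thesis using len_nonneg[OF assms(1,3)] by simp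
  qed
  have mono: "V a \<le> V b" if "a \<le> b" "b \<le> Suc n" for a b
    using that
  proof (induction b rule: dec_induct)
    case (step b)
    then show ?case using E[of b] by (simp add: VE)
  qed simp
  have pt: "cross v (side_point m n k (a + g) u) = V a + u * E a" for a u
    by (simp add: side_point_def V_def E_def cross_simps)
  have le: "V x + s * E x \<le> V y + t * E y" using less by (simp add: pt)
  consider "x = y" | "x < y" | "y < x" by linarith
  then have "V x + E x / 2 \<le> V y + E y / 2"
  proof cases
    case 2
    then have "V x + E x \<le> V y" using mono[of "Suc x" y] assms by (simp add: VE)
    then show ?thesis using E[of x] E[of y] assms by simp
  next
    case 3
    then have b: "V y + E y \<le> V x" using mono[of "Suc y" x] assms by (simp add: VE)
    have nn: "0 \<le> s * E x" "0 \<le> (1 - t) * E y" using E[of x] E[of y] assms by simp_all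
    moreover have e: "(1 - t) * E y = E y - t * E y" by (simp add: left_diff_distrib)
    ultimately have "(1 - t) * E y = 0" using le b unfolding e by linarith
    then have "E y = 0" using assms by simp
    then have "V x + s * E x \<le> V y" "V y \<le> V x" using le b by simp_all
    then have "s * E x = 0" "V x = V y" using nn(1) by linarith+
    then show ?thesis using \<open>E y = 0\<close> assms by simp
  qed simp
  then show ?thesis by (simp add: pt)
qed

text \<open>The chord does not descend over the boundary direction \<open>i\<close> and does not
  ascend over the direction \<open>i + 1\<close>. Reflecting the entry edge in the axis orthogonal
  to the boundary direction puts both ends on one monotone chain, where
  \<open>midpoint_heights\<close> passes to midpoints.\<close>

lemma trajectory_step_cone:
  fixes j :: int
  assumes "m \<ge> 2" "n \<ge> 2" "trajectory m n \<theta> T" "\<theta> \<in> sector m n i"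
  defines "d \<equiv> midpoint_offset m n (polyg T j) (out_edge T j) - midpoint_offset m n (polyg T j) (in_edge T j)"
  shows "exit_index n i (out_edge T j)" "\<not> exit_index n i (in_edge T j)"
    and "0 \<le> cross (cis (real i * pi / real n)) d"
    and "cross (cis (real (i + 1) * pi / real n)) d \<le> 0"
proof -
  have n1: "n \<ge> 1" using assms(2) by simp
  define k e f s t where "k = polyg T j" "e = in_edge T j" "f = out_edge T j" "s = in_pos T j" "t = out_pos T j"
  note defs = this
  define \<delta> where "\<delta> = time T (j + 1) - time T j"
  have T: "k < m" "0 < s" "s < 1" "0 < t" "t < 1"
      "cross (cis \<theta>) (BM_edge m n k e) < 0" "0 < cross (cis \<theta>) (BM_edge m n k f)" "0 \<le> \<delta>"
      "side_point m n k f t = side_point m n k e s + of_real \<delta> * cis \<theta>"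
    using assms(3)[unfolded trajectory_def, THEN conjunct1, rule_format, of j]
    unfolding defs \<delta>_def by auto
  have len: "0 \<le> len m n k a" for a using len_nonneg[OF assms(1) T(1)] .
  have x1: "exit_index n i f"
  proof (rule ccontr)
    assume "\<not> ?thesis"
    then have "len m n k f * sin (real f * pi / real n - \<theta>) \<le> 0"
      by (intro mult_nonneg_nonpos len exit_index_sin[OF assms(2,4)])
    then show False using T(7) by (simp add: cross_BM_edge)
  qed
  then show "exit_index n i (out_edge T j)" by (simp add: defs)
  have x2: "\<not> exit_index n i e"
  proof
    assume "exit_index n i e"
    then have "0 \<le> len m n k e * sin (real e * pi / real n - \<theta>)"
      by (intro mult_nonneg_nonneg len exit_index_sin[OF assms(2,4)])
    then show False using T(6) by (simp add: cross_BM_edge)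
  qed
  then show "\<not> exit_index n i (in_edge T j)" by (simp add: defs)
  have d: "d = side_point m n k f (1/2) - side_point m n k e (1/2)"
    unfolding d_def side_point_eq[OF assms(2)] defs by simp
  have th: "real i * pi / real n \<le> \<theta>" "\<theta> \<le> real (i + 1) * pi / real n"
    using assms(4) by (auto simp: sector_def)
  have w: "real (i + 1) * pi / real n = real i * pi / real n + pi / real n"
    by (simp add: distrib_right add_divide_distrib)
  have pin: "pi / real n \<le> pi" using n1 by (simp add: divide_le_eq)
  obtain y q where y: "1 \<le> y" "y \<le> n" "int f = int i + int y + 2 * int n * q"
    using exit_indexE[OF x1 n1] by metis
  obtain x r where x: "x < n" "int e = int i - int x + 2 * int n * r"
    using not_exit_indexE[OF x2 n1] by metis
  note hf = height_out[OF assms(2) y(3)] and he = height_in[OF assms(2) x(2)]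
  \<comment> \<open>The same edges counted from \<open>i + 1\<close>: the exit offset drops by one,
    the entry offset grows by one, and both stay in 0..n.\<close>
  have y': "int f = int (i + 1) + int (y - 1) + 2 * int n * q" using y by simp
  have x': "int e = int (i + 1) - int (x + 1) + 2 * int n * r" using x by simp
  note hf' = height_out[OF assms(2) y'] and he' = height_in[OF assms(2) x']
  have "cross (cis (real i * pi / real n)) (side_point m n k e s)
      \<le> cross (cis (real i * pi / real n)) (side_point m n k f t)"
  proof -
    have "0 \<le> sin (\<theta> - real i * pi / real n)" using th w pin by (intro sin_ge_zero; linarith)
    then show ?thesis unfolding T(9) cross_simps cross_cis using T(8) by simp
  qed
  then show "0 \<le> cross (cis (real i * pi / real n)) d"
    using midpoint_heights[OF assms(1,2) T(1), of x y "1 - s" t i] x(1) y(2) T(2-5)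
    unfolding d cross_simps hf he by simp
  have "cross (cis (real (i + 1) * pi / real n)) (side_point m n k f t)
      \<le> cross (cis (real (i + 1) * pi / real n)) (side_point m n k e s)"
  proof -
    have "0 \<le> sin (real (i + 1) * pi / real n - \<theta>)" using th w pin by (intro sin_ge_zero; linarith)
    then have "sin (\<theta> - real (i + 1) * pi / real n) \<le> 0" by (metis minus_diff_eq neg_0_le_iff_le sin_minus)
    then show ?thesis unfolding T(9) cross_simps cross_cis using T(8) by (simp add: mult_nonneg_nonpos)
  qed
  then show "cross (cis (real (i + 1) * pi / real n)) d \<le> 0"
    using midpoint_heights[OF assms(1,2) T(1), of "y - 1" "x + 1" t "1 - s" "i + 1"] x(1) y(2) T(2-5)
    unfolding d cross_simps hf' he' by simp
qed

text \<open>The trajectory behind an arrow depends on the arrow and may have any direction in the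
  sector. The conclusion mentions \<open>p\<close>, \<open>q\<close> and \<open>i\<close> only, so
  it applies to every pair of consecutive letters of an admissible word.\<close>

lemma arrow_step_cone:
  assumes "m \<ge> 2" "n \<ge> 2" "arrow m n i p q"
  defines "d \<equiv> midpoint_offset m n (out_poly n i q) (out_side n i q)
             - midpoint_offset m n (in_poly n i p) (in_side n i p)"
  shows "p \<in> labels m n" "in_poly n i p = out_poly n i q"
    and "0 \<le> cross (cis (real i * pi / real n)) d"
    and "cross (cis (real (i + 1) * pi / real n)) d \<le> 0"
proof -
  have n1: "n \<ge> 1" using assms(2) by simp
  obtain \<theta> w j T where th: "\<theta> \<in> sector m n i" and pq: "w j = p" "w (j + 1) = q"
    and T: "trajectory m n \<theta> T" and lab: "\<And>j. side_label m n (polyg T j) (in_edge T j) (w j)"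
    using assms(3) unfolding arrow_def cutting_sequence_def by blast
  have Tj: "out_edge T j < 2 * n"
    "glued m n (polyg T j) (out_edge T j) (polyg T (j + 1)) (in_edge T (j + 1)) \<or>
     glued m n (polyg T (j + 1)) (in_edge T (j + 1)) (polyg T j) (out_edge T j)"
    using T[unfolded trajectory_def, THEN conjunct1, rule_format, of j] by auto
  have sl: "side_label m n (polyg T j) (in_edge T j) p" using lab[of j] pq by simp
  note g = glued_side_label[OF n1 lab[of "j + 1"] Tj, unfolded pq]
  have sl': "side_label m n (polyg T j) (out_edge T j) q"
    unfolding side_label_iff[OF n1] using g by blast
  show "p \<in> labels m n" using sl n1 by (simp add: side_label_iff)
  note c = trajectory_step_cone[OF assms(1,2) T th, of j]
  note e1 = side_label_exit(1)[OF sl' n1 c(1)] and e2 = side_label_exit(2)[OF sl n1 c(2)]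
  show "in_poly n i p = out_poly n i q" using e1 e2 by simp
  have "d = midpoint_offset m n (polyg T j) (out_edge T j) - midpoint_offset m n (polyg T j) (in_edge T j)"
    unfolding d_def using e1 e2 by simp
  then show "0 \<le> cross (cis (real i * pi / real n)) d"
    "cross (cis (real (i + 1) * pi / real n)) d \<le> 0" using c(3,4) by simp_all
qed

lemma finite_labels: "finite (labels m n)"
  by (simp add: labels_def)

lemma finite_range_labels:
  assumes "\<And>j. w j \<in> labels m n"
  shows "finite (range (\<lambda>j. f (w j)))"
  by (rule finite_subset[of _ "f ` labels m n"]) (use assms finite_labels in auto)

text \<open>A word admissible in sector \<open>i\<close> can be developed with direction in the
  sector or, reversed, in the opposite cone. The second is excluded by restricting \<theta> to
  [0,\<pi>], which contains the sector as \<open>i < n\<close>.\<close>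

lemma admissible_direction:
  assumes "m \<ge> 2" "n \<ge> 2" "i < n" "admissible m n i w"
    and "develops m n w K Z" "directed Z \<theta>" "spread Z \<theta>" "0 \<le> \<theta>" "\<theta> \<le> pi"
  shows "real i * pi / real n < \<theta> \<and> \<theta> < real (i + 1) * pi / real n"
proof -
  have arr: "arrow m n i (w j) (w (j + 1))" for j using assms(4) by (simp add: admissible_def)
  note cone = arrow_step_cone[OF assms(1,2) arr]
  have lab: "w j \<in> labels m n" for j using cone(1) .
  define K' where "K' j = out_poly n i (w j)" for j
  have K': "K' (j + 1) = in_poly n i (w j)" for j using cone(2)[of j] by (simp add: K'_def)
  have "crosses (label_row n (w j)) (K' j) (K' (j + 1))" for j
    unfolding K' unfolding K'_def by (rule crosses_out_in)
  from develops_other_crossings[OF assms(5) this]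
  obtain \<sigma> :: real where sg: "\<sigma> = 1 \<or> \<sigma> = -1" and dev: "develops m n w K' (\<lambda>j. of_real \<sigma> * Z j)"
  proof (elim disjE)
    assume "develops m n w K' Z"
    then show ?thesis using that[of 1] by simp
  next
    assume "develops m n w K' (\<lambda>j. - Z j)"
    then show ?thesis using that[of "-1"] by simp
  qed
  \<comment> \<open>Up to the sign \<sigma>, \<open>Z j + \<mu> j\<close> is the unfolded midpoint
    of the edge crossed at \<open>j\<close>, and \<open>D j\<close> leads from there to the next
    midpoint through the polygon between them.\<close>
  define \<nu> where "\<nu> l = midpoint_offset m n (out_poly n i l) (out_side n i l)" for l
  define \<mu> where "\<mu> j = of_real \<sigma> * \<nu> (w j)" for j
  define D where "D j = \<nu> (w (j + 1)) - midpoint_offset m n (in_poly n i (w j)) (in_side n i (w j))" for j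
  have ss: "of_real \<sigma> * (of_real \<sigma> * z) = z" for z :: complex using sg by auto
  have inc: "(Z (j + 1) + \<mu> (j + 1)) - (Z j + \<mu> j) = of_real \<sigma> * D j" for j
  proof -
    have "of_real \<sigma> * Z (j + 1) = of_real \<sigma> * Z j + of_real (real (K' (j + 1)) - real (K' j)) * crossing_vector m n (w j)"
      using dev unfolding develops_def by blast
    also have "of_real (real (K' (j + 1)) - real (K' j)) * crossing_vector m n (w j) =
      \<nu> (w j) - midpoint_offset m n (in_poly n i (w j)) (in_side n i (w j))"
      unfolding K' unfolding K'_def \<nu>_def by (rule crossing_vector_out_in[OF lab assms(2)])
    finally have e: "of_real \<sigma> * (Z (j + 1) - Z j) = D j + \<nu> (w j) - \<nu> (w (j + 1))"
      by (simp add: D_def algebra_simps)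
    have "Z (j + 1) - Z j = of_real \<sigma> * (D j + \<nu> (w j) - \<nu> (w (j + 1)))"
      unfolding e[symmetric] ss ..
    then show ?thesis by (simp add: \<mu>_def algebra_simps)
  qed
  have finmu: "finite (range \<mu>)" unfolding \<mu>_def
    using finite_range_labels[of w m n "\<lambda>l. of_real \<sigma> * \<nu> l", OF lab] .
  have fininc: "finite (range (\<lambda>j. (Z (j + 1) + \<mu> (j + 1)) - (Z j + \<mu> j)))"
  proof -
    define h where "h = (\<lambda>(l, l'). of_real \<sigma> * (\<nu> l' - midpoint_offset m n (in_poly n i l) (in_side n i l)))"
    have "range (\<lambda>j. (Z (j + 1) + \<mu> (j + 1)) - (Z j + \<mu> j)) \<subseteq> h ` (labels m n \<times> labels m n)"
    proof (rule image_subsetI)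
      fix j
      show "(Z (j + 1) + \<mu> (j + 1)) - (Z j + \<mu> j) \<in> h ` (labels m n \<times> labels m n)"
        by (rule image_eqI[of _ _ "(w j, w (j + 1))"]) (simp_all add: inc D_def h_def lab)
    qed
    then show ?thesis using finite_labels by (meson finite_SigmaI finite_imageI finite_subset)
  qed
  define a b where "a = real i * pi / real n" and "b = real (i + 1) * pi / real n"
  \<comment> \<open>The weak inequality comes from the cone; equality would put \<theta> on its
    boundary and contradict \<open>spread\<close>.\<close>
  have strict: "0 < cross v (cis \<theta>)" if "\<And>j. 0 \<le> cross v (of_real \<sigma> * D j)" "v \<noteq> 0" for v
  proof -
    have "0 \<le> cross v ((Z (j + 1) + \<mu> (j + 1)) - (Z j + \<mu> j))" for j unfolding inc using that(1) .
    then have "0 \<le> cross v (cis \<theta>)" "cross v (cis \<theta>) \<noteq> 0"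
      using directed_cone[OF assms(6) finmu] not_spread_boundary[OF assms(6) finmu that(2) _ fininc] assms(7)
      by blast+
    then show ?thesis by simp
  qed
  have c1: "0 \<le> cross (cis a) (D j)" and c2: "cross (cis b) (D j) \<le> 0" for j
    using cone(3,4)[of j] unfolding a_def b_def D_def \<nu>_def by simp_all
  have "0 < cross (of_real \<sigma> * cis a) (cis \<theta>)" "0 < cross (of_real (- \<sigma>) * cis b) (cis \<theta>)"
  proof -
    have "cross (of_real \<sigma> * cis a) (of_real \<sigma> * D j) = cross (cis a) (D j)"
      "cross (of_real (- \<sigma>) * cis b) (of_real \<sigma> * D j) = - cross (cis b) (D j)" for j
      using sg unfolding cross_simps by auto
    then show "0 < cross (of_real \<sigma> * cis a) (cis \<theta>)" "0 < cross (of_real (- \<sigma>) * cis b) (cis \<theta>)"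
      by (intro strict; use sg c1 c2 in force)+
  qed
  then have sa: "0 < \<sigma> * sin (\<theta> - a)" and sb: "0 < \<sigma> * sin (b - \<theta>)"
    using sin_minus[of "\<theta> - b"] by (simp_all add: cross_simps cross_cis)
  have n0: "real n > 0" using assms(2) by simp
  have ab: "0 \<le> a" "b \<le> pi" "b = a + pi / real n"
  proof -
    show "0 \<le> a" by (simp add: a_def)
    have "b \<le> real n * pi / real n" unfolding b_def
      using assms(3) by (intro divide_right_mono mult_right_mono) auto
    then show "b \<le> pi" using n0 by simp
    show "b = a + pi / real n" by (simp add: a_def b_def distrib_right add_divide_distrib)
  qed
  have pin: "0 < pi / real n" using n0 by simp
  show ?thesis unfolding a_def[symmetric] b_def[symmetric]
  proof (cases "\<sigma> = 1")
    case True
    have "a < \<theta>"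
    proof (rule ccontr)
      assume "\<not> a < \<theta>"
      then have "0 \<le> sin (a - \<theta>)" using ab pin assms(8,9) by (intro sin_ge_zero; linarith)
      then have "sin (\<theta> - a) \<le> 0" by (metis minus_diff_eq neg_0_le_iff_le sin_minus)
      then show False using sa True by simp
    qed
    moreover have "\<theta> < b"
    proof (rule ccontr)
      assume "\<not> \<theta> < b"
      then have "0 \<le> sin (\<theta> - b)" using ab pin assms(8,9) by (intro sin_ge_zero; linarith)
      then have "sin (b - \<theta>) \<le> 0" by (metis minus_diff_eq neg_0_le_iff_le sin_minus)
      then show False using sb True by simp
    qed
    ultimately show "a < \<theta> \<and> \<theta> < b" by simp
  next
    \<comment> \<open>In the reversed reading \<theta> would have to be below \<open>a\<close> and
      above \<open>b\<close>.\<close>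
    case False
    then have s1: "\<sigma> = -1" using sg by simp
    have "\<theta> < a"
    proof (rule ccontr)
      assume "\<not> \<theta> < a"
      then have "0 \<le> sin (\<theta> - a)" using ab pin assms(8,9) by (intro sin_ge_zero; linarith)
      then show False using sa s1 by simp
    qed
    moreover have "b < \<theta>"
    proof (rule ccontr)
      assume "\<not> b < \<theta>"
      then have "0 \<le> sin (b - \<theta>)" using ab pin assms(8,9) by (intro sin_ge_zero; linarith)
      then show False using sb s1 by simp
    qed
    ultimately show "a < \<theta> \<and> \<theta> < b" using ab pin by simp
  qed
qed

section \<open>The grid of the standard transition diagram\<close>

text \<open>Second coordinate of the inverse of \<open>pos_label\<close>: in even rows of the
  diagram the labels run from right to left.\<close>

definition label_col :: "nat \<Rightarrow> nat \<Rightarrow> nat" where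
  "label_col n l = (if odd (label_row n l) then (l - 1) mod n + 1 else n - (l - 1) mod n)"

lemma pos_label_eq:
  assumes "1 \<le> r" "1 \<le> c" "c \<le> n"
  shows "pos_label n r c = (r - 1) * n + (if odd r then c else n + 1 - c)"
proof -
  obtain r' where "r = Suc r'" using assms by (cases r) auto
  then show ?thesis using assms by (simp add: pos_label_def add.commute)
qed

lemma pos_label:
  assumes "1 \<le> r" "1 \<le> c" "c \<le> n"
  shows "label_row n (pos_label n r c) = r" "label_col n (pos_label n r c) = c"
    "(pos_label n r c - 1) mod n + 1 = (if odd r then c else n + 1 - c)"
    "r \<le> m - 1 \<Longrightarrow> pos_label n r c \<in> labels m n"
proof -
  define s where "s = (if odd r then c else n + 1 - c)"
  have s: "1 \<le> s" "s \<le> n" using assms by (auto simp: s_def)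
  have p: "pos_label n r c = (r - 1) * n + s" using pos_label_eq[OF assms] by (simp add: s_def)
  show 1: "label_row n (pos_label n r c) = r" and 2: "(pos_label n r c - 1) mod n + 1 = s"
    unfolding p by (rule label_row_eq[OF assms(1) s])+
  then have "(pos_label n r c - 1) mod n = s - 1" by simp
  then show "label_col n (pos_label n r c) = c" using 1 assms by (auto simp: label_col_def s_def)
  show "r \<le> m - 1 \<Longrightarrow> pos_label n r c \<in> labels m n"
    unfolding p using assms s by (intro label_in_labels)
qed

lemma outward_normal_eq: "outward_normal n e = Complex (sin (real e * (pi / real n))) (- cos (real e * (pi / real n)))"
  by (simp add: outward_normal_def complex_eq_iff)

lemma outward_normal_mod:
  assumes "n \<ge> 1"
  shows "outward_normal n (e mod (2 * n)) = outward_normal n e"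
proof -
  define q x where "q = e div (2 * n)" and "x = e mod (2 * n)"
  have e: "e = 2 * n * q + x" unfolding q_def x_def by simp
  then have i: "int e = int 0 + int x + 2 * int n * int q" by simp
  have "real e * pi / real n = real x * pi / real n + 2 * pi * of_int (int q)"
    using index_angle[OF i assms] by simp
  then have "cis (real e * pi / real n) = cis (real x * pi / real n)"
    by (simp only: complex_eq_iff cis.sel trig_add_period simp_thms)
  then show ?thesis by (simp add: outward_normal_def x_def[symmetric])
qed

lemma normal_label_index:
  assumes "n \<ge> 1" "1 \<le> s" "s \<le> n"
  shows "outward_normal n (label_index n k s) = (if right_odd n k \<longleftrightarrow> odd s
    then Complex (sin (real s * (pi / real n))) (- cos (real s * (pi / real n)))
    else Complex (- sin ((real s - 1) * (pi / real n))) (- cos ((real s - 1) * (pi / real n))))"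
proof -
  have "real (2 * n + 1 - s) = 2 * real n - (real s - 1)" using assms by (simp add: of_nat_diff)
  then have "real (2 * n + 1 - s) * (pi / real n) = 2 * pi - (real s - 1) * (pi / real n)"
    using assms by (simp add: field_simps)
  then have "outward_normal n (2 * n + 1 - s) =
      Complex (- sin ((real s - 1) * (pi / real n))) (- cos ((real s - 1) * (pi / real n)))"
    by (simp add: outward_normal_eq)
  then show ?thesis
    unfolding label_index_def outward_normal_mod[OF assms(1)] by (simp add: outward_normal_eq)
qed

text \<open>With column angle \<open>y\<close> and \<open>b\<close> = \<pi>/n, the normal of an edge
  depends on the row only through the parity \<open>e\<close> of row plus column, up to a sign given
  by the column. That sign is left out, as it cancels against the sense of crossing.\<close>

definition grid_normal :: "bool \<Rightarrow> real \<Rightarrow> real \<Rightarrow> complex" where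
  "grid_normal e y b = (if e then Complex (sin y) (- cos y) else Complex (sin (y - b)) (cos (y - b)))"

lemma normal_pos_label:
  assumes "n \<ge> 1" "1 \<le> r" "1 \<le> c" "c \<le> n"
  shows "outward_normal n (right_index n (pos_label n r c)) =
    (if odd c then 1 else -1) * grid_normal (even (r + c)) (real c * (pi / real n)) (pi / real n)"
proof -
  define s where "s = (if odd r then c else n + 1 - c)"
  have s: "1 \<le> s" "s \<le> n" using assms by (auto simp: s_def)
  have ri: "right_index n (pos_label n r c) = label_index n (r - 1) s"
    unfolding right_index_def using pos_label[OF assms(2-4)] by (simp add: s_def)
  have ro: "right_odd n (r - 1) \<longleftrightarrow> odd n \<or> odd r"
    using assms(2) by (simp add: right_odd_def even_diff_nat)
  have ps: "odd s \<longleftrightarrow> (if odd r then odd c else (odd n \<longleftrightarrow> odd c))"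
    using assms(4) by (auto simp: s_def even_diff_nat)
  have match: "(right_odd n (r - 1) \<longleftrightarrow> odd s) \<longleftrightarrow> odd c"
    unfolding ro ps by auto
  have n0: "real n \<noteq> 0" using assms(1) by simp
  have rs: "real s = (if odd r then real c else real n - (real c - 1))"
    using assms(4) by (simp add: s_def of_nat_diff)
  have a1: "(real n - (real c - 1)) * (pi / real n) = pi - (real c * (pi / real n) - pi / real n)"
    using n0 by (simp add: field_simps)
  have a2: "(real n - (real c - 1) - 1) * (pi / real n) = pi - real c * (pi / real n)"
    "(real c - 1) * (pi / real n) = real c * (pi / real n) - pi / real n"
    using n0 by (simp_all add: field_simps)
  have t: "sin (pi - x) = sin x" "cos (pi - x) = - cos x" for x :: real by simp_all
  show ?thesis unfolding ri normal_label_index[OF assms(1) s] match rs grid_normal_def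
    by (cases "odd r"; cases "odd c")
      (simp_all only: if_True if_False a1 a2 t even_add simp_thms, simp_all add: complex_eq_iff)
qed

text \<open>For \<open>a\<close> = \<pi>/m and \<open>b\<close> = \<pi>/n this is
  \<open>gamma m n\<close> multiplied by the square root of sin a sin b, so that no roots or
  quotients remain.\<close>

definition shear :: "real \<Rightarrow> real \<Rightarrow> complex \<Rightarrow> complex" where
  "shear a b z = Complex ((cos a + cos b) * Im z - sin b * Re z) (sin a * Im z)"

text \<open>Up to scale, a letter of the diagram at row angle \<open>x\<close> and column angle \<open>y\<close> moves the centre
  by \<open>grid_vector\<close>. The potential is the sheared midpoint of the edge, minus the position of the
  corresponding diagonal in the polygon of the dual surface that belongs to the column; the identities
  below express that shearing cuts the one surface into the polygons of the other.\<close>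

definition grid_vector :: "bool \<Rightarrow> real \<Rightarrow> real \<Rightarrow> real \<Rightarrow> real \<Rightarrow> complex" where
  "grid_vector e x y a b = of_real (2 * sin x * (cos a + cos b)) * grid_normal e y b"

definition grid_potential :: "bool \<Rightarrow> bool \<Rightarrow> real \<Rightarrow> real \<Rightarrow> real \<Rightarrow> real \<Rightarrow> complex" where
  "grid_potential d e x y a b =
     (let L = sin (if e then y else y - b); L' = sin (if e then y - b else y);
          h = sin (if d then x - a else x + a) + sin x * cos b in
      shear a b (of_real h * grid_normal e y b) -
      of_real (if d then 1 else -1) *
        Complex (sin a * sin b * cos x * L) (- (sin b * cos x * (L' + cos a * L))))"

text \<open>One identity per type of arrow, based at the vertex with angles \<open>x\<close>,
  \<open>y\<close>: \<open>d\<close> means odd column and \<open>e\<close> even sum of row and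
  column. Horizontal arrows give crossing vectors of the dual surface times 2 sin a sin b; vertical
  ones, which carry no label, give 0.\<close>

lemma grid_identities:
  shows grid_right: "shear a b (grid_vector e x y a b) + grid_potential (\<not> d) (\<not> e) x (y + b) a b
      - grid_potential d e x y a b
    = of_real (2 * sin b * sin y * (cos a + cos b)) *
      (if e then Complex (- sin x) (if d then - cos x else cos x)
       else if d then Complex (sin (x + a)) (- cos (x + a)) else Complex (sin (x - a)) (cos (x - a)))"
    (is ?right)
  and grid_left: "shear a b (grid_vector (\<not> e) x (y + b) a b) + grid_potential d e x y a b
      - grid_potential (\<not> d) (\<not> e) x (y + b) a b
    = of_real (2 * sin b * sin y * - (cos a + cos b)) *
      (if e then Complex (sin x) (if d then - cos x else cos x)
       else if d then Complex (- sin (x - a)) (- cos (x - a)) else Complex (- sin (x + a)) (cos (x + a)))"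
    (is ?left)
  and grid_down: "shear a b (grid_vector e x y a b) + grid_potential True (\<not> e) (x + a) y a b
      - grid_potential True e x y a b = 0" (is ?down)
  and grid_up: "shear a b (grid_vector (\<not> e) (x + a) y a b) + grid_potential False e x y a b
      - grid_potential False (\<not> e) (x + a) y a b = 0" (is ?up)
proof -
  \<comment> \<open>After expansion these are polynomial identities in the eight values, modulo the
    Pythagorean relations of \<open>a\<close> and \<open>b\<close>.\<close>
  define A C p q sa ca sb cb where "A = sin x" "C = cos x" "p = sin y" "q = cos y"
    "sa = sin a" "ca = cos a" "sb = sin b" "cb = cos b"
  note atoms = this[symmetric]
  have "sa * sa = 1 - ca * ca" "sb * sb = 1 - cb * cb"
    using sin_squared_eq[of a] sin_squared_eq[of b] by (simp_all add: atoms power2_eq_square)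
  moreover from this have "sa * (sa * z) = z - ca * (ca * z)" "sb * (sb * z) = z - cb * (cb * z)" for z
    unfolding mult.assoc[symmetric] by (simp_all add: left_diff_distrib)
  ultimately have sq: "sa * sa = 1 - ca * ca" "sb * sb = 1 - cb * cb"
    "sa * (sa * z) = z - ca * (ca * z)" "sb * (sb * z) = z - cb * (cb * z)" for z by blast+
  have ang: "sin (x + a) = A * ca + C * sa" "cos (x + a) = C * ca - A * sa"
    "sin (x - a) = A * ca - C * sa" "cos (x - a) = C * ca + A * sa"
    "sin (y + b) = p * cb + q * sb" "cos (y + b) = q * cb - p * sb"
    "sin (y - b) = p * cb - q * sb" "cos (y - b) = q * cb + p * sb"
    "x + a - a = x" "x + a + a = x + 2 * a" "y + b - b = y"
    "sin (x + 2 * a) = A * (2 * ca * ca - 1) + C * (2 * sa * ca)"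
    using sin_squared_eq[of a]
    by (simp_all add: atoms sin_add cos_add sin_diff cos_diff sin_double cos_double_cos power2_eq_square)
  note defs = grid_vector_def grid_potential_def grid_normal_def shear_def Let_def
  show ?right unfolding defs ang unfolding atoms
    by (cases d; cases e; simp add: complex_eq_iff ang atoms; simp add: algebra_simps sq)
  show ?left unfolding defs ang unfolding atoms
    by (cases d; cases e; simp add: complex_eq_iff ang atoms; simp add: algebra_simps sq)
  show ?down unfolding defs ang unfolding atoms
    by (cases e; simp add: complex_eq_iff ang atoms; simp add: algebra_simps sq)
  show ?up unfolding defs ang unfolding atoms
    by (cases e; simp add: complex_eq_iff ang atoms; simp add: algebra_simps sq)
qed

text \<open>In the standard sector, the parity of the column of a label decides in which direction its edge
  is crossed.\<close>

definition entered_from :: "nat \<Rightarrow> nat \<Rightarrow> nat" where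
  "entered_from n l = (if odd (label_col n l) then label_row n l - 1 else label_row n l)"

definition entered :: "nat \<Rightarrow> nat \<Rightarrow> nat" where
  "entered n l = (if odd (label_col n l) then label_row n l else label_row n l - 1)"

definition diagram_vector :: "nat \<Rightarrow> nat \<Rightarrow> nat \<Rightarrow> complex" where
  "diagram_vector m n l =
     of_real (real (entered n l) - real (entered_from n l)) * crossing_vector m n l"

text \<open>A positive multiple of \<open>gamma\<close>, so it acts alike on directions; the scale
  is the one for which corrected steps are exactly crossing vectors of the dual surface.\<close>

definition dual_map :: "nat \<Rightarrow> nat \<Rightarrow> complex \<Rightarrow> complex" where
  "dual_map m n z = of_real (1 / sin (pi / real m)) * shear (pi / real m) (pi / real n) z"

definition diagram_potential :: "nat \<Rightarrow> nat \<Rightarrow> nat \<Rightarrow> complex" where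
  "diagram_potential m n l =
     of_real (1 / (2 * sin (pi / real m) * sin (pi / real n))) *
     grid_potential (odd (label_col n l)) (even (label_row n l + label_col n l))
       (real (label_row n l) * (pi / real m)) (real (label_col n l) * (pi / real n)) (pi / real m) (pi / real n)"

lemma crosses_entered: "crosses (label_row n l) (entered_from n l) (entered n l)"
  by (simp add: crosses_def entered_def entered_from_def)

lemma shear_of_real: "shear a b (of_real t * z) = of_real t * shear a b z"
  by (simp add: shear_def complex_eq_iff algebra_simps)

lemma linear_dual_map: "linear (dual_map m n)"
  by (rule linearI) (simp_all add: dual_map_def shear_def complex_eq_iff algebra_simps
      add_divide_distrib diff_divide_distrib)

lemma cross_dual_map:
  assumes "m \<ge> 2"
  shows "cross (dual_map m n z) (dual_map m n w) = - (sin (pi / real n) / sin (pi / real m)) * cross z w"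
proof -
  have "cross (shear a b z) (shear a b w) = - (sin a * sin b) * cross z w" for a b
    by (simp add: cross_def shear_def algebra_simps)
  then show ?thesis using sin_pi_div_pos[OF assms]
    by (simp add: dual_map_def cross_simps del: of_real_divide)
qed

lemma diagram_vector_pos_label:
  assumes "n \<ge> 2" "1 \<le> r" "1 \<le> c" "c \<le> n"
  shows "diagram_vector m n (pos_label n r c) = of_real (1 / (2 * sin (pi / real n))) *
    grid_vector (even (r + c)) (real r * (pi / real m)) (real c * (pi / real n)) (pi / real m) (pi / real n)"
proof -
  define N where "N = grid_normal (even (r + c)) (real c * (pi / real n)) (pi / real n)"
  have rc: "label_row n (pos_label n r c) = r" "label_col n (pos_label n r c) = c"
    using pos_label[OF assms(2-4)] by auto
  have n1: "n \<ge> 1" using assms(1) by simp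
  have r: "of_nat (r - Suc 0) = (of_nat r - 1 :: complex)" using assms(2) by (simp add: of_nat_diff)
  have nrm: "outward_normal n (right_index n (pos_label n r c)) = (if odd c then 1 else -1) * N"
    unfolding N_def by (rule normal_pos_label[OF n1 assms(2-4)])
  have "diagram_vector m n (pos_label n r c) =
    of_real (sin (real r * (pi / real m)) * (cos (pi / real m) + cos (pi / real n)) / sin (pi / real n)) * N"
    unfolding diagram_vector_def crossing_vector_def entered_def entered_from_def rc nrm by (simp add: r)
  also have "\<dots> = of_real (1 / (2 * sin (pi / real n))) *
      (of_real (2 * sin (real r * (pi / real m)) * (cos (pi / real m) + cos (pi / real n))) * N)"
    by simp
  finally show ?thesis unfolding grid_vector_def N_def .
qed

lemma diagram_potential_pos_label:
  assumes "1 \<le> r" "1 \<le> c" "c \<le> n"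
  shows "diagram_potential m n (pos_label n r c) =
     of_real (1 / (2 * sin (pi / real m) * sin (pi / real n))) *
     grid_potential (odd c) (even (r + c)) (real r * (pi / real m)) (real c * (pi / real n))
       (pi / real m) (pi / real n)"
  unfolding diagram_potential_def using pos_label[OF assms] by simp

lemma dual_map_diagram_vector:
  assumes "n \<ge> 2" "1 \<le> r" "1 \<le> c" "c \<le> n"
  shows "dual_map m n (diagram_vector m n (pos_label n r c)) =
     of_real (1 / (2 * sin (pi / real m) * sin (pi / real n))) *
     shear (pi / real m) (pi / real n)
       (grid_vector (even (r + c)) (real r * (pi / real m)) (real c * (pi / real n)) (pi / real m) (pi / real n))"
  unfolding dual_map_def diagram_vector_pos_label[OF assms] shear_of_real by simp

section \<open>Arrows of the diagram as steps on the dual surface\<close>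

lemma crossing_vector_label:
  assumes "m \<ge> 2" "1 \<le> c" "1 \<le> s" "s \<le> m"
  shows "crossing_vector n m ((c - 1) * m + s) =
    of_real (sin (real c * (pi / real n)) * (cos (pi / real m) + cos (pi / real n)) / sin (pi / real m)) *
    (if (odd m \<or> odd c) \<longleftrightarrow> odd s
     then Complex (sin (real s * (pi / real m))) (- cos (real s * (pi / real m)))
     else Complex (- sin ((real s - 1) * (pi / real m))) (- cos ((real s - 1) * (pi / real m))))"
proof -
  have m1: "m \<ge> 1" using assms(1) by simp
  have "right_odd m (c - 1) \<longleftrightarrow> odd m \<or> odd c"
    using assms(2) by (simp add: right_odd_def even_diff_nat)
  then show ?thesis
    unfolding crossing_vector_def right_index_def label_row_eq[OF assms(2-4)] normal_label_index[OF m1 assms(3,4)]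
    by (simp add: add.commute)
qed

lemma scaled_identity:
  fixes X P Q V :: complex and sa sb t :: real
  assumes "X + P - Q = of_real (2 * sb * y * t) * V" "sa \<noteq> 0" "sb \<noteq> 0"
  shows "of_real (1 / (2 * sa * sb)) * X + of_real (1 / (2 * sa * sb)) * P - of_real (1 / (2 * sa * sb)) * Q
    = of_real (y * t / sa) * V"
proof -
  have "of_real (1 / (2 * sa * sb)) * X + of_real (1 / (2 * sa * sb)) * P - of_real (1 / (2 * sa * sb)) * Q
    = of_real (1 / (2 * sa * sb)) * (X + P - Q)"
    by (simp only: distrib_left right_diff_distrib)
  also have "\<dots> = of_real (1 / (2 * sa * sb) * (2 * sb * y * t)) * V"
    unfolding assms(1) by (simp only: of_real_mult mult.assoc)
  also have "1 / (2 * sa * sb) * (2 * sb * y * t) = y * t / sa"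
    using assms(2,3) by (simp add: field_simps)
  finally show ?thesis .
qed

text \<open>Column c corresponds to polygon c - 1 of the dual surface, so a rightward arrow from
  column c crosses a dual edge of row c towards polygon c. For even c the label is rewritten to
  exhibit this row; a leftward arrow gives the opposite sign.\<close>

lemma h_arrow_right_step:
  assumes "m \<ge> 2" "n \<ge> 2" "1 \<le> r" "r \<le> m - 1" "1 \<le> c" "c < n"
    and l: "l = (if odd c then (c - 1) * m + (r + 1) else (c - 1) * m + (m + 1 - r))"
  shows "dual_map m n (diagram_vector m n (pos_label n r c)) + diagram_potential m n (pos_label n r (c + 1))
     - diagram_potential m n (pos_label n r c) = crossing_vector n m l"
proof -
  have c: "1 \<le> c + 1" "c + 1 \<le> n" "c \<le> n" using assms by auto
  define a b x y where "a = pi / real m" "b = pi / real n" "x = real r * a" "y = real c * b"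
  note ab = this
  have m0: "real m \<noteq> 0" using assms(1) by simp
  have y: "real (c + 1) * b = y + b" unfolding ab(4) by (simp add: distrib_right)
  have par: "odd (c + 1) = (\<not> odd c)" "even (r + (c + 1)) = (\<not> even (r + c))" by auto
  have cv: "crossing_vector n m l = of_real (sin y * (cos a + cos b) / sin a) *
     (if even (r + c) then Complex (- sin x) (if odd c then - cos x else cos x)
      else if odd c then Complex (sin (x + a)) (- cos (x + a)) else Complex (sin (x - a)) (cos (x - a)))"
  proof (cases "odd c")
    case True
    have s: "1 \<le> r + 1" "r + 1 \<le> m" using assms by auto
    have ang: "real (r + 1) * a = x + a" "(real (r + 1) - 1) * a = x"
      unfolding ab(3) by (simp_all add: distrib_right)
    show ?thesis unfolding l if_P[OF True] crossing_vector_label[OF assms(1,5) s, of n, folded ab(1,2), folded ab(4)] ang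
      using True by auto
  next
    case False
    have s: "1 \<le> m + 1 - r" "m + 1 - r \<le> m" using assms by auto
    have rs: "real (m + 1 - r) = real m + 1 - real r" using assms by (simp add: of_nat_diff)
    \<comment> \<open>In even columns the numbering is reversed, and supplementary angles lead back
      to the row angle \<open>x\<close>.\<close>
    have ang: "real (m + 1 - r) * a = pi - (x - a)" "(real (m + 1 - r) - 1) * a = pi - x"
      unfolding rs using m0 by (simp_all add: ab field_simps)
    have "odd (m + 1 - r) \<longleftrightarrow> (odd m \<longleftrightarrow> odd r)" using assms by (auto simp: even_diff_nat)
    moreover have "sin (pi - z) = sin z" "cos (pi - z) = - cos z" for z :: real by simp_all
    ultimately show ?thesis
      unfolding l if_not_P[OF False] crossing_vector_label[OF assms(1,5) s, of n, folded ab(1,2), folded ab(4)] ang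
      using False by auto
  qed
  show ?thesis
    unfolding dual_map_diagram_vector[OF assms(2,3,5) c(3)] diagram_potential_pos_label[OF assms(3) c(1,2)]
      diagram_potential_pos_label[OF assms(3,5) c(3)] ab[symmetric] y par cv
    by (rule scaled_identity[OF grid_right])
      (use sin_pi_div_pos[OF assms(1)] sin_pi_div_pos[OF assms(2)] in \<open>auto simp: ab\<close>)
qed

lemma h_arrow_left_step:
  assumes "m \<ge> 2" "n \<ge> 2" "1 \<le> r" "r \<le> m - 1" "1 \<le> c" "c < n"
    and l: "l = (if odd c then (c - 1) * m + r else (c - 1) * m + (m - r))"
  shows "dual_map m n (diagram_vector m n (pos_label n r (c + 1))) + diagram_potential m n (pos_label n r c)
     - diagram_potential m n (pos_label n r (c + 1)) = - crossing_vector n m l"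
proof -
  have c: "1 \<le> c + 1" "c + 1 \<le> n" "c \<le> n" using assms by auto
  define a b x y where "a = pi / real m" "b = pi / real n" "x = real r * a" "y = real c * b"
  note ab = this
  have m0: "real m \<noteq> 0" using assms(1) by simp
  have y: "real (c + 1) * b = y + b" unfolding ab(4) by (simp add: distrib_right)
  have par: "odd (c + 1) = (\<not> odd c)" "even (r + (c + 1)) = (\<not> even (r + c))" by auto
  have cv: "crossing_vector n m l = of_real (sin y * (cos a + cos b) / sin a) *
     (if even (r + c) then Complex (sin x) (if odd c then - cos x else cos x)
      else if odd c then Complex (- sin (x - a)) (- cos (x - a)) else Complex (- sin (x + a)) (cos (x + a)))"
  proof (cases "odd c")
    case True
    have s: "1 \<le> r" "r \<le> m" using assms by auto
    have ang: "real r * a = x" "(real r - 1) * a = x - a"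
      unfolding ab(3) by (simp_all add: left_diff_distrib)
    show ?thesis unfolding l if_P[OF True] crossing_vector_label[OF assms(1,5) s, of n, folded ab(1,2), folded ab(4)] ang
      using True by auto
  next
    case False
    have s: "1 \<le> m - r" "m - r \<le> m" using assms by auto
    have rs: "real (m - r) = real m - real r" using assms by (simp add: of_nat_diff)
    have ang: "real (m - r) * a = pi - x" "(real (m - r) - 1) * a = pi - (x + a)"
      unfolding rs using m0 by (simp_all add: ab field_simps)
    have "odd (m - r) \<longleftrightarrow> (odd m \<longleftrightarrow> even r)" using assms by (auto simp: even_diff_nat)
    moreover have "sin (pi - z) = sin z" "cos (pi - z) = - cos z" for z :: real by simp_all
    ultimately show ?thesis
      unfolding l if_not_P[OF False] crossing_vector_label[OF assms(1,5) s, of n, folded ab(1,2), folded ab(4)] ang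
      using False by auto
  qed
  have neg: "- (of_real (sin y * (cos a + cos b) / sin a) * V) = of_real (sin y * - (cos a + cos b) / sin a) * V"
    for V
    by (simp only: mult_minus_right mult_minus_left of_real_minus minus_divide_left[symmetric])
  show ?thesis
    unfolding dual_map_diagram_vector[OF assms(2,3) c(1,2)] diagram_potential_pos_label[OF assms(3) c(1,2)]
      diagram_potential_pos_label[OF assms(3,5) c(3)] ab[symmetric] y par cv neg
    by (rule scaled_identity[OF grid_left])
      (use sin_pi_div_pos[OF assms(1)] sin_pi_div_pos[OF assms(2)] in \<open>auto simp: ab\<close>)
qed

text \<open>A vertical arrow stays in its column, hence in one dual polygon, and the corrected path
  stands still.\<close>

lemma v_arrow_step:
  assumes "m \<ge> 2" "n \<ge> 2" "v_arrow m n p q"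
  shows "p \<in> labels m n" "q \<in> labels m n" "entered n p = entered_from n q" "label_col n p = label_col n q"
    and "dual_map m n (diagram_vector m n p) + diagram_potential m n q - diagram_potential m n p = 0"
proof -
  obtain r c where rc: "1 \<le> r" "r < m - 1" "1 \<le> c" "c \<le> n"
    and pq: "odd c \<and> p = pos_label n r c \<and> q = pos_label n (r + 1) c \<or>
             even c \<and> p = pos_label n (r + 1) c \<and> q = pos_label n r c"
    using assms(3) by (cases rule: v_arrow.cases) blast+
  have r1: "1 \<le> r + 1" by simp
  note P = pos_label[OF rc(1,3,4)] and P1 = pos_label[OF r1 rc(3,4)]
  have r2: "r \<le> m - 1" "r + 1 \<le> m - 1" using rc(2) by auto
  show "p \<in> labels m n" "q \<in> labels m n" using pq P(4)[OF r2(1)] P1(4)[OF r2(2)] by blast+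
  show "label_col n p = label_col n q" using pq P(2) P1(2) by metis
  show "entered n p = entered_from n q"
    using pq P(1,2) P1(1,2) unfolding entered_def entered_from_def by (metis add_diff_cancel_right')
  define a b where "a = pi / real m" "b = pi / real n"
  note ab = this
  have x: "real (r + 1) * a = real r * a + a" by (simp add: algebra_simps)
  have par: "even (r + 1 + c) = (\<not> even (r + c))" by auto
  note D = dual_map_diagram_vector[OF assms(2) rc(1,3,4), of m, folded ab]
    dual_map_diagram_vector[OF assms(2) r1 rc(3,4), of m, folded ab, unfolded x par]
    diagram_potential_pos_label[OF rc(1,3,4), of m, folded ab]
    diagram_potential_pos_label[OF r1 rc(3,4), of m, folded ab, unfolded x par]
  have sc: "of_real k * X + of_real k * P - of_real k * Q = 0" if "X + P - Q = 0"
    for k :: real and X P Q :: complex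
    using that by (metis distrib_left mult_zero_right right_diff_distrib)
  show "dual_map m n (diagram_vector m n p) + diagram_potential m n q - diagram_potential m n p = 0"
    using pq
  proof (elim disjE conjE)
    assume c: "odd c" "p = pos_label n r c" "q = pos_label n (r + 1) c"
    then have d: "odd c = True" by simp
    show ?thesis unfolding c(2,3) D unfolding d by (rule sc[OF grid_down])
  next
    assume c: "even c" "p = pos_label n (r + 1) c" "q = pos_label n r c"
    then have d: "odd c = False" by simp
    show ?thesis unfolding c(2,3) D unfolding d by (rule sc[OF grid_up])
  qed
qed

lemma h_arrow_step:
  assumes "m \<ge> 2" "n \<ge> 2" "h_arrow m n p q l"
  shows "p \<in> labels m n" "q \<in> labels m n" "l \<in> labels n m" "entered n p = entered_from n q"
    and "crosses (label_row m l) (label_col n p - 1) (label_col n q - 1)"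
    and "dual_map m n (diagram_vector m n p) + diagram_potential m n q - diagram_potential m n p =
      of_real (real (label_col n q - 1) - real (label_col n p - 1)) * crossing_vector n m l"
proof -
  have even_lab: "c * m - r + 1 = (c - 1) * m + (m + 1 - r)" "c * m - r = (c - 1) * m + (m - r)"
    if "1 \<le> c" "r \<le> m" for c r
    using that by (cases c; simp)+
  obtain r c where rc: "1 \<le> r" "r \<le> m - 1" "1 \<le> c" "c < n"
    and pq: "p = pos_label n r c \<and> q = pos_label n r (c + 1) \<and>
        l = (if odd c then (c - 1) * m + (r + 1) else (c - 1) * m + (m + 1 - r)) \<or>
      p = pos_label n r (c + 1) \<and> q = pos_label n r c \<and>
        l = (if odd c then (c - 1) * m + r else (c - 1) * m + (m - r))"
    using assms(3)
  proof (cases rule: h_arrow.cases)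
    case (odd_left r c)
    then show ?thesis using that[of r c] by simp
  next
    case (odd_right r c)
    then show ?thesis using that[of r c] by (simp add: add.assoc)
  next
    case (even_right r c)
    moreover have "r \<le> m" using even_right by linarith
    ultimately show ?thesis using that[of r c] even_lab[of c r] by simp
  next
    case (even_left r c)
    moreover have "r \<le> m" using even_left by linarith
    ultimately show ?thesis using that[of r c] even_lab[of c r] by simp
  qed
  have c: "1 \<le> c + 1" "c + 1 \<le> n" "c \<le> n" "c \<le> n - 1" using rc by auto
  note P = pos_label[OF rc(1,3) c(3)] and P1 = pos_label[OF rc(1) c(1,2)]
  show "p \<in> labels m n" "q \<in> labels m n" using pq P(4)[OF rc(2)] P1(4)[OF rc(2)] by blast+
  have "(if odd c then r else r - 1) = (if odd (c + 1) then r - 1 else r)"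
    "(if odd (c + 1) then r else r - 1) = (if odd c then r - 1 else r)" by simp_all
  then show "entered n p = entered_from n q"
    using pq P(1,2) P1(1,2) unfolding entered_def entered_from_def by metis
  obtain s where s: "l = (c - 1) * m + s" "1 \<le> s" "s \<le> m"
  proof -
    have bd: "1 \<le> r + 1" "r + 1 \<le> m" "1 \<le> m + 1 - r" "m + 1 - r \<le> m" "r \<le> m" "1 \<le> m - r" "m - r \<le> m"
      using rc(1,2) assms(1) by linarith+
    consider "l = (c - 1) * m + (r + 1)" | "l = (c - 1) * m + (m + 1 - r)"
      | "l = (c - 1) * m + r" | "l = (c - 1) * m + (m - r)"
      using pq by presburger
    then show ?thesis
    proof cases
      case 1 show ?thesis by (rule that[OF 1 bd(1,2)])
    next
      case 2 show ?thesis by (rule that[OF 2 bd(3,4)])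
    next
      case 3 show ?thesis by (rule that[OF 3 rc(1) bd(5)])
    next
      case 4 show ?thesis by (rule that[OF 4 bd(6,7)])
    qed
  qed
  show "l \<in> labels n m" unfolding s(1) by (rule label_in_labels[OF rc(3) c(4) s(2,3)])
  have "label_row m l = c" unfolding s(1) by (rule label_row_eq(1)[OF rc(3) s(2,3)])
  then show "crosses (label_row m l) (label_col n p - 1) (label_col n q - 1)"
    using pq P(2) P1(2) unfolding crosses_def by (metis add_diff_cancel_right')
  have r: "real (c - 1) = real c - 1" "c + 1 - 1 = c" using rc by auto
  show "dual_map m n (diagram_vector m n p) + diagram_potential m n q - diagram_potential m n p =
      of_real (real (label_col n q - 1) - real (label_col n p - 1)) * crossing_vector n m l"
    using pq
  proof (elim disjE conjE)
    assume a: "p = pos_label n r c" "q = pos_label n r (c + 1)"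
      "l = (if odd c then (c - 1) * m + (r + 1) else (c - 1) * m + (m + 1 - r))"
    show ?thesis using h_arrow_right_step[OF assms(1,2) rc a(3)] unfolding a(1,2) P(2) P1(2) r by simp
  next
    assume a: "p = pos_label n r (c + 1)" "q = pos_label n r c"
      "l = (if odd c then (c - 1) * m + r else (c - 1) * m + (m - r))"
    show ?thesis using h_arrow_left_step[OF assms(1,2) rc a(3)] unfolding a(1,2) P(2) P1(2) r by simp
  qed
qed

section \<open>Derivation\<close>

text \<open>The blocks between consecutive values of \<open>f\<close> cover all integers, so each
  position of a word falls between two letters of the derived word.\<close>

lemma strict_mono_int_bracket:
  fixes f :: "int \<Rightarrow> int"
  assumes "strict_mono f"
  obtains i where "f i < j" "j \<le> f (i + 1)"
proof -
  have up: "f i + d \<le> f (i + d)" if "0 \<le> d" for i d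
    using that
  proof (induction d rule: int_ge_induct)
    case (step d)
    have "f (i + d) < f (i + (d + 1))" using assms by (simp add: strict_mono_def)
    then show ?case using step by simp
  qed simp
  define i0 where "i0 = - \<bar>j - 1 - f 0\<bar>"
  have "f i0 < j" using up[of "- i0" i0] by (simp add: i0_def)
  show ?thesis
  proof (rule ccontr)
    assume "\<not> thesis"
    then have st: "f (i + 1) < j" if "f i < j" for i using that \<open>\<And>i. f i < j \<Longrightarrow> j \<le> f (i + 1) \<Longrightarrow> thesis\<close>
      by force
    have "f (i0 + d) < j" if "0 \<le> d" for d
      using that
    proof (induction d rule: int_ge_induct)
      case (step d)
      then show ?case using st[of "i0 + d"] by (simp add: add.assoc)
    qed (use \<open>f i0 < j\<close> in simp)
    moreover have "f i0 + \<bar>j - f i0\<bar> \<le> f (i0 + \<bar>j - f i0\<bar>)" by (rule up) simp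
    ultimately show False by (smt (verit))
  qed
qed

lemma gamma_dual_map:
  assumes "m \<ge> 2" "n \<ge> 2"
  shows "gamma m n z = of_real (sqrt (sin (pi / real m) / sin (pi / real n))) * dual_map m n z"
proof -
  define sm sn k where "sm = sin (pi / real m)" "sn = sin (pi / real n)"
    "k = cos (pi / real m) + cos (pi / real n)"
  note d = this
  have pos: "sm > 0" "sn > 0" using sin_pi_div_pos assms by (auto simp: d)
  define u v where "u = sqrt sm" "v = sqrt sn"
  have uv: "u > 0" "v > 0" "sm = u * u" "sn = v * v" using pos by (simp_all add: u_v_def)
  have q: "sqrt (sn / sm) = v / u" "sqrt (sm * sn) = u * v" "sqrt (sm / sn) = u / v"
    by (simp_all add: u_v_def real_sqrt_divide real_sqrt_mult)
  show ?thesis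
    unfolding gamma_def Let_def dual_map_def shear_def d[symmetric] q
    using uv(1,2) by (simp add: complex_eq_iff uv(3,4) field_simps)
qed

lemma act_gamma:
  assumes "m \<ge> 2" "n \<ge> 2" "0 < \<theta>" "\<theta> < pi"
  shows "0 < act (gamma m n) \<theta>" "act (gamma m n) \<theta> < pi"
    and "\<exists>c>0. dual_map m n (cis \<theta>) = of_real c * cis (act (gamma m n) \<theta>)"
proof -
  define s where "s = sqrt (sin (pi / real m) / sin (pi / real n))"
  have s: "s > 0" using sin_pi_div_pos assms by (simp add: s_def)
  define z where "z = gamma m n (cis \<theta>)"
  have z: "z = of_real s * dual_map m n (cis \<theta>)" unfolding z_def s_def by (rule gamma_dual_map[OF assms(1,2)])
  have "Im (dual_map m n (cis \<theta>)) = sin \<theta>"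
    using sin_pi_div_pos[OF assms(1)] by (simp add: dual_map_def shear_def)
  then have im: "Im z > 0" using s sin_gt_zero[OF assms(3,4)] by (simp add: z)
  then show "0 < act (gamma m n) \<theta>" "act (gamma m n) \<theta> < pi"
    using Arg_lt_pi[of z] unfolding act_def z_def by auto
  have z0: "z \<noteq> 0" using im by auto
  have "z = of_real (norm z) * cis (Arg z)"
    using rcis_cmod_Arg[of z] by (simp add: rcis_def)
  then have "of_real s * dual_map m n (cis \<theta>) = of_real (norm z) * cis (act (gamma m n) \<theta>)"
    by (simp add: z act_def z_def[symmetric] flip: z)
  then have "dual_map m n (cis \<theta>) = of_real (norm z / s) * cis (act (gamma m n) \<theta>)"
    using s by (simp add: field_simps)
  moreover have "norm z / s > 0" using s z0 by simp
  ultimately show "\<exists>c>0. dual_map m n (cis \<theta>) = of_real c * cis (act (gamma m n) \<theta>)" by blast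
qed

lemma pi_div_le_pi_half: "n \<ge> 2 \<Longrightarrow> pi / real n \<le> pi / 2"
  by (intro divide_left_mono) auto

lemma cos_pi_div_nonneg:
  assumes "n \<ge> 2"
  shows "0 \<le> cos (pi / real n)"
proof (rule cos_ge_zero)
  have "- (pi / 2) \<le> 0" "0 \<le> pi / real n" by simp_all
  then show "- (pi / 2) \<le> pi / real n" by (rule order_trans)
qed (rule pi_div_le_pi_half[OF assms])

text \<open>Settles the sign of a development in the standard sector, whose inner directions have
  positive cosine.\<close>

lemma Re_diagram_vector_nonneg:
  assumes "m \<ge> 2" "n \<ge> 2" "1 \<le> r" "r \<le> m - 1" "1 \<le> c" "c \<le> n"
  shows "0 \<le> Re (diagram_vector m n (pos_label n r c))"
proof -
  have mul: "0 \<le> sin (real x * (pi / real d))" if "x \<le> d" "d \<ge> 2" for x d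
  proof (rule sin_ge_zero)
    have "real x * (pi / real d) \<le> real d * (pi / real d)" using that by (intro mult_right_mono) auto
    then show "real x * (pi / real d) \<le> pi" using that by simp
  qed simp
  have y: "real c * (pi / real n) - pi / real n = real (c - 1) * (pi / real n)"
    using assms(5) by (simp add: of_nat_diff left_diff_distrib del: times_divide_eq_right)
  have "0 \<le> Re (grid_normal (even (r + c)) (real c * (pi / real n)) (pi / real n))"
    unfolding grid_normal_def y using mul[of c n] mul[of "c - 1" n] assms by simp
  moreover have "0 \<le> sin (real r * (pi / real m))" using mul[of r m] assms by simp
  ultimately have "0 \<le> 1 / (2 * sin (pi / real n)) * (2 * sin (real r * (pi / real m)) * (cos (pi / real m) + cos (pi / real n))
      * Re (grid_normal (even (r + c)) (real c * (pi / real n)) (pi / real n)))"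
    using cos_pi_div_nonneg assms(1,2) sin_pi_div_pos[OF assms(2)]
    by (intro mult_nonneg_nonneg add_nonneg_nonneg) auto
  moreover have "Re (of_real t * z) = t * Re z" for t z by simp
  ultimately show ?thesis
    unfolding diagram_vector_pos_label[OF assms(2,3,5,6)] grid_vector_def by (simp only:)
qed

lemma label_as_pos_label:
  assumes "l \<in> labels m n" "n \<ge> 1"
  shows "l = pos_label n (label_row n l) (label_col n l)" "1 \<le> label_col n l" "label_col n l \<le> n"
proof -
  note b = label_bounds[OF assms]
  show c: "1 \<le> label_col n l" "label_col n l \<le> n" using b(4,5) by (auto simp: label_col_def)
  have "(if odd (label_row n l) then label_col n l else n + 1 - label_col n l) = (l - 1) mod n + 1"
    using b(5) by (auto simp: label_col_def)
  then show "l = pos_label n (label_row n l) (label_col n l)"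
    unfolding pos_label_eq[OF b(1) c] using b(6) by simp
qed

text \<open>The image \<open>G\<close> of the centres, corrected by the potential, rests along
  vertical arrows and makes a dual step along horizontal ones, so sampling it at \<open>f\<close>
  develops the derived word.\<close>

lemma derived_develops:
  assumes mn: "m \<ge> 2" "n \<ge> 2" and der: "derived m n u W"
    and dev: "develops m n u K Z" and dir: "directed Z \<theta>" and spr: "spread Z \<theta>"
    and th: "0 < \<theta>" "\<theta> < pi / real n"
  defines "\<theta>' \<equiv> act (gamma m n) \<theta>"
  shows "\<exists>K Z. develops n m W K Z \<and> directed Z \<theta>' \<and> spread Z \<theta>'"
proof -
  have n1: "n \<ge> 1" using mn by simp
  obtain f where path: "\<And>j. (\<exists>l. h_arrow m n (u j) (u (j + 1)) l) \<or> v_arrow m n (u j) (u (j + 1))"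
    and f: "strict_mono f" "range f = {j. \<exists>l. h_arrow m n (u j) (u (j + 1)) l}"
    and W: "\<And>j. h_arrow m n (u (f j)) (u (f j + 1)) (W j)"
    using der unfolding derived_def by blast
  have lab: "u j \<in> labels m n" for j
    using path[of j] h_arrow_step(1)[OF mn] v_arrow_step(1)[OF mn] by blast
  have ent: "entered n (u j) = entered_from n (u (j + 1))" for j
    using path[of j] h_arrow_step(4)[OF mn] v_arrow_step(3)[OF mn] by blast
  define K0 where "K0 j = entered_from n (u j)" for j
  have K0: "K0 (j + 1) = entered n (u j)" for j using ent[of j] by (simp add: K0_def)
  have "crosses (label_row n (u j)) (K0 j) (K0 (j + 1))" for j
    unfolding K0 unfolding K0_def by (rule crosses_entered)
  note alt = develops_other_crossings[OF dev this]
  have pin: "pi / real n \<le> pi / 2" by (rule pi_div_le_pi_half[OF mn(2)])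
  \<comment> \<open>The opposite development would make \<open>Z\<close> move weakly to the left
    throughout, contrary to cos \<theta> > 0.\<close>
  have dev0: "develops m n u K0 Z"
  proof (rule ccontr)
    assume "\<not> ?thesis"
    then have dev': "develops m n u K0 (\<lambda>j. - Z j)" using alt by blast
    have "0 \<le> cross \<i> ((Z (j + 1) + 0) - (Z j + 0))" for j
    proof -
      have "- Z (j + 1) = - Z j + of_real (real (K0 (j + 1)) - real (K0 j)) * crossing_vector m n (u j)"
        using dev' unfolding develops_def by blast
      then have "Z (j + 1) - Z j = - diagram_vector m n (u j)"
        unfolding K0 unfolding K0_def diagram_vector_def by (simp add: algebra_simps)
      moreover have "0 \<le> Re (diagram_vector m n (u j))"
        using Re_diagram_vector_nonneg[OF mn label_bounds(1,2)[OF lab n1] label_as_pos_label(2,3)[OF lab n1]]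
          label_as_pos_label(1)[OF lab n1] by metis
      ultimately show ?thesis by (simp add: cross_def)
    qed
    then have "0 \<le> cross \<i> (cis \<theta>)" using directed_cone[OF dir, of "\<lambda>_. 0"] by simp
    moreover have "0 < cos \<theta>" using th pin pi_gt_zero by (intro cos_gt_zero_pi; linarith)
    ultimately show False by (simp add: cross_def)
  qed
  have Z: "Z (j + 1) = Z j + diagram_vector m n (u j)" for j
    using dev0 K0[of j] unfolding develops_def diagram_vector_def K0_def by metis
  define G where "G j = dual_map m n (Z j) + diagram_potential m n (u j)" for j
  have G: "G (j + 1) = G j + (dual_map m n (diagram_vector m n (u j)) + diagram_potential m n (u (j + 1))
      - diagram_potential m n (u j))" for j
    by (simp add: G_def Z linear_add[OF linear_dual_map])
  have between: "G j = G (f i + 1) \<and> label_col n (u j) = label_col n (u (f i + 1))" if "f i + 1 \<le> j" "j \<le> f (i + 1)" for i j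
    using that
  proof (induction j rule: int_ge_induct)
    case (step j)
    have "j \<notin> range f"
    proof
      assume "j \<in> range f"
      then obtain k where "j = f k" by blast
      then have "f i < f k" "f k < f (i + 1)" using step by auto
      then have "i < k" "k < i + 1" using f(1) by (simp_all add: strict_mono_less)
      then show False by simp
    qed
    then have "v_arrow m n (u j) (u (j + 1))" using path[of j] f(2) by blast
    from v_arrow_step(4,5)[OF mn this] step G[of j] show ?case by simp
  qed simp
  have lt: "f i + 1 \<le> f (i + 1)" for i using f(1) strict_monoD[OF f(1), of i "i + 1"] by simp
  define K' where "K' i = label_col n (u (f i)) - 1" for i
  define Z' where "Z' i = G (f i)" for i
  have K': "K' (i + 1) = label_col n (u (f i + 1)) - 1" for i
    using between[OF lt order_refl, of i] by (simp add: K'_def)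
  have Z': "Z' (i + 1) = G (f i + 1)" for i using between[OF lt order_refl, of i] by (simp add: Z'_def)
  have "develops n m W K' Z'" unfolding develops_def
  proof (intro allI conjI)
    fix i
    note h = h_arrow_step[OF mn W[of i]]
    show "W i \<in> labels n m" by (rule h(3))
    show "crosses (label_row m (W i)) (K' i) (K' (i + 1))" using h(5) unfolding K' unfolding K'_def .
    show "Z' (i + 1) = Z' i + of_real (real (K' (i + 1)) - real (K' i)) * crossing_vector n m (W i)"
      unfolding Z' G h(6) K' unfolding Z'_def K'_def ..
  qed
  moreover have pinu: "finite (range (\<lambda>j. diagram_potential m n (u j)))"
    by (rule finite_range_labels[OF lab])
  have "\<theta> < pi" using th pin pi_gt_zero by linarith
  then obtain c where c: "c > 0" "dual_map m n (cis \<theta>) = of_real c * cis \<theta>'"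
    using act_gamma(3)[OF mn th(1)] unfolding \<theta>'_def by blast
  have "directed Z' \<theta>'"
  proof (rule directed_transfer[OF dir linear_dual_map c(2,1) f(1)])
    show "finite (range (\<lambda>i. diagram_potential m n (u (f i))))"
      by (rule finite_subset[OF _ pinu]) auto
    show "Z' i = dual_map m n (Z (f i)) + diagram_potential m n (u (f i))" for i
      by (simp add: Z'_def G_def)
  qed
  moreover have "spread Z' \<theta>'"
  proof (rule spread_transfer[OF spr c(2) cross_dual_map[OF mn(1)] _ pinu])
    show "- (sin (pi / real n) / sin (pi / real m)) \<noteq> 0"
      using sin_pi_div_pos[OF mn(1)] sin_pi_div_pos[OF mn(2)] by simp
    fix j
    \<comment> \<open>\<open>G\<close> is constant on blocks, so the sampling loses none of its
      values.\<close>
    obtain i where i: "f i < j" "j \<le> f (i + 1)" using strict_mono_int_bracket[OF f(1)] by blast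
    then have "G j = Z' (i + 1)" using between[of i j] Z' by simp
    then show "\<exists>i. Z' i = dual_map m n (Z j) + diagram_potential m n (u j)" by (metis G_def)
  qed
  ultimately show ?thesis by blast
qed

section \<open>Normalization and the itinerary\<close>

text \<open>Stated for the two sides in either order, since a reflection may send a right edge to
  the other side of its image.\<close>

lemma two_sides:
  assumes "side_label m n k e l" "side_label m n k' e' l" "k \<noteq> k'" "n \<ge> 2"
  shows "crosses (label_row n l) k k'"
    and "of_real (real k' - real k) * crossing_vector m n l =
      midpoint_offset m n k e - midpoint_offset m n k' e'"
proof -
  have n1: "n \<ge> 1" using assms(4) by simp
  have l: "l \<in> labels m n" using assms(1) unfolding side_label_iff[OF n1] by simp
  have "real (label_row n l - 1) = real (label_row n l) - 1" using label_row_ge_1[of n l] by simp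
  moreover have "k = label_row n l - 1 \<and> e = right_index n l \<and> k' = label_row n l \<and> e' = (right_index n l + n) mod (2 * n)
    \<or> k' = label_row n l - 1 \<and> e' = right_index n l \<and> k = label_row n l \<and> e = (right_index n l + n) mod (2 * n)"
    using assms(1-3) unfolding side_label_iff[OF n1] by metis
  ultimately show "crosses (label_row n l) k k'"
    "of_real (real k' - real k) * crossing_vector m n l =
      midpoint_offset m n k e - midpoint_offset m n k' e'"
    unfolding crossing_apothems[OF l assms(4)] crosses_def by auto
qed

lemma crosses_sides:
  assumes "l \<in> labels m n" "crosses (label_row n l) k k'" "n \<ge> 1"
  obtains e e' where "side_label m n k e l" "side_label m n k' e' l"
  using assms unfolding side_label_iff[OF assms(3)] crosses_def by blast

text \<open>Labeled edges have length sin(r\<pi>/m) with 0 < r < m. \<open>induced_perm\<close> only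
  constrains nonzero edges, so this is what makes it applicable to letters.\<close>

lemma side_label_edge_nonzero:
  assumes "m \<ge> 2" "n \<ge> 2" "side_label m n k e l"
  shows "k < m" "e < 2 * n" "BM_edge m n k e \<noteq> 0"
proof -
  have n1: "n \<ge> 1" using assms(2) by simp
  have l: "l \<in> labels m n" using assms(3) unfolding side_label_iff[OF n1] by simp
  note b = label_bounds[OF l n1]
  define r where "r = label_row n l"
  have r: "Suc (r - 1) = r" "r - 1 + 1 = r" by (simp_all add: r_def)
  note re = right_edge_right_index[OF l n1, folded r_def]
  note L = len_right_edge(1)[OF re, of m] len_left_edge(1)[OF re n1, of m]
  have "len m n k e = sin (real r * pi / real m)"
    using assms(3) L unfolding side_label_iff[OF n1] r_def[symmetric] r by metis
  moreover have "0 < sin (real r * pi / real m)"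
  proof (rule sin_gt_zero)
    show "0 < real r * pi / real m" using b(1) assms(1) by (simp add: r_def)
    have "real r * pi / real m < real m * pi / real m"
      using b(3) assms(1) by (intro divide_strict_right_mono mult_strict_right_mono) (auto simp: r_def)
    then show "real r * pi / real m < pi" using assms(1) by simp
  qed
  ultimately show "BM_edge m n k e \<noteq> 0" by (simp add: BM_edge_len)
  show "k < m" using assms(3) b(3) unfolding side_label_iff[OF n1] by linarith
  show "e < 2 * n" using assms(3) right_index_less[OF n1, of l] n1 unfolding side_label_iff[OF n1] by auto
qed

lemma linear_phi: "linear (phi m n i)"
  by (rule linearI) (simp_all add: phi_def distrib_left scaleR_conv_of_real mult.left_commute)

lemma phi_cis: "phi m n i (cis \<theta>) = cis (real (i + 1) * pi / real n - \<theta>)"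
  by (simp only: phi_def cis_cnj cis_mult) simp

lemma cross_phi: "cross (phi m n i z) (phi m n i w) = - 1 * cross z w"
proof -
  have c: "cross u v = Im (cnj u * v)" for u v by (simp add: cross_def)
  have "cnj (phi m n i z) * phi m n i w =
      (cnj (cis (real (i + 1) * pi / real n)) * cis (real (i + 1) * pi / real n)) * (z * cnj w)"
    unfolding phi_def complex_cnj_mult complex_cnj_cnj by (simp only: mult_ac)
  also have "\<dots> = z * cnj w" unfolding cis_cnj cis_mult by simp
  finally show ?thesis unfolding c by simp
qed

lemma act_phi:
  assumes "n \<ge> 1" "real i * pi / real n < \<theta>" "\<theta> < real (i + 1) * pi / real n"
  shows "act (phi m n i) \<theta> = real (i + 1) * pi / real n - \<theta>"
    and "0 < act (phi m n i) \<theta>" "act (phi m n i) \<theta> < pi / real n"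
proof -
  have w: "real (i + 1) * pi / real n = real i * pi / real n + pi / real n"
    by (simp add: distrib_right add_divide_distrib)
  have "pi / real n \<le> pi" using assms(1) by (simp add: divide_le_eq)
  then have "real (i + 1) * pi / real n - \<theta> \<in> {- pi<..pi}" using assms w by auto
  then show a: "act (phi m n i) \<theta> = real (i + 1) * pi / real n - \<theta>"
    unfolding act_def phi_cis by (rule Arg_cis)
  show "0 < act (phi m n i) \<theta>" "act (phi m n i) \<theta> < pi / real n" unfolding a using assms w by auto
qed

text \<open>A reflection need not fix the centres of the polygons: it moves them by a quantity that
  depends on the polygon only, which cancels along a developed path.\<close>

lemma induced_perm_develops:
  assumes mn: "m \<ge> 2" "n \<ge> 2" and perm: "induced_perm m n i \<pi>"
    and dev: "develops m n W K Z" and dir: "directed Z \<theta>" and spr: "spread Z \<theta>"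
  defines "\<theta>' \<equiv> real (i + 1) * pi / real n - \<theta>"
  shows "\<exists>K Z. develops m n (\<lambda>j. \<pi> (W j)) K Z \<and> directed Z \<theta>' \<and> spread Z \<theta>'"
proof -
  have n1: "n \<ge> 1" using mn by simp
  obtain \<rho> \<eta> t where rho: "\<rho> permutes {..<m}" and sym: "\<And>k e. k < m \<Longrightarrow> e < 2 * n \<Longrightarrow> BM_edge m n k e \<noteq> 0 \<Longrightarrow>
      phi m n i (BM_vertex m n k e) + t k = BM_vertex m n (\<rho> k) (\<eta> k e + 1) \<and>
      phi m n i (BM_vertex m n k (e + 1)) + t k = BM_vertex m n (\<rho> k) (\<eta> k e) \<and>
      (\<forall>l. side_label m n k e l \<longrightarrow> side_label m n (\<rho> k) (\<eta> k e) (\<pi> l))"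
    using perm unfolding induced_perm_def by blast
  define \<delta> where "\<delta> k = phi m n i (centre m n k) + t k - centre m n (\<rho> k)" for k
  \<comment> \<open>A reflection exchanges the ends of an edge but respects midpoints, which give
    the offsets.\<close>
  have mid: "centre m n k + midpoint_offset m n k e = of_real (1/2) * (BM_vertex m n k e + BM_vertex m n k (e + 1))"
    for k e
  proof -
    have "BM_vertex m n k (e + 1) = BM_vertex m n k e + BM_edge m n k e"
      by (simp add: BM_edge_eq_vertex_diff)
    then show ?thesis unfolding BM_vertex_eq[OF mn(2), of m k e] by (simp add: field_simps)
  qed
  have refl: "midpoint_offset m n (\<rho> k) (\<eta> k e) = phi m n i (midpoint_offset m n k e) + \<delta> k"
    and lab': "side_label m n (\<rho> k) (\<eta> k e) (\<pi> l)"
    if "side_label m n k e l" for k e l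
  proof -
    note s = sym[OF side_label_edge_nonzero[OF mn that]]
    show "side_label m n (\<rho> k) (\<eta> k e) (\<pi> l)" using s that by blast
    have half: "phi m n i (of_real (1/2) * z) = of_real (1/2) * phi m n i z" for z
      by (simp add: phi_def)
    have "phi m n i (centre m n k + midpoint_offset m n k e) + t k =
      of_real (1/2) * (phi m n i (BM_vertex m n k e) + t k + (phi m n i (BM_vertex m n k (e + 1)) + t k))"
      unfolding mid half linear_add[OF linear_phi] by (simp add: field_simps)
    also have "\<dots> = centre m n (\<rho> k) + midpoint_offset m n (\<rho> k) (\<eta> k e)"
      unfolding mid using s by (simp add: add.commute)
    finally show "midpoint_offset m n (\<rho> k) (\<eta> k e) = phi m n i (midpoint_offset m n k e) + \<delta> k"
      unfolding \<delta>_def linear_add[OF linear_phi] by (simp add: algebra_simps)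
  qed
  have W: "W j \<in> labels m n" "crosses (label_row n (W j)) (K j) (K (j + 1))"
    "Z (j + 1) = Z j + of_real (real (K (j + 1)) - real (K j)) * crossing_vector m n (W j)" for j
    using dev unfolding develops_def by blast+
  have Km: "K j < m" for j
    using W(2)[of j] label_bounds(3)[OF W(1) n1, of j] unfolding crosses_def by auto
  define K' where "K' j = \<rho> (K j)" for j
  define Z' where "Z' j = phi m n i (Z j) + - \<delta> (K j)" for j
  have "develops m n (\<lambda>j. \<pi> (W j)) K' Z'" unfolding develops_def
  proof (intro allI)
    fix j
    obtain e e' where e: "side_label m n (K j) e (W j)" "side_label m n (K (j + 1)) e' (W j)"
      using crosses_sides[OF W(1,2) n1] by blast
    have "K j \<noteq> K (j + 1)" using W(2)[of j] label_row_ge_1[of n "W j"] unfolding crosses_def by linarith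
    then have ne': "K' j \<noteq> K' (j + 1)" using permutes_inj[OF rho] unfolding K'_def by (meson injD)
    note sides = two_sides[OF e \<open>K j \<noteq> K (j + 1)\<close> mn(2)]
    note sides' = two_sides[OF lab'[OF e(1)] lab'[OF e(2)] ne'[unfolded K'_def] mn(2), folded K'_def]
    have "\<pi> (W j) \<in> labels m n" using lab'[OF e(1)] unfolding side_label_iff[OF n1] by simp
    moreover have "Z' (j + 1) = Z' j + of_real (real (K' (j + 1)) - real (K' j)) * crossing_vector m n (\<pi> (W j))"
      unfolding Z'_def sides'(2) W(3) sides(2) refl[OF e(1), folded K'_def] refl[OF e(2), folded K'_def]
        linear_add[OF linear_phi] linear_diff[OF linear_phi] by simp
    ultimately show "\<pi> (W j) \<in> labels m n \<and> crosses (label_row n (\<pi> (W j))) (K' j) (K' (j + 1)) \<and>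
      Z' (j + 1) = Z' j + of_real (real (K' (j + 1)) - real (K' j)) * crossing_vector m n (\<pi> (W j))"
      using sides'(1) by blast
  qed
  moreover have fin: "finite (range (\<lambda>j. - \<delta> (K j)))"
    by (rule finite_subset[of _ "(\<lambda>k. - \<delta> k) ` {..<m}"]) (use Km in auto)
  have c: "phi m n i (cis \<theta>) = of_real 1 * cis \<theta>'" unfolding \<theta>'_def phi_cis by simp
  have "directed Z' \<theta>'"
    by (rule directed_transfer[OF dir linear_phi c _ strict_mono_id fin]) (simp_all add: Z'_def)
  moreover have "spread Z' \<theta>'"
    by (rule spread_transfer[OF spr c cross_phi _ fin]) (auto simp: Z'_def)
  ultimately show ?thesis by blast
qed

text \<open>The invariant of the iteration. The sector is open so that the next image under
  \<open>gamma\<close> lies strictly between 0 and \<pi>.\<close>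

definition standard_path :: "nat \<Rightarrow> nat \<Rightarrow> biword \<Rightarrow> real \<Rightarrow> bool" where
  "standard_path m n u \<theta> \<longleftrightarrow> 0 < \<theta> \<and> \<theta> < pi / real n \<and>
     (\<exists>K Z. develops m n u K Z \<and> directed Z \<theta> \<and> spread Z \<theta>)"

text \<open>The sector used by the normalization is not given as \<open>a\<close>; both contain the
  new direction in their interior, hence they agree, and the reflection applied to the word is that
  of the Farey branch.\<close>

lemma standard_path_step:
  assumes mn: "m \<ge> 2" "n \<ge> 2" and path: "standard_path m n u \<theta>" and der: "derived m n u W"
    and norm: "normalized n m W u'" and a: "a \<in> {1..m - 1}" and adm: "admissible n m a W"
  shows "act (gamma m n) \<theta> \<in> sector n m a" "standard_path n m u' (farey_half m n \<theta>)"
proof -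
  define \<theta>' where "\<theta>' = act (gamma m n) \<theta>"
  have m1: "m \<ge> 1" using mn by simp
  have th: "0 < \<theta>" "\<theta> < pi / real n" using path by (auto simp: standard_path_def)
  have "\<theta> < pi" using th pi_div_le_pi_half[OF mn(2)] pi_gt_zero by linarith
  note act = act_gamma(1,2)[OF mn th(1) this, folded \<theta>'_def]
  obtain K Z where Z: "develops n m W K Z" "directed Z \<theta>'" "spread Z \<theta>'"
    using path derived_develops[OF mn der _ _ _ th] unfolding standard_path_def \<theta>'_def by blast
  note dirn = admissible_direction[OF mn(2,1) _ _ Z less_imp_le[OF act(1)] less_imp_le[OF act(2)]]
  have am: "a < m" using a mn by auto
  note sa = dirn[OF am adm]
  then show "act (gamma m n) \<theta> \<in> sector n m a"
    unfolding \<theta>'_def[symmetric] by (auto simp: sector_def simp del: of_nat_add of_nat_Suc)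
  obtain i \<pi> where i: "i < m" "admissible n m i W" and pi: "induced_perm n m i \<pi>" and u': "\<And>j. u' j = \<pi> (W j)"
    using norm unfolding normalized_def by blast
  \<comment> \<open>Since the direction is interior to sector \<open>a\<close>, no other closed
    sector contains it; the tie-breaking rule of \<open>farey_half\<close> is never invoked.\<close>
  have uniq: "j = a" if "real j * pi / real m \<le> \<theta>'" "\<theta>' \<le> real (j + 1) * pi / real m" for j
  proof -
    have less: "x < y" if "real x * pi / real m < real y * pi / real m" for x y
      using that m1 by (simp add: divide_less_cancel)
    have "j < a + 1" using less[of j "a + 1"] that(1) sa by linarith
    moreover have "a < j + 1" using less[of a "j + 1"] that(2) sa by linarith
    ultimately show ?thesis by simp
  qed
  have ia: "i = a" using dirn[OF i] by (intro uniq) auto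
  have "(LEAST j. 1 \<le> j \<and> j \<le> m - 1 \<and> \<theta>' \<in> sector n m j) = a"
  proof (rule Least_equality)
    show "1 \<le> a \<and> a \<le> m - 1 \<and> \<theta>' \<in> sector n m a"
      using a sa by (auto simp: sector_def simp del: of_nat_add of_nat_Suc)
    fix j assume "1 \<le> j \<and> j \<le> m - 1 \<and> \<theta>' \<in> sector n m j"
    then have "j = a" by (intro uniq) (auto simp: sector_def simp del: of_nat_add of_nat_Suc)
    then show "a \<le> j" by simp
  qed
  then have fh: "farey_half m n \<theta> = act (phi n m a) \<theta>'"
    unfolding farey_half_def Let_def \<theta>'_def[symmetric] by simp
  note ap = act_phi[OF m1, of a \<theta>' n]
  have u'_eq: "u' = (\<lambda>j. \<pi> (W j))" using u' by auto
  show "standard_path n m u' (farey_half m n \<theta>)"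
    unfolding standard_path_def fh u'_eq
    using induced_perm_develops[OF mn(2,1) pi[unfolded ia] Z] ap sa by auto
qed

text \<open>The trajectory of \<open>w\<close> itself realizes all its arrows, so \<open>w\<close>
  is admissible in sector 0, and non-periodicity moves \<theta> off the boundary.\<close>

lemma cutting_sequence_standard_path:
  assumes "m \<ge> 2" "n \<ge> 2" "\<theta> \<in> sector m n 0" "cutting_sequence m n \<theta> w" "\<not> periodic w"
  shows "standard_path m n w \<theta>"
proof -
  obtain T where T: "trajectory m n \<theta> T" and lab: "\<And>j. side_label m n (polyg T j) (in_edge T j) (w j)"
    using assms(4) unfolding cutting_sequence_def by blast
  obtain K Z where Z: "develops m n w K Z" "directed Z \<theta>" "spread Z \<theta>"
    using trajectory_develops[OF assms(1,2) T lab] trajectory_directed[OF assms(2) T]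
      trajectory_spread[OF assms(1,2) T assms(3) lab assms(5)] by blast
  have "admissible m n 0 w"
    using assms(3,4) unfolding admissible_def arrow_def by blast
  moreover have "pi / real n \<le> pi" using pi_div_le_pi_half[OF assms(2)] pi_gt_zero by linarith
  then have "0 \<le> \<theta>" "\<theta> \<le> pi" using assms(3) by (auto simp: sector_def)
  ultimately have "real 0 * pi / real n < \<theta> \<and> \<theta> < real (0 + 1) * pi / real n"
    using assms(2) by (intro admissible_direction[OF assms(1,2) _ _ Z]) auto
  then show ?thesis unfolding standard_path_def using Z by auto
qed

theorem proposition8p5:
  fixes m n :: nat and \<theta> :: real and w :: biword and a b :: "nat \<Rightarrow> nat"
  assumes "m \<ge> 2" and "n \<ge> 2" and "m * n \<ge> 6"
    and "\<theta> \<in> sector m n 0"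
    and "cutting_sequence m n \<theta> w"
    and "\<not> periodic w"
    and "sector_sequences m n w a b"
  shows "is_itinerary m n \<theta> (\<lambda>k. (a k, b k))"
proof -
  note mn = assms(1,2)
  obtain W where W0: "W 0 = w" "derived m n (W 0) (W 1)"
    and W: "\<And>k. k \<ge> 1 \<Longrightarrow> if odd k then \<exists>u. normalized n m (W k) u \<and> derived n m u (W (k + 1))
                else \<exists>u. normalized m n (W k) u \<and> derived m n u (W (k + 1))"
    and ab: "\<And>k. k \<ge> 1 \<Longrightarrow> a k \<in> {1..m - 1} \<and> b k \<in> {1..n - 1} \<and>
           admissible n m (a k) (W (2 * k - 1)) \<and> admissible m n (b k) (W (2 * k))"
    using assms(7) unfolding sector_sequences_def by blast
  define \<theta>s where "\<theta>s k = (farey m n ^^ k) \<theta>" for k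
  \<comment> \<open>One application of \<open>farey\<close> is two half steps, with \<open>m\<close>
    and \<open>n\<close> exchanged in the second. The word \<open>u\<close> is the one from which
    \<open>W (2 * k + 1)\<close> is derived; for \<open>k = 0\<close> it is
    \<open>w\<close>.\<close>
  have step: "\<theta>s k \<in> farey_sector m n (a (k + 1)) (b (k + 1)) \<and>
      (\<exists>u. standard_path m n u (\<theta>s (Suc k)) \<and> derived m n u (W (2 * Suc k + 1)))"
    if u: "standard_path m n u (\<theta>s k)" "derived m n u (W (2 * k + 1))" for u k
  proof -
    obtain v where v: "normalized n m (W (2 * k + 1)) v" "derived n m v (W (2 * k + 2))"
      using W[of "2 * k + 1"] by auto
    obtain u' where u': "normalized m n (W (2 * k + 2)) u'" "derived m n u' (W (2 * k + 3))"
      using W[of "2 * k + 2"] by (auto simp: numeral_3_eq_3)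
    have A: "a (k + 1) \<in> {1..m - 1}" "b (k + 1) \<in> {1..n - 1}"
      "admissible n m (a (k + 1)) (W (2 * k + 1))" "admissible m n (b (k + 1)) (W (2 * k + 2))"
      using ab[of "k + 1"] by auto
    note s1 = standard_path_step[OF mn u v(1) A(1,3)]
    note s2 = standard_path_step[OF mn(2,1) s1(2) v(2) u'(1) A(2,4)]
    have "\<theta>s k \<in> sector m n 0" using u(1) by (auto simp: standard_path_def sector_def)
    then have "\<theta>s k \<in> farey_sector m n (a (k + 1)) (b (k + 1))"
      unfolding farey_sector_def using s1(1) s2(1) by simp
    moreover have "\<theta>s (Suc k) = farey_half n m (farey_half m n (\<theta>s k))"
      by (simp add: \<theta>s_def farey_def)
    moreover have "2 * Suc k + 1 = 2 * k + 3" by simp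
    ultimately show ?thesis using s2(2) u'(2) by metis
  qed
  have "\<exists>u. standard_path m n u (\<theta>s k) \<and> derived m n u (W (2 * k + 1))" for k
  proof (induction k)
    case 0
    then show ?case using cutting_sequence_standard_path[OF mn assms(4-6)] W0
      by (auto simp: \<theta>s_def)
  qed (use step in blast)
  then have "\<theta>s k \<in> farey_sector m n (a (k + 1)) (b (k + 1))" for k using step by blast
  then have "(farey m n ^^ (k - 1)) \<theta> \<in> farey_sector m n (a k) (b k)" if "k \<ge> 1" for k
    using that unfolding \<theta>s_def by (metis le_add_diff_inverse2)
  then show ?thesis unfolding is_itinerary_def by simp
qed

end
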